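(* Let $n\ge1$, $\mu\in\mathbb{R}$, $\varepsilon\in\{1,-1\}$ and $0<p<p_n^{**}$. Breather solutions $u$ of the biharmonic nonlinear Schrödinger equation $$iu_t+\mu\Delta u-\Delta^2u=\varepsilon|u|^pu,\qquad (t,x)\in\mathbb{R}\times\mathbb{R}^n,$$ cannot exist in any of the following regimes: (1) $\varepsilon=1$ and $\mu\ge0$; (2) $\varepsilon=-1$ and either (i) $p<\frac8n<p_n^{**}$, $\mu\le0$ and $E_2[u]\ge0$, or (ii) $\frac8n<p<p_n^{**}$, $\mu\ge0$ and $E_2[u]\le0$; (3) $\varepsilon=\pm1$, $p=\frac8n$, $(E_2[u],\mu)\ne(0,0)$ and $\mu E_2[u]\le0$.
   Context: Here $p_n^{**}=\infty$ if $n\le4$ and $p_n^{**}=\frac{8}{n-4}$ if $n\ge5$. The energy is $$E_2[u]=\int_{\mathbb{R}^n}\Big(|\Delta u|^2+\mu|\nabla_xu|^2+\varepsilon\tfrac{2}{p+2}|u|^{p+2}\Big)dx .$$ Breather (in the weak sense, which includes standing waves): a solution $u:\mathbb{R}\times\mathbb{R}^n\to\mathbb{C}$, not identically zero, for which there exist $\tau,C,\gamma>0$ and $\alpha^*\ge0$ such that: (i) $u(t+\tau,x)=u(t,x)$ for all $(t,x)\in\mathbb{R}\times\mathbb{R}^n$; (ii) $u(t,\cdot)\in C^\infty(\mathbb{R}^n)\cap H^2(\mathbb{R}^n)$ for all $t\in\mathbb{R}$; (iii) $\sup_{t\in\mathbb{R}}|D_x^\alpha u(t,x)|\le Ce^{-\gamma|x|}$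 for all $x\in\mathbb{R}^n$ and all multi-indices $|\alpha|\le\alpha^*$. *)

theory Defs
  imports "HOL-Analysis.Analysis"
begin

definition partial :: "'a::euclidean_space \<Rightarrow> ('a \<Rightarrow> complex) \<Rightarrow> 'a \<Rightarrow> complex" where
  "partial b f x = vector_derivative (\<lambda>s. f (x + s *\<^sub>R b)) (at 0)"

text \<open>A multi-index \<open>\<alpha>\<close> is encoded by a list of standard basis vectors in which the
  \<open>i\<close>-th basis vector occurs \<open>\<alpha>\<^sub>i\<close> times; \<open>|\<alpha>|\<close> is the length of the list. The order of the list
  fixes an order of differentiation, which is immaterial for smooth functions.\<close>

abbreviation multi_indices :: "'a::euclidean_space list set" where
  "multi_indices \<equiv> lists Basis"

definition partials :: "'a::euclidean_space list \<Rightarrow> ('a \<Rightarrow> complex) \<Rightarrow> 'a \<Rightarrow> complex" where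
  "partials \<alpha> f = foldr partial \<alpha> f"

definition smooth :: "('a::euclidean_space \<Rightarrow> complex) \<Rightarrow> bool" where
  "smooth f \<longleftrightarrow>
     (\<forall>\<alpha>\<in>multi_indices. continuous_on UNIV (partials \<alpha> f) \<and>
        (\<forall>b\<in>Basis. \<forall>x. (\<lambda>s::real. partials \<alpha> f (x + s *\<^sub>R b)) differentiable (at 0)))"

definition laplacian :: "('a::euclidean_space \<Rightarrow> complex) \<Rightarrow> 'a \<Rightarrow> complex" where
  "laplacian f x = (\<Sum>b\<in>Basis. partial b (partial b f) x)"

definition gradient_norm :: "('a::euclidean_space \<Rightarrow> complex) \<Rightarrow> 'a \<Rightarrow> real" where
  "gradient_norm f x = sqrt (\<Sum>b\<in>Basis. (norm (partial b f x))\<^sup>2)"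

definition test_function :: "('a::euclidean_space \<Rightarrow> complex) \<Rightarrow> bool" where
  "test_function \<phi> \<longleftrightarrow> smooth \<phi> \<and> compact (closure {x. \<phi> x \<noteq> 0})"

definition L2 :: "('a::euclidean_space \<Rightarrow> complex) set" where
  "L2 = {f. f \<in> borel_measurable lborel \<and> integrable lborel (\<lambda>x. (norm (f x))\<^sup>2)}"

definition has_weak_partials ::
    "'a::euclidean_space list \<Rightarrow> ('a \<Rightarrow> complex) \<Rightarrow> ('a \<Rightarrow> complex) \<Rightarrow> bool" where
  "has_weak_partials \<alpha> f g \<longleftrightarrow>
     (\<forall>\<phi>. test_function \<phi> \<longrightarrow>
        (LINT x|lborel. f x * partials \<alpha> \<phi> x) = (- 1) ^ length \<alpha> * (LINT x|lborel. g x * \<phi> x))"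

definition H2 :: "('a::euclidean_space \<Rightarrow> complex) set" where
  "H2 = {f \<in> L2. \<forall>\<alpha>\<in>multi_indices. length \<alpha> \<le> 2 \<longrightarrow> (\<exists>g\<in>L2. has_weak_partials \<alpha> f g)}"

text \<open>For elements of \<open>H2\<close> the weak derivative is unique up to null sets, so the choice below does
  not affect the norm. In the norm, each mixed second derivative is counted once for each order of
  differentiation; the resulting norm is equivalent to every other usual \<open>H\<^sup>2\<close> norm.\<close>

definition weak_partials ::
    "'a::euclidean_space list \<Rightarrow> ('a \<Rightarrow> complex) \<Rightarrow> 'a \<Rightarrow> complex" where
  "weak_partials \<alpha> f = (SOME g. g \<in> L2 \<and> has_weak_partials \<alpha> f g)"

definition H2_norm :: "('a::euclidean_space \<Rightarrow> complex) \<Rightarrow> real" where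
  "H2_norm f =
     sqrt (\<Sum>\<alpha> | \<alpha> \<in> multi_indices \<and> length \<alpha> \<le> 2. LINT x|lborel. (norm (weak_partials \<alpha> f x))\<^sup>2)"

definition p_crit :: "nat \<Rightarrow> ereal" where
  "p_crit n = (if n \<le> 4 then \<infinity> else ereal (8 / (real n - 4)))"

definition energy :: "real \<Rightarrow> real \<Rightarrow> real \<Rightarrow> ('a::euclidean_space \<Rightarrow> complex) \<Rightarrow> real" where
  "energy \<mu> \<epsilon> p f =
     (LINT x|lborel. (norm (laplacian f x))\<^sup>2 + \<mu> * (gradient_norm f x)\<^sup>2
                       + \<epsilon> * (2 / (p + 2)) * norm (f x) powr (p + 2))"

text \<open>Solutions are the global \<open>H\<^sup>2\<close>-solutions on which the energy is defined: \<open>u\<close> is a continuous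
  curve in \<open>H\<^sup>2\<close> and, at every time, the equation
  \<open>i u\<^sub>t + \<mu> \<Delta>u - \<Delta>\<^sup>2u = \<epsilon> |u|\<^sup>p u\<close> holds in the sense of distributions on the space
  (equivalently, in \<open>H\<^sup>-\<^sup>2\<close>). No pointwise differentiability in time is required.\<close>

definition biharmonic_NLS_solution ::
    "real \<Rightarrow> real \<Rightarrow> real \<Rightarrow> (real \<Rightarrow> 'a::euclidean_space \<Rightarrow> complex) \<Rightarrow> bool" where
  "biharmonic_NLS_solution \<mu> \<epsilon> p u \<longleftrightarrow>
     (\<forall>t. u t \<in> H2) \<and>
     (\<forall>t. ((\<lambda>s. H2_norm (\<lambda>x. u s x - u t x)) \<longlongrightarrow> 0) (at t)) \<and>
     (\<forall>\<psi>. test_function \<psi> \<longrightarrow>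
        (\<forall>t. \<exists>d. ((\<lambda>s. LINT x|lborel. u s x * \<psi> x) has_vector_derivative d) (at t) \<and>
             \<i> * d + (LINT x|lborel. u t x * (of_real \<mu> * laplacian \<psi> x - laplacian (laplacian \<psi>) x))
               = of_real \<epsilon> * (LINT x|lborel. of_real (norm (u t x) powr p) * u t x * \<psi> x)))"

definition breather ::
    "real \<Rightarrow> real \<Rightarrow> real \<Rightarrow> (real \<Rightarrow> 'a::euclidean_space \<Rightarrow> complex) \<Rightarrow> bool" where
  "breather \<mu> \<epsilon> p u \<longleftrightarrow>
     biharmonic_NLS_solution \<mu> \<epsilon> p u \<and>
     (\<exists>t x. u t x \<noteq> 0) \<and>
     (\<exists>\<tau> C \<gamma> :: real. \<exists>k :: nat. \<tau> > 0 \<and> C > 0 \<and> \<gamma> > 0 \<and>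
        (\<forall>t x. u (t + \<tau>) x = u t x) \<and>
        (\<forall>t. smooth (u t) \<and> u t \<in> H2) \<and>
        (\<forall>x. \<forall>\<alpha>\<in>multi_indices. length \<alpha> \<le> k \<longrightarrow>
           (\<forall>t. norm (partials \<alpha> (u t) x) \<le> C * exp (- \<gamma> * norm x))))"

end

(*
  The virial (Morawetz) identity says that along a time-periodic solution the integral over one period of
    V = 4 |Lap u|^2 + 2 mu |grad u|^2 + eps (n p / (p + 2)) |u|^(p+2)   (integrated over space)
  vanishes. Combined with conservation of the energy, V(t) has a constant sign in each of the listed regimes
  and vanishes only if u(t) does; so u vanishes at some time, and then at all times because the mass is conserved.

  The solution is only a continuous curve in H^2 satisfying the equation in H^-2, so neither law follows by
  differentiating directly. Both are obtained from pairings of the solution at two different times, which are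
  C^1 functions of these times.
  For the energy, differentiate Im <u(t+r), u(t)> along t and compare with its first-order behaviour as
  r -> 0; the remainder is controlled by |u(t+r) - u(t)|^2 = o(r).
  For the virial identity, the generator x . grad is replaced by a genuine dilation u(c x), which maps H^2 to
  itself and commutes with the operators up to powers of c: one differentiates Im <u(t, c x), u(t, x)>,
  integrates over a period, divides by c - 1 and lets c -> 1. The nonlinear term is handled without
  differentiating it: its error is bounded by the squared L^2 norm of u(c x) - u(x), which is o(c - 1) by the
  exponential decay.
*)
theory Submission
  imports Defs "HOL-Real_Asymp.Real_Asymp"
begin

text \<open>The decay bound may be available for k = 0 only, so it controls \<open>u\<close> but
  none of its derivatives: x . grad u need not be square integrable, let alone lie in H^2, and
  cannot be inserted as a test function. A dilate of \<open>u t\<close> always can. Decay enters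
  three times: the uniform bound makes the nonlinearity Lipschitz on L^2, the exponential tail makes
  the squared L^2 norm of u(c x) - u(x) negligible against c - 1 after splitting space at a radius R
  with c - 1 = R^-4, and decay excludes nonzero functions that are constant along lines. The
  coefficients 4, 2 and n p / (p + 2) of V are the derivatives at c = 1 of c^2 - c^-2, c - c^-1 and
  (p / (p + 2)) (1 - c^-n); a dilate and its adjoint contribute with opposite signs. Conservation of
  the energy allows either the integral of |u|^(p+2) or that of |grad u|^2 to be eliminated from V,
  which exposes its sign. The thresholds n p = 4 and n p = 8 are the zeros of the coefficients left
  over.\<close>

abbreviation dil :: "real \<Rightarrow> ('a::real_vector \<Rightarrow> 'b) \<Rightarrow> 'a \<Rightarrow> 'b" where
  "dil c f \<equiv> \<lambda>x. f (c *\<^sub>R x)"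

section \<open>Partial derivatives and smooth functions\<close>

definition has_partial ::
    "'a::euclidean_space \<Rightarrow> ('a \<Rightarrow> complex) \<Rightarrow> ('a \<Rightarrow> complex) \<Rightarrow> bool" where
  "has_partial b f f' \<longleftrightarrow> (\<forall>x. ((\<lambda>s::real. f (x + s *\<^sub>R b)) has_vector_derivative f' x) (at 0))"

lemma has_partial_imp_partial: "has_partial b f f' \<Longrightarrow> partial b f = f'"
  unfolding has_partial_def partial_def by (auto intro!: ext vector_derivative_at)

lemma has_partial_iff:
  "has_partial b f (partial b f) \<longleftrightarrow> (\<forall>x. (\<lambda>s::real. f (x + s *\<^sub>R b)) differentiable (at 0))"
  unfolding has_partial_def partial_def by (auto simp: vector_derivative_works)

text \<open>\<open>has_partial\<close> speaks of the parameter value 0 only; moving the base point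
  along b turns this into a derivative along the whole line, as the fundamental theorem of calculus
  needs it.\<close>

lemma has_partial_line:
  assumes "has_partial b f f'"
  shows "((\<lambda>s::real. f (x + s *\<^sub>R b)) has_vector_derivative f' (x + s0 *\<^sub>R b)) (at s0)"
proof -
  have "((\<lambda>s::real. f ((x + s0 *\<^sub>R b) + s *\<^sub>R b)) has_vector_derivative f' (x + s0 *\<^sub>R b)) (at 0)"
    using assms by (auto simp: has_partial_def)
  then have "(((\<lambda>s. f ((x + s0 *\<^sub>R b) + s *\<^sub>R b)) \<circ> (\<lambda>s. s - s0))
      has_vector_derivative (1 *\<^sub>R f' (x + s0 *\<^sub>R b))) (at s0)"
    by (intro vector_diff_chain_at) (auto intro!: derivative_eq_intros simp: has_vector_derivative_def)
  then show ?thesis by (simp add: o_def algebra_simps)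
qed

lemma has_partial_add: "has_partial b f f' \<Longrightarrow> has_partial b g g' \<Longrightarrow> has_partial b (\<lambda>x. f x + g x) (\<lambda>x. f' x + g' x)"
  unfolding has_partial_def by (auto intro!: has_vector_derivative_add)

lemma has_partial_diff: "has_partial b f f' \<Longrightarrow> has_partial b g g' \<Longrightarrow> has_partial b (\<lambda>x. f x - g x) (\<lambda>x. f' x - g' x)"
  unfolding has_partial_def by (auto intro!: has_vector_derivative_diff)

lemma has_partial_const: "has_partial b (\<lambda>x. c) (\<lambda>x. 0)"
  unfolding has_partial_def by auto

lemma has_partial_mult:
  assumes "has_partial b f f'" "has_partial b g g'"
  shows "has_partial b (\<lambda>x. f x * g x) (\<lambda>x. f' x * g x + f x * g' x)"
  unfolding has_partial_def
proof
  fix x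
  have "((\<lambda>s. f (x + s *\<^sub>R b) * g (x + s *\<^sub>R b)) has_vector_derivative
      (f (x + 0 *\<^sub>R b) * g' x + f' x * g (x + 0 *\<^sub>R b))) (at 0)"
    using assms unfolding has_partial_def by (intro has_vector_derivative_mult) auto
  then show "((\<lambda>s. f (x + s *\<^sub>R b) * g (x + s *\<^sub>R b)) has_vector_derivative
      (f' x * g x + f x * g' x)) (at 0)" by (simp add: add.commute)
qed

lemma has_partial_cnj: "has_partial b f f' \<Longrightarrow> has_partial b (\<lambda>x. cnj (f x)) (\<lambda>x. cnj (f' x))"
  unfolding has_partial_def by (auto intro!: has_vector_derivative_cnj)

lemma has_partial_dilate:
  assumes "has_partial b f f'"
  shows "has_partial b (dil c f) (\<lambda>x. of_real c * f' (c *\<^sub>R x))"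
  unfolding has_partial_def
proof
  fix x
  have "((\<lambda>s. f (c *\<^sub>R x + s *\<^sub>R b)) has_vector_derivative f' (c *\<^sub>R x)) (at (c * 0))"
    using assms by (simp add: has_partial_def)
  then have "(((\<lambda>s. f (c *\<^sub>R x + s *\<^sub>R b)) \<circ> (\<lambda>s. c * s)) has_vector_derivative (c *\<^sub>R f' (c *\<^sub>R x))) (at 0)"
    by (intro vector_diff_chain_at) (auto intro!: derivative_eq_intros simp: has_vector_derivative_def)
  then show "((\<lambda>s. f (c *\<^sub>R (x + s *\<^sub>R b))) has_vector_derivative of_real c * f' (c *\<^sub>R x)) (at 0)"
    by (simp add: o_def algebra_simps scaleR_conv_of_real)
qed

text \<open>Chain rule for a one-dimensional profile \<open>h\<close> composed with an affine
  function of x; the factors of the bump functions have this shape.\<close>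

lemma has_partial_ridge:
  fixes h h' :: "real \<Rightarrow> real"
  assumes "\<And>y. (h has_real_derivative h' y) (at y)"
  shows "has_partial b (\<lambda>x. of_real (h (a * (x \<bullet> e) + d))) (\<lambda>x. of_real (a * (b \<bullet> e)) * of_real (h' (a * (x \<bullet> e) + d)))"
  unfolding has_partial_def
proof
  fix x
  have "((\<lambda>s::real. h (a * ((x + s *\<^sub>R b) \<bullet> e) + d)) has_real_derivative h' (a * (x \<bullet> e) + d) * (a * (b \<bullet> e))) (at 0)"
    by (rule DERIV_chain2[where f = h])
      (use assms[of "a * (x \<bullet> e) + d"] in \<open>auto intro!: derivative_eq_intros simp: inner_simps\<close>)
  then have "((\<lambda>s::real. complex_of_real (h (a * ((x + s *\<^sub>R b) \<bullet> e) + d))) has_vector_derivative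
      of_real (h' (a * (x \<bullet> e) + d) * (a * (b \<bullet> e)))) (at 0)"
    by (intro has_vector_derivative_of_real) (simp add: has_real_derivative_iff_has_vector_derivative)
  then show "((\<lambda>s. complex_of_real (h (a * ((x + s *\<^sub>R b) \<bullet> e) + d))) has_vector_derivative
      complex_of_real (a * (b \<bullet> e)) * complex_of_real (h' (a * (x \<bullet> e) + d))) (at 0)"
    by (simp add: mult.commute)
qed

text \<open>Peels off the innermost derivative first, whereas \<^const>\<open>smooth\<close> speaks about the outermost one;
  this makes closure under products a plain induction on \<open>k\<close>.\<close>

primrec Ck :: "nat \<Rightarrow> ('a::euclidean_space \<Rightarrow> complex) \<Rightarrow> bool" where
  "Ck 0 f = continuous_on UNIV f"
| "Ck (Suc k) f = (continuous_on UNIV f \<and> (\<forall>b\<in>Basis. has_partial b f (partial b f) \<and> Ck k (partial b f)))"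

lemma Ck_SucI:
  assumes "continuous_on UNIV f" "\<And>b. b \<in> Basis \<Longrightarrow> \<exists>f'. has_partial b f f' \<and> Ck k f'"
  shows "Ck (Suc k) f"
  using assms has_partial_imp_partial by fastforce

lemma Ck_continuous: "Ck k f \<Longrightarrow> continuous_on UNIV f"
  by (cases k) auto

lemma Ck_Suc_imp: "Ck (Suc k) f \<Longrightarrow> Ck k f"
  by (induction k arbitrary: f) auto

lemma partials_simps [simp]:
  "partials [] f = f" "partials (b # \<alpha>) f = partial b (partials \<alpha> f)"
  "partials (\<alpha> @ [b]) f = partials \<alpha> (partial b f)"
  by (simp_all add: partials_def)

text \<open>\<open>Ck\<close> exposes the innermost derivative, which is the last entry of the list,
  hence the reversed induction. The strict bound keeps one order in reserve, so that the last
  derivative taken can itself be differentiated.\<close>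

lemma Ck_partials:
  assumes "\<alpha> \<in> multi_indices" "Ck k f" "length \<alpha> < k"
  shows "continuous_on UNIV (partials \<alpha> f) \<and> (\<forall>b\<in>Basis. has_partial b (partials \<alpha> f) (partial b (partials \<alpha> f)))"
  using assms
proof (induction \<alpha> arbitrary: k f rule: rev_induct)
  case Nil
  then show ?case by (cases k) auto
next
  case (snoc b \<alpha>)
  then obtain j where "k = Suc j" by (cases k) auto
  with snoc show ?case by auto
qed

lemma smooth_partial: "smooth f \<Longrightarrow> b \<in> Basis \<Longrightarrow> smooth (partial b f)"
  unfolding smooth_def
proof
  fix \<alpha> :: "'a list"
  assume *: "\<forall>\<alpha>\<in>multi_indices. continuous_on UNIV (partials \<alpha> f) \<and>
        (\<forall>b\<in>Basis. \<forall>x. (\<lambda>s::real. partials \<alpha> f (x + s *\<^sub>R b)) differentiable (at 0))" "b \<in> Basis" "\<alpha> \<in> multi_indices"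
  then have "\<alpha> @ [b] \<in> multi_indices" by auto
  with *(1) show "continuous_on UNIV (partials \<alpha> (partial b f)) \<and>
        (\<forall>ba\<in>Basis. \<forall>x. (\<lambda>s::real. partials \<alpha> (partial b f) (x + s *\<^sub>R ba)) differentiable (at 0))"
    by (metis partials_simps(3))
qed

lemma smooth_continuous: "smooth f \<Longrightarrow> continuous_on UNIV f"
  unfolding smooth_def by (metis lists.Nil partials_simps(1))

lemma smooth_has_partial: "smooth f \<Longrightarrow> b \<in> Basis \<Longrightarrow> has_partial b f (partial b f)"
  unfolding smooth_def has_partial_iff by (metis lists.Nil partials_simps(1))

lemma smooth_Ck: "smooth f \<Longrightarrow> Ck k f"
  by (induction k arbitrary: f) (auto simp: smooth_continuous smooth_has_partial smooth_partial)

text \<open>The bridge between the two orders of peeling off derivatives: closure properties are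
  proved for every \<open>Ck\<close> and transferred to \<open>smooth\<close> through this
  equivalence.\<close>

lemma smooth_iff: "smooth f \<longleftrightarrow> (\<forall>k. Ck k f)"
proof
  assume *: "\<forall>k. Ck k f"
  show "smooth f"
    unfolding smooth_def has_partial_iff[symmetric] using Ck_partials[OF _ *[rule_format]] lessI by blast
qed (auto simp: smooth_Ck)

lemma smooth_partials: "smooth f \<Longrightarrow> \<alpha> \<in> multi_indices \<Longrightarrow> smooth (partials \<alpha> f)"
  by (induction \<alpha>) (auto simp: smooth_partial)

lemma Ck_const: "Ck k (\<lambda>x. c)"
  by (induction k arbitrary: c) (auto intro!: Ck_SucI simp del: Ck.simps(2) intro: has_partial_const)

lemma Ck_add: "Ck k f \<Longrightarrow> Ck k g \<Longrightarrow> Ck k (\<lambda>x. f x + g x)"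
proof (induction k arbitrary: f g)
  case (Suc k)
  show ?case
    by (rule Ck_SucI) (use Suc in \<open>auto intro!: continuous_intros has_partial_add exI\<close>)
qed (auto intro!: continuous_intros)

lemma Ck_mult: "Ck k f \<Longrightarrow> Ck k g \<Longrightarrow> Ck k (\<lambda>x. f x * g x)"
proof (induction k arbitrary: f g)
  case (Suc k)
  then have "Ck k f" "Ck k g" by (blast dest: Ck_Suc_imp)+
  with Suc show ?case
    by (intro Ck_SucI) (auto intro!: continuous_intros has_partial_mult exI Ck_add)
qed (auto intro!: continuous_intros)

lemma Ck_cnj: "Ck k f \<Longrightarrow> Ck k (\<lambda>x. cnj (f x))"
proof (induction k arbitrary: f)
  case (Suc k)
  show ?case
    by (rule Ck_SucI) (use Suc in \<open>auto intro!: continuous_intros has_partial_cnj exI\<close>)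
qed (auto intro!: continuous_intros)

lemma Ck_dilate: "Ck k f \<Longrightarrow> Ck k (dil c f)"
proof (induction k arbitrary: f)
  case 0
  show ?case
    unfolding Ck.simps by (rule continuous_on_compose2[OF Ck_continuous[OF 0]]) (auto intro!: continuous_intros)
next
  case (Suc k)
  show ?case
  proof (rule Ck_SucI)
    show "continuous_on UNIV (dil c f)"
      by (rule continuous_on_compose2[OF Ck_continuous[OF Suc.prems]]) (auto intro!: continuous_intros)
    show "\<exists>f'. has_partial b (dil c f) f' \<and> Ck k f'" if "b \<in> Basis" for b
    proof -
      have "has_partial b f (partial b f)" "Ck k (partial b f)"
        using Suc.prems that by auto
      then have "has_partial b (dil c f) (\<lambda>x. of_real c * partial b f (c *\<^sub>R x)) \<and>
        Ck k (\<lambda>x. of_real c * partial b f (c *\<^sub>R x))"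
        by (intro conjI has_partial_dilate Ck_mult Ck_const Suc.IH)
      then show ?thesis by blast
    qed
  qed
qed

lemma Ck_prod: "finite I \<Longrightarrow> (\<And>i. i \<in> I \<Longrightarrow> Ck k (f i)) \<Longrightarrow> Ck k (\<lambda>x. \<Prod>i\<in>I. f i x)"
  by (induction I rule: finite_induct) (auto intro!: Ck_const Ck_mult)

lemma Ck_sum: "finite I \<Longrightarrow> (\<And>i. i \<in> I \<Longrightarrow> Ck k (f i)) \<Longrightarrow> Ck k (\<lambda>x. \<Sum>i\<in>I. f i x)"
  by (induction I rule: finite_induct) (auto intro!: Ck_const Ck_add)

section \<open>Closure properties and differentiation rules for smooth functions\<close>

lemma smooth_const: "smooth (\<lambda>x::'a::euclidean_space. z)"
  and smooth_add: "smooth f \<Longrightarrow> smooth g \<Longrightarrow> smooth (\<lambda>x. f x + g x)"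
  and smooth_mult: "smooth f \<Longrightarrow> smooth g \<Longrightarrow> smooth (\<lambda>x. f x * g x)"
  and smooth_cnj: "smooth f \<Longrightarrow> smooth (\<lambda>x. cnj (f x))"
  and smooth_dilate: "smooth f \<Longrightarrow> smooth (dil c f)"
  and smooth_sum: "finite I \<Longrightarrow> (\<And>i. i \<in> I \<Longrightarrow> smooth (F i)) \<Longrightarrow> smooth (\<lambda>x. \<Sum>i\<in>I. F i x)"
  by (auto simp: smooth_iff intro!: Ck_const Ck_add Ck_mult Ck_cnj Ck_dilate Ck_sum)

lemma smooth_diff: "smooth f \<Longrightarrow> smooth g \<Longrightarrow> smooth (\<lambda>x. f x - g x)"
  using smooth_add[of f "\<lambda>x. (-1) * g x"] smooth_mult[OF smooth_const[of "-1"], of g] by simp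

lemma smooth_laplacian: "smooth f \<Longrightarrow> smooth (laplacian f)"
  unfolding laplacian_def[abs_def] by (intro smooth_sum smooth_partial) auto

lemma partial_diff:
  "smooth f \<Longrightarrow> smooth g \<Longrightarrow> b \<in> Basis \<Longrightarrow> partial b (\<lambda>x. f x - g x) = (\<lambda>x. partial b f x - partial b g x)"
  by (intro has_partial_imp_partial has_partial_diff smooth_has_partial)

lemma partial_mult:
  "smooth f \<Longrightarrow> smooth g \<Longrightarrow> b \<in> Basis \<Longrightarrow>
    partial b (\<lambda>x. f x * g x) = (\<lambda>x. partial b f x * g x + f x * partial b g x)"
  by (intro has_partial_imp_partial has_partial_mult smooth_has_partial)

lemma partial_add:
  "smooth f \<Longrightarrow> smooth g \<Longrightarrow> b \<in> Basis \<Longrightarrow> partial b (\<lambda>x. f x + g x) = (\<lambda>x. partial b f x + partial b g x)"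
  by (intro has_partial_imp_partial has_partial_add smooth_has_partial)

lemma partial_cnj:
  "smooth f \<Longrightarrow> b \<in> Basis \<Longrightarrow> partial b (\<lambda>x. cnj (f x)) = (\<lambda>x. cnj (partial b f x))"
  by (intro has_partial_imp_partial has_partial_cnj smooth_has_partial)

lemma partial_dilate:
  "smooth f \<Longrightarrow> b \<in> Basis \<Longrightarrow> partial b (dil c f) = (\<lambda>x. of_real c * partial b f (c *\<^sub>R x))"
  by (intro has_partial_imp_partial has_partial_dilate smooth_has_partial)

lemma partial_cmult:
  "smooth f \<Longrightarrow> b \<in> Basis \<Longrightarrow> partial b (\<lambda>x. c * f x) = (\<lambda>x. c * partial b f x)"
  using partial_mult[OF smooth_const, of f b] has_partial_imp_partial[OF has_partial_const, of b] by simp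

lemma partials_diff:
  "\<alpha> \<in> multi_indices \<Longrightarrow> smooth f \<Longrightarrow> smooth g \<Longrightarrow> partials \<alpha> (\<lambda>x. f x - g x) = (\<lambda>x. partials \<alpha> f x - partials \<alpha> g x)"
  by (induction \<alpha>) (auto simp: partial_diff smooth_partials)

lemma partials_dilate:
  "\<alpha> \<in> multi_indices \<Longrightarrow> smooth f \<Longrightarrow>
    partials \<alpha> (dil c f) = (\<lambda>x. of_real c ^ length \<alpha> * partials \<alpha> f (c *\<^sub>R x))"
  by (induction \<alpha>) (auto simp: partial_cmult partial_dilate smooth_partials smooth_dilate algebra_simps)

lemma laplacian_cnj: "smooth f \<Longrightarrow> laplacian (\<lambda>x. cnj (f x)) = (\<lambda>x. cnj (laplacian f x))"
  by (auto simp: laplacian_def partial_cnj smooth_partial fun_eq_iff)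

lemma laplacian_dilate: "smooth f \<Longrightarrow> laplacian (dil c f) = (\<lambda>x. of_real (c\<^sup>2) * laplacian f (c *\<^sub>R x))"
  by (auto simp: laplacian_def partial_dilate partial_cmult smooth_partial smooth_dilate fun_eq_iff
     sum_distrib_left power2_eq_square mult.assoc)

lemma laplacian_mult:
  assumes "smooth f" "smooth g"
  shows "laplacian (\<lambda>x. f x * g x) = (\<lambda>x. laplacian f x * g x + 2 * (\<Sum>b\<in>Basis. partial b f x * partial b g x) + f x * laplacian g x)"
proof
  fix x
  have "partial b (partial b (\<lambda>x. f x * g x)) x = partial b (partial b f) x * g x + 2 * (partial b f x * partial b g x) + f x * partial b (partial b g) x"
    if "b \<in> Basis" for b
    using assms that by (simp add: partial_mult partial_add smooth_partial smooth_mult algebra_simps)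
  then show "laplacian (\<lambda>x. f x * g x) x = laplacian f x * g x + 2 * (\<Sum>b\<in>Basis. partial b f x * partial b g x) + f x * laplacian g x"
    by (simp add: laplacian_def sum.distrib sum_distrib_left sum_distrib_right)
qed

section \<open>Test functions\<close>

lemma test_functionI: "smooth f \<Longrightarrow> bounded {x. f x \<noteq> 0} \<Longrightarrow> test_function f"
  by (simp add: test_function_def)

lemma test_function_bounded: "test_function f \<Longrightarrow> bounded {x. f x \<noteq> 0}"
  by (simp add: test_function_def)

lemma test_function_smooth: "test_function f \<Longrightarrow> smooth f"
  by (simp add: test_function_def)

text \<open>Off the closed support of \<open>f\<close>, the line through x stays in an open set
  where \<open>f\<close> vanishes for small parameters, so the derivative there is 0.\<close>

lemma partial_support: "{x. partial b f x \<noteq> 0} \<subseteq> closure {x. f x \<noteq> 0}"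
proof
  fix x assume *: "x \<in> {x. partial b f x \<noteq> 0}"
  show "x \<in> closure {x. f x \<noteq> 0}"
  proof (rule ccontr)
    assume n: "x \<notin> closure {x. f x \<noteq> 0}"
    let ?S = "(\<lambda>s::real. x + s *\<^sub>R b) -` (- closure {x. f x \<noteq> 0})"
    have S: "open ?S"
      by (intro open_vimage) (auto intro!: continuous_intros)
    have 0: "0 \<in> ?S" using n by simp
    have "f (x + s *\<^sub>R b) = 0" if "s \<in> ?S" for s
      using that closure_subset[of "{x. f x \<noteq> 0}"] by auto
    then have "((\<lambda>s. f (x + s *\<^sub>R b)) has_vector_derivative 0) (at 0)"
      by (intro has_vector_derivative_transform_within_open[OF has_vector_derivative_const S 0]) auto
    then have "partial b f x = 0" unfolding partial_def by (rule vector_derivative_at)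
    with * show False by simp
  qed
qed

lemma test_function_partial: "test_function f \<Longrightarrow> b \<in> Basis \<Longrightarrow> test_function (partial b f)"
  using partial_support[of b f] unfolding test_function_def compact_closure
  by (metis bounded_closure bounded_subset smooth_partial)

lemma test_function_partials: "test_function f \<Longrightarrow> \<alpha> \<in> multi_indices \<Longrightarrow> test_function (partials \<alpha> f)"
  by (induction \<alpha>) (auto simp: test_function_partial)

lemma test_function_mult: "test_function f \<Longrightarrow> smooth g \<Longrightarrow> test_function (\<lambda>x. f x * g x)"
  unfolding test_function_def compact_closure
  by (auto intro!: smooth_mult elim: bounded_subset)

lemma test_function_sum:
  "finite I \<Longrightarrow> (\<And>i. i \<in> I \<Longrightarrow> test_function (F i)) \<Longrightarrow> test_function (\<lambda>x. \<Sum>i\<in>I. F i x)"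
proof -
  assume *: "finite I" "\<And>i. i \<in> I \<Longrightarrow> test_function (F i)"
  have "bounded (\<Union>i\<in>I. {x. F i x \<noteq> 0})"
    using * by (intro bounded_UN) (auto intro!: test_function_bounded)
  moreover have "{x. (\<Sum>i\<in>I. F i x) \<noteq> 0} \<subseteq> (\<Union>i\<in>I. {x. F i x \<noteq> 0})"
    by (auto dest: sum.not_neutral_contains_not_neutral)
  ultimately show ?thesis
    using * by (intro test_functionI smooth_sum) (auto intro: test_function_smooth bounded_subset)
qed

lemma test_function_laplacian: "test_function f \<Longrightarrow> test_function (laplacian f)"
  unfolding laplacian_def[abs_def] by (intro test_function_sum test_function_partial) auto

section \<open>Bump functions\<close>

text \<open>The functions \<open>P(1/x) exp(-1/x)\<close>, extended by \<open>0\<close> to \<open>x \<le> 0\<close>, are closed under differentiation.\<close>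

definition flat :: "real poly \<Rightarrow> real \<Rightarrow> real" where
  "flat P x = (if x > 0 then poly P (1 / x) * exp (- (1 / x)) else 0)"

lemma poly_exp_neg_tendsto: "((\<lambda>y. poly P y * exp (- y)) \<longlongrightarrow> (0::real)) at_top"
proof -
  have "((\<lambda>y. \<Sum>i\<le>degree P. coeff P i * (y ^ i / exp y)) \<longlongrightarrow> (\<Sum>i\<le>degree P. coeff P i * 0)) at_top"
    by (intro tendsto_intros tendsto_power_div_exp_0)
  then show ?thesis
    by (simp add: poly_altdef sum_distrib_right exp_minus divide_inverse mult.assoc)
qed

lemma flat_tendsto: "(flat P \<longlongrightarrow> 0) (at 0)"
proof -
  have "((\<lambda>x. poly P (1 / x) * exp (- (1 / x))) \<longlongrightarrow> 0) (at_right 0)"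
    by (rule filterlim_compose[OF poly_exp_neg_tendsto]) real_asymp
  then have "(flat P \<longlongrightarrow> 0) (at_right 0)"
    by (rule Lim_transform_eventually) (auto simp: flat_def eventually_at_filter)
  moreover have "(flat P \<longlongrightarrow> 0) (at_left 0)"
    by (rule Lim_transform_eventually[OF tendsto_const]) (auto simp: flat_def eventually_at_filter)
  ultimately show ?thesis using filterlim_split_at by blast
qed

text \<open>With y = 1/x the chain rule gives y^2 (P(y) - P'(y)) exp(-y), which is the stated
  polynomial. Only x = 0 needs a separate argument.\<close>

lemma flat_deriv: "(flat P has_real_derivative flat ([:0, 0, 1:] * (P - pderiv P)) x) (at x)"
proof -
  consider "x > 0" | "x < 0" | "x = 0" by linarith
  then show ?thesis
  proof cases
    case 1
    have "((\<lambda>x. poly P (1 / x) * exp (- (1 / x))) has_real_derivative flat ([:0, 0, 1:] * (P - pderiv P)) x) (at x)"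
      using 1 by (auto intro!: derivative_eq_intros DERIV_chain2[where f = "poly P"] simp: flat_def field_simps power2_eq_square)
    then show ?thesis
      by (rule has_field_derivative_transform_within_open[of _ _ _ "{0<..}"]) (use 1 in \<open>auto simp: flat_def\<close>)
  next
    case 2
    have "((\<lambda>x. 0) has_real_derivative flat ([:0, 0, 1:] * (P - pderiv P)) x) (at x)"
      using 2 by (auto simp: flat_def)
    then show ?thesis
      by (rule has_field_derivative_transform_within_open[of _ _ _ "{..<0}"]) (use 2 in \<open>auto simp: flat_def\<close>)
  next
    case 3
    \<comment> \<open>Dividing by h multiplies the polynomial in 1/h by its variable, so the
      difference quotient at 0 is again a \<open>flat\<close> function and tends to 0.\<close>
    have "flat ([:0, 1:] * P) = (\<lambda>h. flat P h / h)"
      by (auto simp: flat_def fun_eq_iff)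
    then have "((\<lambda>h. (flat P (0 + h) - flat P 0) / h) \<longlongrightarrow> 0) (at 0)"
      using flat_tendsto[of "[:0, 1:] * P"] by (simp add: flat_def[of P 0])
    then show ?thesis
      using 3 by (simp add: DERIV_def flat_def[of _ 0])
  qed
qed

text \<open>The induction ranges over all polynomials at once, because differentiation changes
  \<open>P\<close>.\<close>

lemma Ck_flat: "Ck k (\<lambda>x. of_real (flat P (a * (x \<bullet> e) + d)))"
proof (induction k arbitrary: P)
  case 0
  have "continuous_on UNIV (flat P)"
    by (intro continuous_at_imp_continuous_on ballI DERIV_isCont[OF flat_deriv])
  show ?case
    unfolding Ck.simps by (intro continuous_intros continuous_on_compose2[OF \<open>continuous_on UNIV (flat P)\<close>]) auto
next
  case (Suc k)
  have "continuous_on UNIV (flat P)"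
    by (intro continuous_at_imp_continuous_on ballI DERIV_isCont[OF flat_deriv])
  have cont: "continuous_on UNIV (\<lambda>x. complex_of_real (flat P (a * (x \<bullet> e) + d)))"
    by (intro continuous_intros continuous_on_compose2[OF \<open>continuous_on UNIV (flat P)\<close>]) auto
  show ?case
  proof (rule Ck_SucI[OF cont])
    fix b :: 'a assume "b \<in> Basis"
    show "\<exists>f'. has_partial b (\<lambda>x. complex_of_real (flat P (a * (x \<bullet> e) + d))) f' \<and> Ck k f'"
      by (rule exI, rule conjI, rule has_partial_ridge[where h = "flat P", OF flat_deriv], rule Ck_mult[OF Ck_const Suc])
  qed
qed

text \<open>A smooth substitute for the indicator of \<open>box l r\<close>. The factor
  \<open>m\<close> magnifies the distances to the faces, so that increasing \<open>m\<close> pushes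
  the values inside the box towards 1.\<close>

definition bump :: "real \<Rightarrow> 'a::euclidean_space \<Rightarrow> 'a \<Rightarrow> 'a \<Rightarrow> complex" where
  "bump m l r x = (\<Prod>b\<in>Basis. of_real (flat 1 (m * (x \<bullet> b - l \<bullet> b))) * of_real (flat 1 (m * (r \<bullet> b - x \<bullet> b))))"

lemma flat_1: "flat 1 x = (if x > 0 then exp (- (1 / x)) else 0)"
  by (simp add: flat_def)

lemma smooth_bump: "smooth (bump m l r)"
proof -
  have "Ck k (\<lambda>x. complex_of_real (flat 1 (m * (x \<bullet> b - l \<bullet> b))) * of_real (flat 1 (m * (r \<bullet> b - x \<bullet> b))))" for k and b :: 'a
    using Ck_mult[OF Ck_flat[of k 1 m b "- (m * (l \<bullet> b))"] Ck_flat[of k 1 "- m" b "m * (r \<bullet> b)"]]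
    by (simp add: algebra_simps)
  then show ?thesis
    unfolding smooth_iff bump_def[abs_def] by (intro allI Ck_prod) auto
qed

lemma bump_eq_0:
  assumes "m > 0" "x \<notin> box l r"
  shows "bump m l r x = 0"
proof -
  obtain b where b: "b \<in> Basis" "x \<bullet> b \<le> l \<bullet> b \<or> r \<bullet> b \<le> x \<bullet> b"
    using assms(2) by (auto simp: mem_box not_less)
  then have "flat 1 (m * (x \<bullet> b - l \<bullet> b)) = 0 \<or> flat 1 (m * (r \<bullet> b - x \<bullet> b)) = 0"
    using assms(1) by (auto simp: flat_1 zero_less_mult_iff)
  with b show ?thesis
    by (auto simp: bump_def)
qed

lemma bump_tendsto:
  assumes "x \<in> box l r"
  shows "(\<lambda>k. bump (real (Suc k)) l r x) \<longlonglongrightarrow> 1"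
proof -
  have *: "(\<lambda>k. flat 1 (real (Suc k) * y)) \<longlonglongrightarrow> 1" if "y > 0" for y
  proof -
    have "(\<lambda>k. exp (- (1 / (real (Suc k) * y)))) \<longlonglongrightarrow> 1"
      using that by real_asymp
    then show ?thesis using that by (simp add: flat_1 zero_less_mult_iff)
  qed
  have "(\<lambda>k. bump (real (Suc k)) l r x) \<longlonglongrightarrow> (\<Prod>b\<in>(Basis::'a set). of_real 1 * of_real 1)"
    unfolding bump_def using assms by (intro tendsto_intros *) (auto simp: mem_box)
  then show ?thesis by simp
qed

lemma norm_bump_le: "norm (bump m l r x) \<le> 1"
proof -
  have "norm (flat 1 y) \<le> 1" for y by (auto simp: flat_1)
  then show ?thesis
    unfolding bump_def prod_norm[symmetric] norm_mult
    by (intro prod_le_1) (auto intro!: mult_le_one)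
qed

lemma test_function_bump: "m > 0 \<Longrightarrow> test_function (bump m l r)"
  by (rule test_functionI[OF smooth_bump], rule bounded_subset[OF bounded_box[of l r]])
    (use bump_eq_0 in blast)

section \<open>Square-integrable functions\<close>

definition sqn :: "('a::euclidean_space \<Rightarrow> complex) \<Rightarrow> real" where
  "sqn f = (LINT x|lborel. (norm (f x))\<^sup>2)"

definition ip :: "('a::euclidean_space \<Rightarrow> complex) \<Rightarrow> ('a \<Rightarrow> complex) \<Rightarrow> complex" where
  "ip f g = (LINT x|lborel. f x * cnj (g x))"

lemma sqn_nonneg [simp]: "sqn f \<ge> 0"
  unfolding sqn_def by simp

lemma L2_I: "f \<in> borel_measurable borel \<Longrightarrow> integrable lborel (\<lambda>x. (norm (f x))\<^sup>2) \<Longrightarrow> f \<in> L2"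
  by (simp add: L2_def)

lemma L2_measurable: "f \<in> L2 \<Longrightarrow> f \<in> borel_measurable borel"
  by (simp add: L2_def)

lemma L2_integrable: "f \<in> L2 \<Longrightarrow> integrable lborel (\<lambda>x. (norm (f x))\<^sup>2)"
  by (simp add: L2_def)

lemma L2_bound:
  assumes "f \<in> borel_measurable borel" "integrable lborel h" "\<And>x. (norm (f x))\<^sup>2 \<le> h x"
  shows "f \<in> L2"
proof (rule L2_I)
  have [measurable]: "f \<in> borel_measurable borel" by fact
  have "(norm (f x))\<^sup>2 \<le> \<bar>h x\<bar>" for x using assms(3)[of x] by linarith
  then show "integrable lborel (\<lambda>x. (norm (f x))\<^sup>2)"
    by (intro Bochner_Integration.integrable_bound[OF assms(2)]) auto
qed fact

lemma norm_add_sq_le: "(norm (a + b :: complex))\<^sup>2 \<le> 2 * (norm a)\<^sup>2 + 2 * (norm b)\<^sup>2"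
proof -
  have "(norm (a + b))\<^sup>2 \<le> (norm a + norm b)\<^sup>2"
    by (intro power_mono norm_triangle_ineq) auto
  also have "\<dots> \<le> 2 * (norm a)\<^sup>2 + 2 * (norm b)\<^sup>2"
    using sum_squares_bound[of "norm a" "norm b"] by (simp add: power2_sum)
  finally show ?thesis .
qed

lemma L2_add: "f \<in> L2 \<Longrightarrow> g \<in> L2 \<Longrightarrow> (\<lambda>x. f x + g x) \<in> L2"
proof -
  assume *: "f \<in> L2" "g \<in> L2"
  then have [measurable]: "f \<in> borel_measurable borel" "g \<in> borel_measurable borel"
    by (auto simp: L2_measurable)
  show ?thesis
    by (rule L2_bound[where h = "\<lambda>x. 2 * (norm (f x))\<^sup>2 + 2 * (norm (g x))\<^sup>2"])
      (use * in \<open>auto intro!: norm_add_sq_le L2_integrable\<close>)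
qed

lemma sqn_add_le: "f \<in> L2 \<Longrightarrow> g \<in> L2 \<Longrightarrow> sqn (\<lambda>x. f x + g x) \<le> 2 * sqn f + 2 * sqn g"
proof -
  assume *: "f \<in> L2" "g \<in> L2"
  have "sqn (\<lambda>x. f x + g x) \<le> (LINT x|lborel. 2 * (norm (f x))\<^sup>2 + 2 * (norm (g x))\<^sup>2)"
    unfolding sqn_def by (intro integral_mono norm_add_sq_le) (use * in \<open>auto intro!: L2_integrable L2_add\<close>)
  also have "\<dots> = 2 * sqn f + 2 * sqn g"
    unfolding sqn_def using * by (subst Bochner_Integration.integral_add) (auto intro!: L2_integrable)
  finally show ?thesis .
qed

lemma L2_bdd_mult:
  assumes "f \<in> L2" "m \<in> borel_measurable borel" "\<And>x. norm (m x) \<le> B"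
  shows "(\<lambda>x. m x * f x) \<in> L2"
proof -
  have [measurable]: "f \<in> borel_measurable borel" "m \<in> borel_measurable borel"
    using assms by (auto simp: L2_measurable)
  have "(norm (m x * f x))\<^sup>2 \<le> B\<^sup>2 * (norm (f x))\<^sup>2" for x
    using assms(3)[of x] by (auto simp: norm_mult power_mult_distrib intro!: mult_right_mono power_mono)
  then show ?thesis
    by (intro L2_bound[where h = "\<lambda>x. B\<^sup>2 * (norm (f x))\<^sup>2"]) (use assms in \<open>auto intro!: L2_integrable\<close>)
qed

lemma L2_cmult: "f \<in> L2 \<Longrightarrow> (\<lambda>x. c * f x) \<in> L2"
  by (rule L2_bdd_mult[where B = "norm c"]) auto

lemma L2_diff: "f \<in> L2 \<Longrightarrow> g \<in> L2 \<Longrightarrow> (\<lambda>x. f x - g x) \<in> L2"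
  using L2_add[of f "\<lambda>x. (-1) * g x"] L2_cmult[of g "-1"] by simp

lemma L2_cnj: "f \<in> L2 \<Longrightarrow> (\<lambda>x. cnj (f x)) \<in> L2"
  unfolding L2_def by (auto intro!: measurable_compose[OF _ borel_measurable_continuous_onI[of cnj]] continuous_intros)

lemma L2_zero: "(\<lambda>x. 0) \<in> L2"
  by (simp add: L2_def)

lemma L2_sum: "finite I \<Longrightarrow> (\<And>i. i \<in> I \<Longrightarrow> F i \<in> L2) \<Longrightarrow> (\<lambda>x. \<Sum>i\<in>I. F i x) \<in> L2"
  by (induction I rule: finite_induct) (auto intro: L2_add L2_zero)

lemma sqn_cnj [simp]: "sqn (\<lambda>x. cnj (f x)) = sqn f"
  by (simp add: sqn_def)

lemma sqn_cmult: "sqn (\<lambda>x. c * f x) = (norm c)\<^sup>2 * sqn f"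
  by (simp add: sqn_def norm_mult power_mult_distrib)

lemma L2_mult_norm_integrable:
  assumes "f \<in> L2" "g \<in> L2" shows "integrable lborel (\<lambda>x. norm (f x) * norm (g x))"
proof -
  have [measurable]: "f \<in> borel_measurable borel" "g \<in> borel_measurable borel"
    using assms by (auto simp: L2_measurable)
  have "norm (f x) * norm (g x) \<le> (norm (f x))\<^sup>2 + (norm (g x))\<^sup>2" for x
    using sum_squares_bound[of "norm (f x)" "norm (g x)"]
      zero_le_power2[of "norm (f x)"] zero_le_power2[of "norm (g x)"] by linarith
  then have *: "AE x in lborel. norm (norm (f x) * norm (g x)) \<le> norm ((norm (f x))\<^sup>2 + (norm (g x))\<^sup>2)"
    by auto
  have "integrable lborel (\<lambda>x. (norm (f x))\<^sup>2 + (norm (g x))\<^sup>2)"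
    using assms by (auto intro!: L2_integrable)
  then show ?thesis
    by (rule Bochner_Integration.integrable_bound[OF _ _ *]) simp
qed

lemma L2_mult_integrable:
  assumes "f \<in> L2" "g \<in> L2" shows "integrable lborel (\<lambda>x. f x * g x)"
proof -
  have [measurable]: "f \<in> borel_measurable borel" "g \<in> borel_measurable borel"
    using assms by (auto simp: L2_measurable)
  show ?thesis
    by (rule Bochner_Integration.integrable_bound[OF L2_mult_norm_integrable[OF assms]]) (auto simp: norm_mult)
qed

text \<open>The integral of (|f| - t |g|)^2 is a nonnegative quadratic in t; its value at the
  minimising t is the inequality.\<close>

lemma CS_real:
  assumes "f \<in> L2" "g \<in> L2"
  shows "(LINT x|lborel. norm (f x) * norm (g x))\<^sup>2 \<le> sqn f * sqn g"
proof -
  define a where "a = (LINT x|lborel. norm (f x) * norm (g x))"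
  have *: "0 \<le> sqn f - 2 * t * a + t\<^sup>2 * sqn g" for t
  proof -
    have "0 \<le> (LINT x|lborel. (norm (f x) - t * norm (g x))\<^sup>2)" by simp
    also have "\<dots> = (LINT x|lborel. (norm (f x))\<^sup>2 - 2 * t * (norm (f x) * norm (g x)) + t\<^sup>2 * (norm (g x))\<^sup>2)"
      by (rule arg_cong[where f = "integral\<^sup>L lborel"]) (auto simp: power2_eq_square algebra_simps)
    also have "\<dots> = sqn f - 2 * t * a + t\<^sup>2 * sqn g"
      unfolding sqn_def a_def using assms by (simp add: L2_integrable L2_mult_norm_integrable)
    finally show ?thesis .
  qed
  show ?thesis
  proof (cases "sqn g = 0")
    case True
    have "a = 0"
    proof (rule ccontr)
      assume "a \<noteq> 0"
      \<comment> \<open>If the quadratic term is absent, this t would give the value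
        -\<open>sqn f\<close> - 2, which is negative.\<close>
      with *[of "(sqn f + 1) / a"] True show False
        using sqn_nonneg[of f] by simp
    qed
    with True show ?thesis by (simp add: a_def)
  next
    case False
    then have g: "sqn g > 0" using sqn_nonneg[of g] by linarith
    with *[of "a / sqn g"] have "a\<^sup>2 / sqn g \<le> sqn f" by (simp add: power2_eq_square)
    with g show ?thesis by (simp add: a_def field_simps)
  qed
qed

lemma CS_norm:
  assumes "f \<in> L2" "g \<in> L2"
  shows "(LINT x|lborel. norm (f x) * norm (g x)) \<le> sqrt (sqn f) * sqrt (sqn g)"
  unfolding real_sqrt_mult[symmetric]
  by (rule real_le_rsqrt[OF CS_real[OF assms]])

lemma CS_bilinear:
  assumes "f \<in> L2" "g \<in> L2"
  shows "norm (LINT x|lborel. f x * g x) \<le> sqrt (sqn f) * sqrt (sqn g)"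
proof -
  have "norm (LINT x|lborel. f x * g x) \<le> (LINT x|lborel. norm (f x * g x))"
    by (rule integral_norm_bound)
  also have "\<dots> = (LINT x|lborel. norm (f x) * norm (g x))" by (simp add: norm_mult)
  finally show ?thesis using CS_norm[OF assms] by linarith
qed

lemma CS_ip: "f \<in> L2 \<Longrightarrow> g \<in> L2 \<Longrightarrow> norm (ip f g) \<le> sqrt (sqn f) * sqrt (sqn g)"
  using CS_bilinear[of f "\<lambda>x. cnj (g x)"] L2_cnj[of g] by (simp add: ip_def)

lemma ip_cnj_commute: "cnj (ip f g) = ip g f"
proof -
  have "cnj (ip f g) = (LINT x|lborel. cnj (f x * cnj (g x)))" unfolding ip_def by (rule Bochner_Integration.integral_cnj[symmetric])
  then show ?thesis by (simp add: ip_def mult.commute)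
qed

lemma ip_self: "ip f f = of_real (sqn f)"
  unfolding ip_def sqn_def integral_complex_of_real[symmetric]
  by (simp add: complex_norm_square[symmetric] del: complex_mult_cnj)

lemma ip_integrable: "f \<in> L2 \<Longrightarrow> g \<in> L2 \<Longrightarrow> integrable lborel (\<lambda>x. f x * cnj (g x))"
  by (intro L2_mult_integrable L2_cnj)

lemma ip_diff_left: "f \<in> L2 \<Longrightarrow> f' \<in> L2 \<Longrightarrow> g \<in> L2 \<Longrightarrow> ip (\<lambda>x. f x - f' x) g = ip f g - ip f' g"
  unfolding ip_def left_diff_distrib by (intro Bochner_Integration.integral_diff ip_integrable)

lemma ip_diff_right: "f \<in> L2 \<Longrightarrow> g \<in> L2 \<Longrightarrow> g' \<in> L2 \<Longrightarrow> ip f (\<lambda>x. g x - g' x) = ip f g - ip f g'"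
  unfolding ip_def complex_cnj_diff right_diff_distrib by (intro Bochner_Integration.integral_diff ip_integrable)

lemma ip_cmult_right: "ip f (\<lambda>x. c * g x) = cnj c * ip f g"
proof -
  have "(\<lambda>x. f x * cnj (c * g x)) = (\<lambda>x. cnj c * (f x * cnj (g x)))" by (auto simp: fun_eq_iff)
  then show ?thesis unfolding ip_def by (metis integral_mult_right_zero)
qed

lemma CS_ip_diff:
  "f \<in> L2 \<Longrightarrow> g \<in> L2 \<Longrightarrow> g' \<in> L2 \<Longrightarrow> norm (ip f g - ip f g') \<le> sqrt (sqn f) * sqrt (sqn (\<lambda>x. g x - g' x))"
  by (subst ip_diff_right[symmetric]) (auto intro: CS_ip L2_diff)

text \<open>Polarisation expresses the size of an increment through scalar pairings, which can be
  differentiated in time although the curve itself cannot.\<close>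

lemma sqn_diff:
  assumes "f \<in> L2" "g \<in> L2"
  shows "sqn (\<lambda>x. f x - g x) = sqn f + sqn g - 2 * Re (ip f g)"
proof -
  have "complex_of_real (sqn (\<lambda>x. f x - g x)) = ip (\<lambda>x. f x - g x) (\<lambda>x. f x - g x)" by (simp add: ip_self)
  also have "\<dots> = of_real (sqn f) + of_real (sqn g) - (ip f g + cnj (ip f g))"
    using assms by (simp add: ip_diff_left ip_diff_right L2_diff ip_cnj_commute) (simp add: ip_self)
  also have "\<dots> = of_real (sqn f + sqn g - 2 * Re (ip f g))"
    by (simp add: complex_add_cnj)
  finally show ?thesis by (simp only: of_real_eq_iff)
qed

section \<open>Translations and dilations in integrals\<close>

lemma LINT_translate:
  fixes f :: "'a::euclidean_space \<Rightarrow> 'b::{banach,second_countable_topology}"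
  assumes [measurable]: "f \<in> borel_measurable borel"
  shows "(LINT x|lborel. f (x + c)) = (LINT x|lborel. f x)"
    and "integrable lborel (\<lambda>x. f (x + c)) \<longleftrightarrow> integrable lborel f"
proof -
  have "(LINT x|lborel. f x) = (LINT x|distr lborel borel ((+) c). f x)" by (simp add: lborel_distr_plus)
  also have "\<dots> = (LINT x|lborel. f (x + c))" by (subst integral_distr) (auto simp: add.commute)
  finally show "(LINT x|lborel. f (x + c)) = (LINT x|lborel. f x)" by simp
  have "integrable lborel f \<longleftrightarrow> integrable (distr lborel borel ((+) c)) f" by (simp add: lborel_distr_plus)
  also have "\<dots> \<longleftrightarrow> integrable lborel (\<lambda>x. f (x + c))" by (subst integrable_distr_eq) (auto simp: add.commute)
  finally show "integrable lborel (\<lambda>x. f (x + c)) \<longleftrightarrow> integrable lborel f" by simp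
qed

lemma LINT_dilate:
  fixes f :: "'a::euclidean_space \<Rightarrow> 'b::{banach,second_countable_topology}"
  assumes [measurable]: "f \<in> borel_measurable borel" and c: "c > 0"
  shows "(LINT x|lborel. f x) = c ^ DIM('a) *\<^sub>R (LINT x|lborel. f (c *\<^sub>R x))"
    and "integrable lborel (dil c f) \<longleftrightarrow> integrable lborel f"
proof -
  have eq: "lborel = density (distr lborel borel (\<lambda>x::'a. c *\<^sub>R x)) (\<lambda>_. ennreal (c ^ DIM('a)))"
    using lborel_affine[of c "0::'a"] c by (simp add: ennreal_power)
  show "(LINT x|lborel. f x) = c ^ DIM('a) *\<^sub>R (LINT x|lborel. f (c *\<^sub>R x))"
    using c by (subst eq, subst integral_density) (auto simp: integral_distr)
  have "integrable lborel f \<longleftrightarrow> integrable lborel (\<lambda>x. c ^ DIM('a) *\<^sub>R f (c *\<^sub>R x))"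
    using c by (subst eq, subst integrable_density) (auto simp: integrable_distr_eq)
  moreover have "integrable lborel (dil c f)" if "integrable lborel (\<lambda>x. c ^ DIM('a) *\<^sub>R f (c *\<^sub>R x))"
    using Bochner_Integration.integrable_scaleR_right[of "1 / c ^ DIM('a)", OF that] c by simp
  ultimately show "integrable lborel (dil c f) \<longleftrightarrow> integrable lborel f"
    by auto
qed

section \<open>Integration by parts and weak derivatives\<close>

text \<open>The integral of \<open>F(x + b) - F(x)\<close> vanishes by translation invariance, and it is the average of the
  integrals of \<open>F'(x + s b)\<close> over \<open>0 \<le> s \<le> 1\<close>; so no decay beyond integrability is needed.\<close>

lemma integral_partial_eq_0:
  fixes F F' :: "'a::euclidean_space \<Rightarrow> complex"
  assumes d: "has_partial b F F'" and int: "integrable lborel F" "integrable lborel F'"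
    and cont: "continuous_on UNIV F'"
  shows "(LINT x|lborel. F' x) = 0"
proof -
  have [measurable]: "F \<in> borel_measurable borel" "F' \<in> borel_measurable borel"
    using int by (auto dest: borel_measurable_integrable)
  define f where "f = (\<lambda>(s::real) x. indicator {0..1} s *\<^sub>R F' (x + s *\<^sub>R b))"
  have FTC: "(LINT s|lborel. f s x) = F (x + b) - F x" for x
  proof -
    have "(LINT s|lborel. f s x) = F (x + 1 *\<^sub>R b) - F (x + 0 *\<^sub>R b)"
      unfolding f_def
    proof (rule integral_FTC_atLeastAtMost)
      show "((\<lambda>s. F (x + s *\<^sub>R b)) has_vector_derivative F' (x + s *\<^sub>R b)) (at s within {0..1})" for s
        using has_partial_line[OF d] has_vector_derivative_at_within by blast
      show "continuous_on {0..1} (\<lambda>s. F' (x + s *\<^sub>R b))"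
        by (rule continuous_on_compose2[OF cont]) (auto intro!: continuous_intros)
    qed auto
    then show ?thesis by simp
  qed
  have f_int: "integrable lborel (f s)" and f_val: "(LINT x|lborel. f s x) = indicator {0..1} s *\<^sub>R (LINT x|lborel. F' x)"
    and f_norm: "(LINT x|lborel. norm (f s x)) = indicator {0..1} s *\<^sub>R (LINT x|lborel. norm (F' x))" for s
  proof -
    show "integrable lborel (f s)"
      unfolding f_def using int by (auto simp: LINT_translate)
    show "(LINT x|lborel. f s x) = indicator {0..1} s *\<^sub>R (LINT x|lborel. F' x)"
      unfolding f_def by (simp add: LINT_translate)
    show "(LINT x|lborel. norm (f s x)) = indicator {0..1} s *\<^sub>R (LINT x|lborel. norm (F' x))"
      unfolding f_def using LINT_translate(1)[of "\<lambda>x. norm (F' x)"] by simp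
  qed
  have I: "integrable (lborel \<Otimes>\<^sub>M lborel) (case_prod f)"
  proof (rule lborel_pair.Fubini_integrable)
    show "case_prod f \<in> borel_measurable (lborel \<Otimes>\<^sub>M lborel)"
      unfolding f_def by measurable
    show "integrable lborel (\<lambda>s. LINT x|lborel. norm (case (s, x) of (s, x) \<Rightarrow> f s x))"
      by (simp add: f_norm)
  qed (simp add: f_int)
  have "(LINT x|lborel. F (x + b) - F x) = (LINT x|lborel. (LINT s|lborel. f s x))"
    by (simp add: FTC)
  also have "\<dots> = (LINT s|lborel. (LINT x|lborel. f s x))"
    by (rule lborel_pair.Fubini_integral[OF I])
  also have "\<dots> = (LINT x|lborel. F' x)"
    by (simp add: f_val)
  finally show ?thesis
    using int by (simp add: LINT_translate)
qed

text \<open>The product rule together with the vanishing integral of a derivative. Asking only for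
  integrability of the three products makes this serve both pairings with a test function and
  pairings of two L^2 functions.\<close>

lemma integration_by_parts:
  assumes "smooth f" "smooth g" "b \<in> Basis"
    and "integrable lborel (\<lambda>x. f x * g x)"
    "integrable lborel (\<lambda>x. partial b f x * g x)" "integrable lborel (\<lambda>x. f x * partial b g x)"
  shows "(LINT x|lborel. f x * partial b g x) = - (LINT x|lborel. partial b f x * g x)"
proof -
  have "(LINT x|lborel. partial b f x * g x + f x * partial b g x) = 0"
    by (rule integral_partial_eq_0[OF has_partial_mult[of b f _ g]])
      (use assms in \<open>auto intro!: smooth_has_partial smooth_continuous smooth_add smooth_mult smooth_partial\<close>)
  then show ?thesis using assms by (simp add: eq_neg_iff_add_eq_0 add.commute)
qed

lemma integrable_test_mult:
  assumes "test_function \<phi>" "continuous_on UNIV f"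
  shows "integrable lborel (\<lambda>x. f x * \<phi> x)"
proof -
  let ?K = "closure {x. \<phi> x \<noteq> 0}"
  have "integrable lborel (\<lambda>x. indicator ?K x *\<^sub>R (f x * \<phi> x))"
  proof (rule borel_integrable_compact)
    show "compact ?K" using assms by (simp add: test_function_def)
    show "continuous_on ?K (\<lambda>x. f x * \<phi> x)"
      using assms by (intro continuous_intros) (auto intro: continuous_on_subset smooth_continuous test_function_smooth)
  qed
  also have "(\<lambda>x. indicator ?K x *\<^sub>R (f x * \<phi> x)) = (\<lambda>x. f x * \<phi> x)"
    using closure_subset[of "{x. \<phi> x \<noteq> 0}"] by (auto simp: indicator_def fun_eq_iff)
  finally show ?thesis .
qed

lemma test_function_L2: "test_function \<phi> \<Longrightarrow> \<phi> \<in> L2"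
proof (rule L2_I)
  assume *: "test_function \<phi>"
  then have c: "continuous_on UNIV \<phi>" by (auto intro: smooth_continuous test_function_smooth)
  then show "\<phi> \<in> borel_measurable borel" by (rule borel_measurable_continuous_onI)
  have "integrable lborel (\<lambda>x. norm (cnj (\<phi> x) * \<phi> x))"
    by (intro integrable_norm integrable_test_mult[OF *] continuous_intros c)
  then show "integrable lborel (\<lambda>x. (norm (\<phi> x))\<^sup>2)" by (simp add: norm_mult power2_eq_square)
qed

lemma rev_multi_indices: "rev \<alpha> \<in> multi_indices \<longleftrightarrow> \<alpha> \<in> multi_indices"
  by (simp add: in_lists_conv_set)

text \<open>Integration by parts moves the outermost derivative first, hence the reversal; with it no symmetry
  of mixed derivatives has to be established.\<close>

lemma smooth_has_weak_partials:
  "smooth f \<Longrightarrow> \<alpha> \<in> multi_indices \<Longrightarrow> has_weak_partials \<alpha> f (partials (rev \<alpha>) f)"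
proof (induction \<alpha> arbitrary: f)
  case Nil
  then show ?case by (simp add: has_weak_partials_def)
next
  case (Cons b \<alpha>)
  then have b: "b \<in> Basis" "\<alpha> \<in> multi_indices" by auto
  show ?case unfolding has_weak_partials_def
  proof (intro allI impI)
    fix \<phi> :: "'a \<Rightarrow> complex" assume \<phi>: "test_function \<phi>"
    have t: "test_function (partials \<alpha> \<phi>)" using \<phi> b by (simp add: test_function_partials)
    have "(LINT x|lborel. f x * partials (b # \<alpha>) \<phi> x) = - (LINT x|lborel. partial b f x * partials \<alpha> \<phi> x)"
      unfolding partials_simps
      by (rule integration_by_parts[OF Cons.prems(1) test_function_smooth[OF t] b(1)
            integrable_test_mult[OF t smooth_continuous[OF Cons.prems(1)]]
            integrable_test_mult[OF t smooth_continuous[OF smooth_partial[OF Cons.prems(1) b(1)]]]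
            integrable_test_mult[OF test_function_partial[OF t b(1)] smooth_continuous[OF Cons.prems(1)]]])
    also have "\<dots> = - ((- 1) ^ length \<alpha> * (LINT x|lborel. partials (rev \<alpha>) (partial b f) x * \<phi> x))"
      using Cons.IH[OF smooth_partial[OF Cons.prems(1) b(1)] b(2)] \<phi> by (simp add: has_weak_partials_def)
    finally show "(LINT x|lborel. f x * partials (b # \<alpha>) \<phi> x) =
      (- 1) ^ length (b # \<alpha>) * (LINT x|lborel. partials (rev (b # \<alpha>)) f x * \<phi> x)"
      by simp
  qed
qed

text \<open>Open boxes form an intersection-stable generator of the Borel sets, so vanishing
  integrals over boxes propagate to all Borel sets. Since \<open>h\<close> is only locally
  integrable, this is carried out inside one fixed box; countably many boxes then exhaust the
  space.\<close>

lemma box_integrals_zero_imp_AE_zero: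
  fixes h :: "'a::euclidean_space \<Rightarrow> complex"
  assumes [measurable]: "h \<in> borel_measurable borel"
    and int: "\<And>l r. set_integrable lborel (box l r) h"
    and zero: "\<And>l r. (LINT x:box l r|lborel. h x) = 0"
  shows "AE x in lborel. h x = 0"
proof -
  have *: "AE x in lborel. indicator (box l r) x *\<^sub>R h x = 0" for l r :: 'a
  proof (rule sigma_finite_measure.density_zero[OF sigma_finite_lborel])
    show I: "integrable lborel (\<lambda>x. indicat_real (box l r) x *\<^sub>R h x)"
      using int by (simp add: set_integrable_def)
    let ?h = "\<lambda>x. indicat_real (box l r) x *\<^sub>R h x"
    have SI: "set_integrable lborel A ?h" if "A \<in> sets borel" for A
      unfolding set_integrable_def using that by (intro integrable_mult_indicator[OF _ I]) simp
    show "(LINT x:A|lborel. ?h x) = 0" if "A \<in> sets lborel" for A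
    proof -
      let ?G = "range (\<lambda>(a, b). box a b :: 'a set)"
      have "Int_stable ?G"
        by (auto simp: Int_stable_def box_Int_box)
      moreover have "?G \<subseteq> Pow UNIV" by simp
      moreover have "A \<in> sigma_sets UNIV ?G" using that by (simp add: borel_eq_box)
      ultimately show ?thesis
      proof (induction rule: sigma_sets_induct_disjoint)
        case (basic A)
        then obtain a b where A: "A = box a b" by auto
        obtain c d where "box a b \<inter> box l r = box c d" by (auto simp: box_Int_box)
        then have "(LINT x:A|lborel. ?h x) = (LINT x:box c d|lborel. h x)"
          unfolding set_lebesgue_integral_def A by (auto simp: indicator_inter_arith[symmetric] scaleR_scaleR)
        then show ?case using zero by simp
      next
        case empty
        then show ?case by (simp add: set_lebesgue_integral_def)
      next
        case (compl A)
        have A: "A \<in> sets borel" using compl(1) by (simp add: borel_eq_box)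
        have "(LINT x:UNIV|lborel. ?h x) = 0" using zero[of l r] by (simp add: set_lebesgue_integral_def)
        moreover have "(LINT x:A \<union> (UNIV - A)|lborel. ?h x) = (LINT x:A|lborel. ?h x) + (LINT x:UNIV - A|lborel. ?h x)"
          using A by (intro set_integral_Un SI) auto
        ultimately show ?case using compl(2) by simp
      next
        case (union F)
        have F: "F i \<in> sets borel" for i using union(2) by (auto simp: borel_eq_box)
        have "(LINT x:\<Union>(range F)|lborel. ?h x) = (\<Sum>i. (LINT x:F i|lborel. ?h x))"
          by (rule lebesgue_integral_countable_add) (use F union(1) SI in \<open>auto simp: disjoint_family_on_def\<close>)
        then show ?case using union(3) by simp
      qed
    qed
  qed
  have "AE x in lborel. \<forall>k::nat. indicator (box (- real k *\<^sub>R One) (real k *\<^sub>R One)) x *\<^sub>R h x = 0"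
    unfolding AE_all_countable using * by blast
  then show ?thesis
  proof (rule AE_mp, intro AE_I2 impI)
    fix x assume z: "\<forall>k::nat. indicator (box (- real k *\<^sub>R One) (real k *\<^sub>R One)) x *\<^sub>R h x = 0"
    have "x \<in> (\<Union>k::nat. box (- real k *\<^sub>R One) (real k *\<^sub>R One))"
      using UN_box_eq_UNIV by auto
    then obtain k :: nat where "x \<in> box (- real k *\<^sub>R One) (real k *\<^sub>R One)" by blast
    with z show "h x = 0" by (metis indicator_simps(1) scaleR_one)
  qed
qed

text \<open>The bumps of a box converge to its indicator and are bounded by it, so dominated
  convergence turns vanishing against test functions into vanishing box integrals.\<close>

lemma fundamental_lemma:
  fixes h :: "'a::euclidean_space \<Rightarrow> complex"
  assumes [measurable]: "h \<in> borel_measurable borel"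
    and int: "\<And>l r. set_integrable lborel (box l r) h"
    and zero: "\<And>\<phi>. test_function \<phi> \<Longrightarrow> (LINT x|lborel. h x * \<phi> x) = 0"
  shows "AE x in lborel. h x = 0"
proof (rule box_integrals_zero_imp_AE_zero)
  fix l r :: 'a
  have [measurable]: "bump m l r \<in> borel_measurable borel" for m
    by (intro borel_measurable_continuous_onI smooth_continuous smooth_bump)
  have "(\<lambda>k. LINT x|lborel. h x * bump (real (Suc k)) l r x) \<longlonglongrightarrow> (LINT x|lborel. indicator (box l r) x *\<^sub>R h x)"
  proof (rule integral_dominated_convergence[where w = "\<lambda>x. norm (indicat_real (box l r) x *\<^sub>R h x)"])
    show "integrable lborel (\<lambda>x. norm (indicat_real (box l r) x *\<^sub>R h x))"
      using int[of l r] unfolding set_integrable_def by (rule integrable_norm)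
    show "AE x in lborel. (\<lambda>k. h x * bump (real (Suc k)) l r x) \<longlonglongrightarrow> indicat_real (box l r) x *\<^sub>R h x"
    proof (intro AE_I2)
      fix x
      show "(\<lambda>k. h x * bump (real (Suc k)) l r x) \<longlonglongrightarrow> indicat_real (box l r) x *\<^sub>R h x"
      proof (cases "x \<in> box l r")
        case True
        then show ?thesis using tendsto_mult[OF tendsto_const[of "h x"] bump_tendsto[OF True]] by simp
      qed (simp add: bump_eq_0)
    qed
    show "AE x in lborel. norm (h x * bump (real (Suc k)) l r x) \<le> norm (indicat_real (box l r) x *\<^sub>R h x)" for k
    proof (intro AE_I2)
      fix x
      show "norm (h x * bump (real (Suc k)) l r x) \<le> norm (indicat_real (box l r) x *\<^sub>R h x)"
        using norm_bump_le[of "real (Suc k)" l r x] mult_left_le[of "norm (bump (real (Suc k)) l r x)" "norm (h x)"]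
        by (cases "x \<in> box l r") (auto simp: bump_eq_0 norm_mult)
    qed
  qed measurable
  moreover have "(LINT x|lborel. h x * bump (real (Suc k)) l r x) = 0" for k
    by (intro zero test_function_bump) simp
  ultimately show "(LINT x:box l r|lborel. h x) = 0"
    by (simp add: set_lebesgue_integral_def LIMSEQ_const_iff)
qed (use assms in auto)

lemma set_integrable_box_L2:
  fixes g :: "'a::euclidean_space \<Rightarrow> complex"
  assumes "g \<in> L2" shows "set_integrable lborel (box l r) g"
proof -
  have "(\<lambda>x. (norm (indicator (box l r) x :: complex))\<^sup>2) = indicat_real (box l r)"
    by (auto simp: indicator_def)
  then have "(\<lambda>x. indicator (box l r) x) \<in> L2"
    by (intro L2_I) (use emeasure_bounded_finite[OF bounded_box, of l r] in \<open>simp_all add: integrable_indicator_iff\<close>)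
  from L2_mult_integrable[OF this assms] show ?thesis
    unfolding set_integrable_def by (simp add: indicator_scaleR_eq_if indicator_times_eq_if)
qed

lemma set_integrable_box_continuous:
  fixes f :: "'a::euclidean_space \<Rightarrow> complex"
  assumes "continuous_on UNIV f" shows "set_integrable lborel (box l r) f"
proof (rule set_integrable_subset)
  show "set_integrable lborel (cbox l r) f"
    unfolding set_integrable_def using assms by (intro borel_integrable_compact) (auto intro: continuous_on_subset)
qed (auto simp: box_subset_cbox)

text \<open>The weak derivative and the classical one agree against every test function, hence
  almost everywhere. The classical derivative carries the reversed list, as integration by parts
  produces it.\<close>

lemma weak_partials_unique:
  assumes f: "smooth f" and \<alpha>: "\<alpha> \<in> multi_indices" and g: "g \<in> L2" "has_weak_partials \<alpha> f g"
  shows "AE x in lborel. g x = partials (rev \<alpha>) f x"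
proof -
  let ?h = "partials (rev \<alpha>) f"
  have c: "continuous_on UNIV ?h" using f \<alpha> by (intro smooth_continuous smooth_partials) auto
  have [measurable]: "g \<in> borel_measurable borel" "?h \<in> borel_measurable borel"
    using g c by (auto simp: L2_measurable intro: borel_measurable_continuous_onI)
  have "AE x in lborel. g x - ?h x = 0"
  proof (rule fundamental_lemma)
    show "set_integrable lborel (box l r) (\<lambda>x. g x - ?h x)" for l r
      using set_integrable_box_L2[OF g(1)] set_integrable_box_continuous[OF c] by (rule set_integral_diff)
    fix \<phi> :: "'a \<Rightarrow> complex" assume \<phi>: "test_function \<phi>"
    have "(- 1) ^ length \<alpha> * (LINT x|lborel. g x * \<phi> x) = (- 1) ^ length \<alpha> * (LINT x|lborel. ?h x * \<phi> x)"
      using g(2) smooth_has_weak_partials[OF f \<alpha>] \<phi> unfolding has_weak_partials_def by metis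
    then have "(LINT x|lborel. g x * \<phi> x) = (LINT x|lborel. ?h x * \<phi> x)" by simp
    then show "(LINT x|lborel. (g x - ?h x) * \<phi> x) = 0"
      using integrable_test_mult[OF \<phi> c] L2_mult_integrable[OF g(1) test_function_L2[OF \<phi>]]
      by (simp add: left_diff_distrib)
  qed measurable
  then show ?thesis by simp
qed

lemma L2_cong_AE:
  assumes "g \<in> L2" "f \<in> borel_measurable borel" "AE x in lborel. g x = f x"
  shows "f \<in> L2" "sqn f = sqn g"
proof -
  have [measurable]: "g \<in> borel_measurable borel" "f \<in> borel_measurable borel" using assms by (auto simp: L2_measurable)
  have "AE x in lborel. (norm (g x))\<^sup>2 = (norm (f x))\<^sup>2"
    using assms(3) by eventually_elim simp
  moreover have "integrable lborel (\<lambda>x. (norm (g x))\<^sup>2)" using assms by (simp add: L2_integrable)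
  ultimately have "integrable lborel (\<lambda>x. (norm (f x))\<^sup>2)"
    by (subst integrable_cong_AE[symmetric]) auto
  then show "f \<in> L2" by (rule L2_I[rotated]) measurable
  show "sqn f = sqn g"
    unfolding sqn_def by (rule integral_cong_AE) (use assms(3) in auto)
qed

text \<open>Membership in H^2 phrased with classical derivatives, so that after this point neither
  weak derivatives nor the choice in \<open>weak_partials\<close> appear.\<close>

definition smooth_H2 :: "('a::euclidean_space \<Rightarrow> complex) \<Rightarrow> bool" where
  "smooth_H2 f \<longleftrightarrow> smooth f \<and> (\<forall>\<alpha>\<in>multi_indices. length \<alpha> \<le> 2 \<longrightarrow> partials \<alpha> f \<in> L2)"

lemma smooth_H2_smooth: "smooth_H2 f \<Longrightarrow> smooth f"
  and smooth_H2_partials: "smooth_H2 f \<Longrightarrow> \<alpha> \<in> multi_indices \<Longrightarrow> length \<alpha> \<le> 2 \<Longrightarrow> partials \<alpha> f \<in> L2"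
  unfolding smooth_H2_def by blast+

lemma partials_measurable: "smooth f \<Longrightarrow> \<alpha> \<in> multi_indices \<Longrightarrow> partials \<alpha> f \<in> borel_measurable borel"
  by (intro borel_measurable_continuous_onI smooth_continuous smooth_partials)

lemma smooth_H2_I:
  assumes "smooth f" "f \<in> H2" shows "smooth_H2 f"
  unfolding smooth_H2_def
proof (intro conjI ballI impI)
  fix \<alpha> :: "'a list" assume \<alpha>: "\<alpha> \<in> multi_indices" "length \<alpha> \<le> 2"
  then have r: "rev \<alpha> \<in> multi_indices" "length (rev \<alpha>) \<le> 2" by (simp_all add: rev_multi_indices)
  with assms(2) obtain g where g: "g \<in> L2" "has_weak_partials (rev \<alpha>) f g"
    unfolding H2_def by blast
  show "partials \<alpha> f \<in> L2"
    using L2_cong_AE(1)[OF g(1) partials_measurable[OF assms(1) \<alpha>(1)]] weak_partials_unique[OF assms(1) r(1) g]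
    by simp
qed fact

lemma finite_multi_indices: "finite {\<alpha>. \<alpha> \<in> multi_indices \<and> length \<alpha> \<le> k}"
proof -
  have "{\<alpha>. \<alpha> \<in> multi_indices \<and> length \<alpha> \<le> k} = {xs::'a list. set xs \<subseteq> Basis \<and> length xs \<le> k}"
    by auto
  then show ?thesis using finite_lists_length_le[of "Basis::'a set" k] by simp
qed

text \<open>The chosen weak derivative for the reversed list equals the classical one almost
  everywhere, and its squared norm is one of the nonnegative summands of \<open>H2_norm\<close>.
  This transfers continuity in time from \<open>H2_norm\<close> to each single derivative.\<close>

lemma sqn_partials_le_H2_norm:
  assumes f: "smooth_H2 f" and \<alpha>: "\<alpha> \<in> multi_indices" "length \<alpha> \<le> 2"
  shows "sqn (partials \<alpha> f) \<le> (H2_norm f)\<^sup>2"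
proof -
  have sm: "smooth f" using f by (simp add: smooth_H2_def)
  let ?w = "weak_partials (rev \<alpha>) f"
  have r: "rev \<alpha> \<in> multi_indices" using \<alpha> by (simp add: rev_multi_indices)
  have "partials \<alpha> f \<in> L2 \<and> has_weak_partials (rev \<alpha>) f (partials \<alpha> f)"
    using smooth_H2_partials[OF f \<alpha>] smooth_has_weak_partials[OF sm r] unfolding rev_rev_ident by (rule conjI)
  then have "?w \<in> L2 \<and> has_weak_partials (rev \<alpha>) f ?w"
    unfolding weak_partials_def by (rule someI[of "\<lambda>g. g \<in> L2 \<and> has_weak_partials (rev \<alpha>) f g"])
  then have w: "?w \<in> L2" "has_weak_partials (rev \<alpha>) f ?w" by blast+
  have "sqn (partials \<alpha> f) = sqn ?w"
    by (rule L2_cong_AE(2)[OF w(1) partials_measurable[OF sm \<alpha>(1)] weak_partials_unique[OF sm r w, unfolded rev_rev_ident]])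
  also have "\<dots> \<le> (\<Sum>\<alpha> | \<alpha> \<in> multi_indices \<and> length \<alpha> \<le> 2. sqn (weak_partials \<alpha> f))"
    by (rule member_le_sum[of "rev \<alpha>"]) (use r \<alpha>(2) finite_multi_indices in simp_all)
  also have "\<dots> = (H2_norm f)\<^sup>2"
    unfolding H2_norm_def sqn_def by (subst real_sqrt_pow2) (auto intro!: sum_nonneg)
  finally show ?thesis .
qed

lemma smooth_H2_L2: "smooth_H2 f \<Longrightarrow> f \<in> L2"
  using smooth_H2_partials[of f "[]"] by simp

lemma smooth_H2_partial: "smooth_H2 f \<Longrightarrow> b \<in> Basis \<Longrightarrow> partial b f \<in> L2"
  using smooth_H2_partials[of f "[b]"] by simp

lemma smooth_H2_partial2: "smooth_H2 f \<Longrightarrow> b \<in> Basis \<Longrightarrow> c \<in> Basis \<Longrightarrow> partial b (partial c f) \<in> L2"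
  using smooth_H2_partials[of f "[b, c]"] by simp

lemma smooth_H2_laplacian: "smooth_H2 f \<Longrightarrow> laplacian f \<in> L2"
  unfolding laplacian_def[abs_def] by (intro L2_sum smooth_H2_partial2) auto

lemma smooth_H2_diff:
  assumes "smooth_H2 f" "smooth_H2 g" shows "smooth_H2 (\<lambda>x. f x - g x)"
  unfolding smooth_H2_def
proof (intro conjI ballI impI)
  fix \<alpha> :: "'a list" assume "\<alpha> \<in> multi_indices" "length \<alpha> \<le> 2"
  with assms show "partials \<alpha> (\<lambda>x. f x - g x) \<in> L2"
    by (subst partials_diff) (rule smooth_H2_smooth L2_diff smooth_H2_partials | assumption)+
qed (intro smooth_diff smooth_H2_smooth assms)

lemma L2_dilate: "f \<in> L2 \<Longrightarrow> c > 0 \<Longrightarrow> (dil c f) \<in> L2"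
proof (rule L2_I)
  assume f: "f \<in> L2" and c: "c > 0"
  have [measurable]: "f \<in> borel_measurable borel" using f by (rule L2_measurable)
  show "(dil c f) \<in> borel_measurable borel" by measurable
  show "integrable lborel (\<lambda>x. (norm (f (c *\<^sub>R x)))\<^sup>2)"
    using LINT_dilate(2)[of "\<lambda>x. (norm (f x))\<^sup>2" c] L2_integrable[OF f] c by simp
qed

lemma smooth_H2_dilate:
  assumes "smooth_H2 f" "c > 0" shows "smooth_H2 (dil c f)"
  unfolding smooth_H2_def
proof (intro conjI ballI impI)
  fix \<alpha> :: "'a list" assume "\<alpha> \<in> multi_indices" "length \<alpha> \<le> 2"
  with assms show "partials \<alpha> (dil c f) \<in> L2"
    by (subst partials_dilate) (rule smooth_H2_smooth L2_cmult L2_dilate smooth_H2_partials | assumption)+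
qed (intro smooth_dilate smooth_H2_smooth assms)

section \<open>The power nonlinearity\<close>

text \<open>A convex function lies above its tangents. The mean value theorem is applied on
  intervals whose interior avoids 0, and an end point equal to 0 is settled by hand.\<close>

lemma powr_tangent_le:
  fixes a b q :: real
  assumes "a \<ge> 0" "b \<ge> 0" "q \<ge> 1"
  shows "a powr q + q * a powr (q - 1) * (b - a) \<le> b powr q"
proof -
  consider "a = 0" | "b = 0" "a > 0" | "a = b" "a > 0" | "0 < a" "a < b" | "0 < b" "b < a"
    using assms by linarith
  then show ?thesis
  proof cases
    case 2
    then have "a powr (q - 1) * a = a powr q" by (simp add: powr_diff)
    then have "q * a powr (q - 1) * (b - a) = - q * a powr q" using 2 by (simp add: algebra_simps)
    moreover have "a powr q \<le> q * a powr q" using assms by (simp add: mult_le_cancel_right1)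
    ultimately show ?thesis using 2 by (simp add: mult.assoc)
  next
    case 4
    have "\<exists>z>a. z < b \<and> b powr q - a powr q = (b - a) * (q * z powr (q - 1))"
      using 4 by (intro MVT2) (auto intro!: derivative_eq_intros)
    then obtain z where z: "z > a" "b powr q - a powr q = (b - a) * (q * z powr (q - 1))" by blast
    have "a powr (q - 1) \<le> z powr (q - 1)" using z 4 assms by (intro powr_mono2) auto
    then have "(b - a) * (q * a powr (q - 1)) \<le> (b - a) * (q * z powr (q - 1))"
      using 4 assms by (intro mult_left_mono) auto
    with z show ?thesis by (simp add: algebra_simps)
  next
    case 5
    have "\<exists>z>b. z < a \<and> a powr q - b powr q = (a - b) * (q * z powr (q - 1))"
      using 5 by (intro MVT2) (auto intro!: derivative_eq_intros)
    then obtain z where z: "z > b" "z < a" "a powr q - b powr q = (a - b) * (q * z powr (q - 1))" by blast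
    have "z powr (q - 1) \<le> a powr (q - 1)" using z 5 assms by (intro powr_mono2) auto
    then have "(a - b) * (q * z powr (q - 1)) \<le> (a - b) * (q * a powr (q - 1))"
      using 5 assms by (intro mult_left_mono) auto
    with z show ?thesis by (simp add: algebra_simps)
  qed auto
qed

text \<open>For p < 1 the derivative of the power blows up at 0; the factor \<open>b\<close>, which
  is at most the intermediate point, absorbs this singularity.\<close>

lemma mult_powr_diff_le:
  fixes a b p M :: real
  assumes "0 \<le> b" "b \<le> a" "a \<le> M" "p > 0"
  shows "b * (a powr p - b powr p) \<le> p * M powr p * (a - b)"
proof (cases "b = 0 \<or> a = b")
  case True
  then show ?thesis using assms by auto
next
  case False
  have "\<exists>z>b. z < a \<and> a powr p - b powr p = (a - b) * (p * z powr (p - 1))"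
    using assms False by (intro MVT2) (auto intro!: derivative_eq_intros)
  then obtain z where z: "z > b" "z < a" "a powr p - b powr p = (a - b) * (p * z powr (p - 1))" by blast
  have "b * z powr (p - 1) \<le> z * z powr (p - 1)" using z by (intro mult_right_mono) auto
  also have "\<dots> = z powr p" using z assms by (simp add: powr_diff)
  also have "\<dots> \<le> M powr p" using z assms by (intro powr_mono2) auto
  finally have "(p * (a - b)) * (b * z powr (p - 1)) \<le> (p * (a - b)) * M powr p"
    using assms by (intro mult_left_mono) auto
  then show ?thesis unfolding z(3) by (simp add: mult_ac)
qed

definition nl :: "real \<Rightarrow> complex \<Rightarrow> complex" where
  "nl p z = of_real (norm z powr p) * z"

text \<open>Write the difference as |z|^p (z - w) + (|z|^p - |w|^p) w with z the larger of the two,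
  so that the second term has the smaller modulus as its factor and \<open>mult_powr_diff_le\<close>
  applies.\<close>

lemma nl_Lipschitz:
  assumes "norm z \<le> M" "norm w \<le> M" "p > 0"
  shows "norm (nl p z - nl p w) \<le> (1 + p) * M powr p * norm (z - w)"
proof -
  have *: "norm (nl p z - nl p w) \<le> (1 + p) * M powr p * norm (z - w)"
    if "norm w \<le> norm z" "norm z \<le> M" for z w
  proof -
    have "nl p z - nl p w = of_real (norm z powr p) * (z - w) + of_real (norm z powr p - norm w powr p) * w"
      by (simp add: nl_def algebra_simps)
    also have "norm \<dots> \<le> norm z powr p * norm (z - w) + norm w * (norm z powr p - norm w powr p)"
      using that assms(3) powr_mono2[of p "norm w" "norm z"]
      by (intro order_trans[OF norm_triangle_ineq]) (simp add: norm_mult mult.commute flip: of_real_diff)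
    also have "\<dots> \<le> M powr p * norm (z - w) + p * M powr p * (norm z - norm w)"
      using that assms(3) by (intro add_mono mult_powr_diff_le mult_right_mono powr_mono2) auto
    also have "\<dots> \<le> M powr p * norm (z - w) + p * M powr p * norm (z - w)"
      using assms(3) by (intro add_left_mono mult_left_mono norm_triangle_ineq2) auto
    finally show ?thesis by (simp add: algebra_simps)
  qed
  show ?thesis
    using *[of w z] *[of z w] assms by (cases "norm w \<le> norm z") (auto simp: norm_minus_commute)
qed

text \<open>Convexity of \<open>|z| powr (p + 2)\<close> at both end points turns the Lipschitz bound into a second-order expansion, without
  differentiating at \<open>z = 0\<close>.\<close>

lemma powr_expand:
  assumes "norm z \<le> M" "norm w \<le> M" "p > 0"
  shows "\<bar>norm w powr (p + 2) - norm z powr (p + 2) - (p + 2) * Re (nl p z * cnj (w - z))\<bar>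
    \<le> (p + 2) * (1 + p) * M powr p * (norm (w - z))\<^sup>2"
proof -
  have conv: "norm z powr (p + 2) + (p + 2) * Re (nl p z * cnj (w - z)) \<le> norm w powr (p + 2)" for z w
  proof -
    have "Re (z * cnj w) \<le> norm z * norm w"
      using complex_Re_le_cmod[of "z * cnj w"] by (simp add: norm_mult)
    then have "norm z powr p * Re (z * cnj w) \<le> norm z powr p * (norm z * norm w)"
      by (intro mult_left_mono) auto
    moreover have "Re (z * cnj z) = (norm z)\<^sup>2"
      by (simp add: complex_mult_cnj cmod_power2)
    moreover have "Re (nl p z * cnj (w - z)) = norm z powr p * Re (z * cnj w) - norm z powr p * Re (z * cnj z)"
      unfolding nl_def by (simp add: algebra_simps)
    ultimately have "Re (nl p z * cnj (w - z)) \<le> norm z powr p * (norm z * norm w - (norm z)\<^sup>2)"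
      by (simp add: right_diff_distrib)
    also have "\<dots> = norm z powr ((p + 2) - 1) * (norm w - norm z)"
      by (cases "z = 0") (auto simp: powr_add power2_eq_square algebra_simps)
    finally have "(p + 2) * Re (nl p z * cnj (w - z)) \<le> (p + 2) * (norm z powr ((p + 2) - 1) * (norm w - norm z))"
      using assms by (intro mult_left_mono) auto
    moreover have "norm z powr (p + 2) + (p + 2) * (norm z powr ((p + 2) - 1) * (norm w - norm z)) \<le> norm w powr (p + 2)"
      using powr_tangent_le[of "norm z" "norm w" "p + 2"] assms by (simp only: mult.assoc) simp
    ultimately show ?thesis by linarith
  qed
  have "Re ((nl p w - nl p z) * cnj (w - z)) \<le> norm (nl p w - nl p z) * norm (w - z)"
    using complex_Re_le_cmod[of "(nl p w - nl p z) * cnj (w - z)"]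
    by (simp add: norm_mult del: complex_cnj_diff)
  also have "\<dots> \<le> (1 + p) * M powr p * norm (w - z) * norm (w - z)"
    using assms by (intro mult_right_mono nl_Lipschitz) auto
  finally have "(p + 2) * Re ((nl p w - nl p z) * cnj (w - z)) \<le> (p + 2) * ((1 + p) * M powr p * norm (w - z) * norm (w - z))"
    using assms by (intro mult_left_mono) auto
  moreover have "Re ((nl p w - nl p z) * cnj (w - z)) = - Re (nl p w * cnj (z - w)) - Re (nl p z * cnj (w - z))"
    by (simp add: algebra_simps)
  ultimately show ?thesis
    using conv[of z w] conv[of w z] by (simp add: power2_eq_square algebra_simps abs_le_iff)
qed

text \<open>For fixed \<open>b\<close> the expression inside the absolute value, as a function of
  \<open>a\<close>, vanishes at a = b. Its derivative at z is a difference of two terms that both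
  lie between 0 and (1 + p) z^p (z - b), so it is bounded by the same quantity, and the mean value
  theorem yields the second factor a - b.\<close>

lemma virial_real_ineq:
  fixes a b p M :: real
  assumes "0 \<le> b" "b \<le> a" "a \<le> M" "p > 0"
  shows "\<bar>(a\<^sup>2 + b\<^sup>2) / 2 * (a powr p - b powr p) - p / (p + 2) * (a powr (p + 2) - b powr (p + 2))\<bar>
    \<le> (1 + p) * M powr p * (a - b)\<^sup>2"
proof -
  consider "a = b" | "b = 0" "a > 0" | "b > 0" "b < a" using assms by linarith
  then show ?thesis
  proof cases
    case 2
    have "(a\<^sup>2 + b\<^sup>2) / 2 * (a powr p - b powr p) - p / (p + 2) * (a powr (p + 2) - b powr (p + 2)) = (1 / 2 - p / (p + 2)) * a powr p * a\<^sup>2"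
      using 2 by (simp add: powr_add powr_numeral algebra_simps)
    moreover have "\<bar>(1 / 2 - p / (p + 2)) * a powr p * a\<^sup>2\<bar> \<le> (1 + p) * M powr p * a\<^sup>2"
    proof -
      have "\<bar>1 / 2 - p / (p + 2)\<bar> \<le> 1 + p"
        using assms by (simp add: field_simps abs_le_iff)
      moreover have "a powr p \<le> M powr p" using assms 2 by (intro powr_mono2) auto
      ultimately show ?thesis
        unfolding abs_mult using 2 by (intro mult_mono) auto
    qed
    ultimately show ?thesis using 2 by simp
  next
    case 3
    define h where "h = (\<lambda>x. (x\<^sup>2 + b\<^sup>2) / 2 * (x powr p - b powr p) - p / (p + 2) * (x powr (p + 2) - b powr (p + 2)))"
    define h' where "h' = (\<lambda>x. x * (x powr p - b powr p) - p * x powr (p - 1) * ((x\<^sup>2 - b\<^sup>2) / 2))"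
    have "(h has_real_derivative h' x) (at x)" if "x \<ge> b" for x
    proof -
      have x: "x > 0" using that 3 by simp
      have "(h has_real_derivative x * (x powr p - b powr p) + (x\<^sup>2 + b\<^sup>2) / 2 * (p * x powr (p - 1)) - p / (p + 2) * ((p + 2) * x powr (p + 2 - 1))) (at x)"
        unfolding h_def using x by (auto intro!: derivative_eq_intros)
      also have "p / (p + 2) * ((p + 2) * x powr (p + 2 - 1)) = p * x powr (p - 1) * x\<^sup>2"
        using x assms by (simp add: powr_add powr_diff power2_eq_square)
      also have "x * (x powr p - b powr p) + (x\<^sup>2 + b\<^sup>2) / 2 * (p * x powr (p - 1)) - p * x powr (p - 1) * x\<^sup>2 = h' x"
        unfolding h'_def by (simp add: field_simps)
      finally show ?thesis .
    qed
    then have "\<exists>z>b. z < a \<and> h a - h b = (a - b) * h' z"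
      using 3 by (intro MVT2) auto
    then obtain z where z: "z > b" "z < a" "h a - h b = (a - b) * h' z" by blast
    have 1: "z * (z powr p - b powr p) \<le> (1 + p) * z powr p * (z - b)"
    proof -
      \<comment> \<open>By homogeneity the claim is 1 - r^p \<le> (1 + p) (1 - r) for 0 < r < 1: a
        tangent inequality if p \<ge> 1, and a consequence of r \<le> r^p otherwise.\<close>
      define r where "r = b / z"
      have r: "0 < r" "r < 1" "b = r * z" using z 3 by (auto simp: r_def)
      have "1 - r powr p \<le> (1 + p) * (1 - r)"
      proof (cases "p \<ge> 1")
        case True
        have "1 - r powr p \<le> p * (1 - r)"
          using powr_tangent_le[of 1 r p] r True by (simp add: algebra_simps)
        then show ?thesis using r by (simp add: algebra_simps)
      next
        case False
        have "r powr 1 \<le> r powr p" using r False assms by (intro powr_mono') auto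
        then have "1 - r powr p \<le> 1 - r" using r by simp
        moreover have "0 \<le> p * (1 - r)" using r assms by simp
        ultimately show ?thesis by (simp add: algebra_simps)
      qed
      then have "z * z powr p * (1 - r powr p) \<le> z * z powr p * ((1 + p) * (1 - r))"
        using z 3 by (intro mult_left_mono) auto
      then show ?thesis
        using r z 3 by (simp add: powr_mult algebra_simps)
    qed
    have 2: "0 \<le> z * (z powr p - b powr p)"
      using z 3 assms powr_mono2[of p b z] by simp
    have 4: "0 \<le> p * z powr (p - 1) * ((z\<^sup>2 - b\<^sup>2) / 2)"
      using z 3 assms by (intro mult_nonneg_nonneg) (auto intro!: power_mono)
    have 5: "p * z powr (p - 1) * ((z\<^sup>2 - b\<^sup>2) / 2) \<le> (1 + p) * z powr p * (z - b)"
    proof -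
      have "p * z powr (p - 1) * ((z\<^sup>2 - b\<^sup>2) / 2) = p * z powr (p - 1) * (z - b) * ((z + b) / 2)"
      proof -
        have "(z\<^sup>2 - b\<^sup>2) / 2 = (z - b) * ((z + b) / 2)" by (simp add: power2_eq_square field_simps)
        then show ?thesis by (simp only: mult.assoc)
      qed
      also have "\<dots> \<le> p * z powr (p - 1) * (z - b) * z"
        using z assms by (intro mult_left_mono) auto
      also have "\<dots> = p * z powr p * (z - b)" using z 3 by (simp add: powr_diff)
      also have "\<dots> \<le> (1 + p) * z powr p * (z - b)" using z by (intro mult_right_mono) auto
      finally show ?thesis .
    qed
    have "\<bar>h' z\<bar> \<le> (1 + p) * z powr p * (z - b)"
      unfolding h'_def using 1 2 4 5 by linarith
    also have "\<dots> \<le> (1 + p) * M powr p * (a - b)"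
      using z 3 assms by (intro mult_mono powr_mono2) auto
    finally have "(a - b) * \<bar>h' z\<bar> \<le> (a - b) * ((1 + p) * M powr p * (a - b))"
      using 3 by (intro mult_left_mono) auto
    moreover have "h b = 0" by (simp add: h_def)
    ultimately have "\<bar>h a\<bar> \<le> (1 + p) * M powr p * (a - b)\<^sup>2"
      using z 3 by (simp add: abs_mult power2_eq_square mult_ac)
    then show ?thesis by (simp add: h_def)
  qed auto
qed

text \<open>Polarisation replaces Re (z cnj w) by the mean of the squared moduli at the cost of |z -
  w|^2 / 2, which leaves the real inequality. With z = u(c x) and w = u(x) this is the pointwise
  form of the nonlinear term of the virial identity.\<close>

lemma virial_ineq:
  assumes "norm z \<le> M" "norm w \<le> M" "p > 0"
  shows "\<bar>Re (z * cnj w) * (norm w powr p - norm z powr p) - p / (p + 2) * (norm w powr (p + 2) - norm z powr (p + 2))\<bar>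
    \<le> (2 + p) * M powr p * (norm (z - w))\<^sup>2"
proof -
  have M: "norm x powr p \<le> M powr p" if "norm x \<le> M" for x :: complex
    using that assms by (intro powr_mono2) auto
  have R: "Re (z * cnj w) = ((norm w)\<^sup>2 + (norm z)\<^sup>2) / 2 - (norm (z - w))\<^sup>2 / 2"
    unfolding cmod_power2 by (simp add: power2_eq_square field_simps)
  let ?h = "\<lambda>a b. (a\<^sup>2 + b\<^sup>2) / 2 * (a powr p - b powr p) - p / (p + 2) * (a powr (p + 2) - b powr (p + 2))"
  have "\<bar>?h (norm w) (norm z)\<bar> \<le> (1 + p) * M powr p * (norm w - norm z)\<^sup>2"
  proof (cases "norm z \<le> norm w")
    case False
    have "s * (A - B) - k * (C - D) = - (s * (B - A) - k * (D - C))" for s A B k C D :: real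
      by (simp add: algebra_simps)
    then have "?h (norm w) (norm z) = - ?h (norm z) (norm w)"
      by (subst (3) add.commute) blast
    then show ?thesis
      using virial_real_ineq[of "norm w" "norm z" M p] False assms by (simp add: power2_commute)
  qed (use virial_real_ineq[of "norm z" "norm w" M p] assms in auto)
  also have "\<dots> \<le> (1 + p) * M powr p * (norm (z - w))\<^sup>2"
    using assms norm_triangle_ineq3[of z w] 
    by (intro mult_left_mono) (auto simp: abs_le_square_iff[symmetric] abs_minus_commute)
  finally have 1: "\<bar>?h (norm w) (norm z)\<bar> \<le> (1 + p) * M powr p * (norm (z - w))\<^sup>2" .
  have 2: "\<bar>(norm (z - w))\<^sup>2 / 2 * (norm w powr p - norm z powr p)\<bar> \<le> (norm (z - w))\<^sup>2 * M powr p"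
  proof -
    have "\<bar>norm w powr p - norm z powr p\<bar> \<le> M powr p"
      using M[OF assms(1)] M[OF assms(2)] by (simp add: abs_le_iff) (smt (verit) powr_ge_zero)
    then have "(norm (z - w))\<^sup>2 / 2 * \<bar>norm w powr p - norm z powr p\<bar> \<le> (norm (z - w))\<^sup>2 * M powr p"
      by (intro mult_mono) auto
    then show ?thesis by (simp add: abs_mult)
  qed
  have "Re (z * cnj w) * (norm w powr p - norm z powr p) - p / (p + 2) * (norm w powr (p + 2) - norm z powr (p + 2))
    = ?h (norm w) (norm z) - (norm (z - w))\<^sup>2 / 2 * (norm w powr p - norm z powr p)"
    unfolding R by (simp add: algebra_simps)
  moreover have "(2 + p) * M powr p * (norm (z - w))\<^sup>2 = (1 + p) * M powr p * (norm (z - w))\<^sup>2 + (norm (z - w))\<^sup>2 * M powr p"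
    by (simp add: algebra_simps)
  ultimately show ?thesis using 1 2 by linarith
qed

section \<open>Continuous curves of square-integrable functions\<close>

definition l2cont :: "(real \<Rightarrow> 'a::euclidean_space \<Rightarrow> complex) \<Rightarrow> bool" where
  "l2cont f \<longleftrightarrow> (\<forall>t. f t \<in> L2) \<and> (\<forall>t. ((\<lambda>s. sqn (\<lambda>x. f s x - f t x)) \<longlongrightarrow> 0) (at t))"

lemma l2cont_L2: "l2cont f \<Longrightarrow> f t \<in> L2"
  by (simp add: l2cont_def)

lemma l2cont_comparison:
  assumes "l2cont f" "\<And>t. g t \<in> L2"
    and "\<And>s t. sqn (\<lambda>x. g s x - g t x) \<le> K * sqn (\<lambda>x. f s x - f t x)"
  shows "l2cont g"
  unfolding l2cont_def
proof (intro conjI allI assms(2))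
  fix t
  have "((\<lambda>s. K * sqn (\<lambda>x. f s x - f t x)) \<longlongrightarrow> K * 0) (at t)"
    using assms(1) by (intro tendsto_intros) (simp add: l2cont_def)
  then have *: "((\<lambda>s. K * sqn (\<lambda>x. f s x - f t x)) \<longlongrightarrow> 0) (at t)" by simp
  show "((\<lambda>s. sqn (\<lambda>x. g s x - g t x)) \<longlongrightarrow> 0) (at t)"
    by (rule tendsto_sandwich[OF _ _ tendsto_const *]) (use assms(3) in simp_all)
qed

lemma l2cont_const: "f \<in> L2 \<Longrightarrow> l2cont (\<lambda>t. f)"
  unfolding l2cont_def by (simp add: sqn_def)

lemma l2cont_add:
  assumes "l2cont f" "l2cont g" shows "l2cont (\<lambda>t x. f t x + g t x)"
  unfolding l2cont_def
proof (intro conjI allI)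
  show "(\<lambda>x. f t x + g t x) \<in> L2" for t using assms by (intro L2_add l2cont_L2)
  fix t
  have le: "sqn (\<lambda>x. f s x + g s x - (f t x + g t x)) \<le> 2 * sqn (\<lambda>x. f s x - f t x) + 2 * sqn (\<lambda>x. g s x - g t x)" for s
    using sqn_add_le[of "\<lambda>x. f s x - f t x" "\<lambda>x. g s x - g t x"] assms
    by (simp add: L2_diff l2cont_L2 add_diff_add)
  have "((\<lambda>s. 2 * sqn (\<lambda>x. f s x - f t x) + 2 * sqn (\<lambda>x. g s x - g t x)) \<longlongrightarrow> 2 * 0 + 2 * 0) (at t)"
    using assms unfolding l2cont_def by (intro tendsto_intros) blast+
  then have *: "((\<lambda>s. 2 * sqn (\<lambda>x. f s x - f t x) + 2 * sqn (\<lambda>x. g s x - g t x)) \<longlongrightarrow> 0) (at t)" by simp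
  show "((\<lambda>s. sqn (\<lambda>x. f s x + g s x - (f t x + g t x))) \<longlongrightarrow> 0) (at t)"
    by (rule tendsto_sandwich[OF _ _ tendsto_const *]) (use le in simp_all)
qed

lemma l2cont_sum:
  "finite I \<Longrightarrow> (\<And>i. i \<in> I \<Longrightarrow> l2cont (F i)) \<Longrightarrow> l2cont (\<lambda>t x. \<Sum>i\<in>I. F i t x)"
  by (induction I rule: finite_induct) (auto intro: l2cont_add l2cont_const L2_zero)

lemma sqn_dilate:
  fixes f :: "'a::euclidean_space \<Rightarrow> complex"
  assumes "f \<in> L2" "c > 0"
  shows "sqn (dil c f) = sqn f / c ^ DIM('a)"
proof -
  have [measurable]: "f \<in> borel_measurable borel" using assms(1) by (rule L2_measurable)
  show ?thesis
    using LINT_dilate(1)[of "\<lambda>x. (norm (f x))\<^sup>2" c] assms(2) by (simp add: sqn_def)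
qed

lemma l2cont_dilate:
  fixes f :: "real \<Rightarrow> 'a::euclidean_space \<Rightarrow> complex"
  assumes "l2cont f" "c > 0" shows "l2cont (\<lambda>t x. f t (c *\<^sub>R x))"
proof (rule l2cont_comparison[OF assms(1), where K = "1 / c ^ DIM('a)"])
  show "(dil c (f t)) \<in> L2" for t using assms by (intro L2_dilate l2cont_L2)
  show "sqn (\<lambda>x. f s (c *\<^sub>R x) - f t (c *\<^sub>R x)) \<le> 1 / c ^ DIM('a) * sqn (\<lambda>x. f s x - f t x)" for s t
    using sqn_dilate[of "\<lambda>x. f s x - f t x" c] assms by (simp add: L2_diff l2cont_L2)
qed

text \<open>Continuity in both times jointly, from the splitting of a difference of products into
  three terms, each estimated by Cauchy-Schwarz. The chain rule along the diagonal relies on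
  it.\<close>

lemma ip_continuous:
  assumes "l2cont f" "l2cont g"
  shows "continuous_on UNIV (\<lambda>q. ip (f (fst q)) (g (snd q)))"
proof -
  have cont: "isCont (\<lambda>s. sqrt (sqn (\<lambda>x. h s x - h t x))) t" if "l2cont h" for h :: "real \<Rightarrow> 'a \<Rightarrow> complex" and t
  proof -
    have "((\<lambda>s. sqrt (sqn (\<lambda>x. h s x - h t x))) \<longlongrightarrow> sqrt 0) (at t)"
      using that by (intro tendsto_intros) (simp add: l2cont_def)
    then show ?thesis by (simp add: isCont_def) (simp add: sqn_def)
  qed
  have "isCont (\<lambda>q. ip (f (fst q)) (g (snd q))) q0" for q0
  proof -
    obtain s0 t0 where q0: "q0 = (s0, t0)" by (cases q0)
    define A where "A = (\<lambda>q::real\<times>real. sqrt (sqn (\<lambda>x. f (fst q) x - f s0 x)))"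
    define B where "B = (\<lambda>q::real\<times>real. sqrt (sqn (\<lambda>x. g (snd q) x - g t0 x)))"
    have "isCont A q0"
      unfolding A_def q0
    proof (rule isCont_o2[where f = fst and g = "\<lambda>s. sqrt (sqn (\<lambda>x. f s x - f s0 x))"])
      show "isCont (\<lambda>s. sqrt (sqn (\<lambda>x. f s x - f s0 x))) (fst (s0, t0))"
        unfolding fst_conv by (rule cont[OF assms(1)])
    qed (intro continuous_fst continuous_ident)
    moreover have "isCont B q0"
      unfolding B_def q0
    proof (rule isCont_o2[where f = snd and g = "\<lambda>s. sqrt (sqn (\<lambda>x. g s x - g t0 x))"])
      show "isCont (\<lambda>s. sqrt (sqn (\<lambda>x. g s x - g t0 x))) (snd (s0, t0))"
        unfolding snd_conv by (rule cont[OF assms(2)])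
    qed (intro continuous_snd continuous_ident)
    moreover have "A q0 = 0" "B q0 = 0" by (simp_all add: A_def B_def q0 sqn_def)
    ultimately have AB: "(A \<longlongrightarrow> 0) (at q0)" "(B \<longlongrightarrow> 0) (at q0)" by (simp_all add: isCont_def)
    have le: "norm (ip (f (fst q)) (g (snd q)) - ip (f s0) (g t0))
      \<le> A q * B q + A q * sqrt (sqn (g t0)) + sqrt (sqn (f s0)) * B q" for q
    proof -
      let ?f = "f (fst q)" and ?g = "g (snd q)"
      have L: "?f \<in> L2" "?g \<in> L2" "f s0 \<in> L2" "g t0 \<in> L2" using assms by (auto simp: l2cont_L2)
      have eq: "ip ?f ?g - ip (f s0) (g t0) = ip (\<lambda>x. ?f x - f s0 x) (\<lambda>x. ?g x - g t0 x)
          + ip (\<lambda>x. ?f x - f s0 x) (g t0) + ip (f s0) (\<lambda>x. ?g x - g t0 x)"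
        using L by (simp add: ip_diff_left ip_diff_right L2_diff)
      have "norm (ip ?f ?g - ip (f s0) (g t0)) \<le> norm (ip (\<lambda>x. ?f x - f s0 x) (\<lambda>x. ?g x - g t0 x))
          + norm (ip (\<lambda>x. ?f x - f s0 x) (g t0)) + norm (ip (f s0) (\<lambda>x. ?g x - g t0 x))"
        unfolding eq by (intro norm_triangle_mono order_refl)
      also have "\<dots> \<le> A q * B q + A q * sqrt (sqn (g t0)) + sqrt (sqn (f s0)) * B q"
        unfolding A_def B_def
        by (rule add_mono[OF add_mono[OF CS_ip[OF L2_diff[OF L(1,3)] L2_diff[OF L(2,4)]]
              CS_ip[OF L2_diff[OF L(1,3)] L(4)]] CS_ip[OF L(3) L2_diff[OF L(2,4)]]])
      finally show ?thesis .
    qed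
    have "((\<lambda>q. A q * B q + A q * sqrt (sqn (g t0)) + sqrt (sqn (f s0)) * B q) \<longlongrightarrow> 0 * 0 + 0 * sqrt (sqn (g t0)) + sqrt (sqn (f s0)) * 0) (at q0)"
      by (intro tendsto_intros AB)
    then have *: "((\<lambda>q. A q * B q + A q * sqrt (sqn (g t0)) + sqrt (sqn (f s0)) * B q) \<longlongrightarrow> 0) (at q0)" by simp
    have "((\<lambda>q. ip (f (fst q)) (g (snd q)) - ip (f s0) (g t0)) \<longlongrightarrow> 0) (at q0)"
      by (rule Lim_null_comparison[OF _ *]) (use le in simp)
    then show ?thesis unfolding isCont_def q0 by (simp add: LIM_zero_iff)
  qed
  then show ?thesis by (simp add: continuous_at_imp_continuous_on)
qed

lemma ip_continuous2:
  assumes "l2cont f" "l2cont g" "continuous_on S a" "continuous_on S b"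
  shows "continuous_on S (\<lambda>x. ip (f (a x)) (g (b x)))"
  using continuous_on_compose2[OF ip_continuous[OF assms(1,2)] continuous_on_Pair[OF assms(3,4)]] by simp

lemma sqn_continuous: "l2cont f \<Longrightarrow> continuous_on S a \<Longrightarrow> continuous_on S (\<lambda>x. sqn (f (a x)))"
  using continuous_on_Re[OF ip_continuous2[of f f S a a]] by (simp add: ip_self)

section \<open>Approximation by test functions\<close>

text \<open>Convergence to 0 in L^2. Approximations are stated through differences that are null, so
  that the terms of a product rule can be treated one at a time.\<close>

definition l2null :: "(nat \<Rightarrow> 'a::euclidean_space \<Rightarrow> complex) \<Rightarrow> bool" where
  "l2null a \<longleftrightarrow> (\<forall>k. a k \<in> L2) \<and> (\<lambda>k. sqn (a k)) \<longlonglongrightarrow> 0"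

lemma l2null_add:
  assumes "l2null a" "l2null b" shows "l2null (\<lambda>k x. a k x + b k x)"
  unfolding l2null_def
proof (intro conjI allI)
  show "(\<lambda>x. a k x + b k x) \<in> L2" for k using assms by (intro L2_add) (auto simp: l2null_def)
  have "(\<lambda>k. 2 * sqn (a k) + 2 * sqn (b k)) \<longlonglongrightarrow> 2 * 0 + 2 * 0"
    using assms unfolding l2null_def by (intro tendsto_intros) blast+
  then have *: "(\<lambda>k. 2 * sqn (a k) + 2 * sqn (b k)) \<longlonglongrightarrow> 0" by simp
  have "sqn (\<lambda>x. a k x + b k x) \<le> 2 * sqn (a k) + 2 * sqn (b k)" for k
    using assms by (intro sqn_add_le) (auto simp: l2null_def)
  then show "(\<lambda>k. sqn (\<lambda>x. a k x + b k x)) \<longlonglongrightarrow> 0"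
    by (intro tendsto_sandwich[OF _ _ tendsto_const *]) simp_all
qed

lemma l2null_cmult: "l2null a \<Longrightarrow> l2null (\<lambda>k x. c * a k x)"
  unfolding l2null_def sqn_cmult by (auto intro!: L2_cmult tendsto_mult_right_zero)

lemma l2null_sum:
  "finite I \<Longrightarrow> (\<And>i. i \<in> I \<Longrightarrow> l2null (A i)) \<Longrightarrow> l2null (\<lambda>k x. \<Sum>i\<in>I. A i k x)"
proof (induction I rule: finite_induct)
  case empty
  show ?case by (simp add: l2null_def L2_zero) (simp add: sqn_def)
next
  case (insert i I)
  then show ?case using l2null_add[of "A i" "\<lambda>k x. \<Sum>i\<in>I. A i k x"] by simp
qed

lemma l2null_mult:
  assumes f: "f \<in> L2" and m[measurable]: "\<And>k. m k \<in> borel_measurable borel"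
    and B: "\<And>k x. norm (m k x) \<le> B" and lim: "\<And>x. (\<lambda>k. m k x) \<longlonglongrightarrow> 0"
  shows "l2null (\<lambda>k x. m k x * f x)"
  unfolding l2null_def
proof (intro conjI allI)
  have [measurable]: "f \<in> borel_measurable borel" using f by (rule L2_measurable)
  show "(\<lambda>x. m k x * f x) \<in> L2" for k using L2_bdd_mult[OF f m B] .
  have "(\<lambda>k. LINT x|lborel. (norm (m k x * f x))\<^sup>2) \<longlonglongrightarrow> (LINT x|(lborel::'a measure). 0)"
  proof (rule integral_dominated_convergence[where w = "\<lambda>x. B\<^sup>2 * (norm (f x))\<^sup>2"])
    show "integrable lborel (\<lambda>x. B\<^sup>2 * (norm (f x))\<^sup>2)" using f by (simp add: L2_integrable)
    show "AE x in lborel. norm ((norm (m k x * f x))\<^sup>2) \<le> B\<^sup>2 * (norm (f x))\<^sup>2" for k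
      using B by (auto simp: norm_mult power_mult_distrib intro!: mult_right_mono power_mono)
    show "AE x in lborel. (\<lambda>k. (norm (m k x * f x))\<^sup>2) \<longlonglongrightarrow> 0"
    proof (intro AE_I2)
      fix x
      have "(\<lambda>k. (norm (m k x * f x))\<^sup>2) \<longlonglongrightarrow> (norm (0 * f x))\<^sup>2"
        by (intro tendsto_intros lim)
      then show "(\<lambda>k. (norm (m k x * f x))\<^sup>2) \<longlonglongrightarrow> 0" by simp
    qed
  qed measurable
  then show "(\<lambda>k. sqn (\<lambda>x. m k x * f x)) \<longlonglongrightarrow> 0" by (simp add: sqn_def)
qed

lemma test_function_norm_le:
  assumes "test_function \<phi>"
  obtains B where "B \<ge> 0" "\<And>x. norm (\<phi> x) \<le> B"
proof -
  let ?K = "closure {x. \<phi> x \<noteq> 0}"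
  have "compact (\<phi> ` ?K)"
    using assms by (intro compact_continuous_image)
      (auto simp: test_function_def intro: continuous_on_subset[OF smooth_continuous])
  then obtain B where B: "\<And>x. x \<in> ?K \<Longrightarrow> norm (\<phi> x) \<le> B"
    using compact_imp_bounded bounded_iff by (metis imageI)
  have "norm (\<phi> x) \<le> max B 0" for x
    using B[of x] closure_subset[of "{x. \<phi> x \<noteq> 0}"] by (cases "\<phi> x = 0") auto
  then show ?thesis by (intro that[of "max B 0"]) auto
qed

lemma test_function_dilate:
  assumes "test_function \<phi>" "c > 0" shows "test_function (dil c \<phi>)"
proof (rule test_functionI)
  have "{x. \<phi> (c *\<^sub>R x) \<noteq> 0} \<subseteq> (\<lambda>y. (1 / c) *\<^sub>R y) ` {y. \<phi> y \<noteq> 0}"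
  proof
    fix x assume "x \<in> {x. \<phi> (c *\<^sub>R x) \<noteq> 0}"
    then show "x \<in> (\<lambda>y. (1 / c) *\<^sub>R y) ` {y. \<phi> y \<noteq> 0}"
      using assms(2) by (intro image_eqI[of _ _ "c *\<^sub>R x"]) auto
  qed
  then show "bounded {x. \<phi> (c *\<^sub>R x) \<noteq> 0}"
    by (rule bounded_subset[OF bounded_scaling[OF test_function_bounded[OF assms(1)]]])
qed (intro smooth_dilate test_function_smooth assms)

lemma ex_cutoff:
  obtains \<theta> :: "'a::euclidean_space \<Rightarrow> complex" where "test_function \<theta>" "\<theta> 0 = 1"
proof -
  let ?\<phi> = "bump 1 (- One) (One::'a)"
  have 0: "?\<phi> 0 \<noteq> 0" by (simp add: bump_def flat_1)
  have "test_function (\<lambda>x. ?\<phi> x * (1 / ?\<phi> 0))"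
    by (intro test_function_mult test_function_bump smooth_const) simp
  with 0 show ?thesis by (intro that[of "\<lambda>x. ?\<phi> x * (1 / ?\<phi> 0)"]) simp_all
qed

lemma smooth_measurable: "smooth f \<Longrightarrow> f \<in> borel_measurable borel"
  by (intro borel_measurable_continuous_onI smooth_continuous)

text \<open>Multiply \<open>f\<close> by the cutoff \<theta>(r x) with r = 1 / (k + 1). Since
  \<open>f\<close> is smooth already, no regularisation is involved; every derivative that falls on
  the cutoff brings a factor r, which tends to 0.\<close>

lemma smooth_H2_approx:
  fixes f :: "'a::euclidean_space \<Rightarrow> complex"
  assumes f: "smooth_H2 f"
  obtains \<psi> where "\<And>k::nat. test_function (\<psi> k)" "l2null (\<lambda>k x. \<psi> k x - f x)"
    "\<And>b. b \<in> Basis \<Longrightarrow> l2null (\<lambda>k x. partial b (\<psi> k) x - partial b f x)"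
    "l2null (\<lambda>k x. laplacian (\<psi> k) x - laplacian f x)"
proof -
  obtain \<theta> :: "'a \<Rightarrow> complex" where \<theta>: "test_function \<theta>" "\<theta> 0 = 1" by (rule ex_cutoff)
  have s: "smooth \<theta>" "smooth f" using \<theta> f by (auto intro: test_function_smooth smooth_H2_smooth)
  define r where "r = (\<lambda>k::nat. 1 / real (Suc k))"
  have r: "0 < r k" "r k \<le> 1" for k by (auto simp: r_def)
  have r0: "r \<longlonglongrightarrow> 0" unfolding r_def by (rule LIMSEQ_Suc[OF lim_1_over_n])
  \<comment> \<open>The terms in which no derivative falls on the cutoff: as \<theta>(0) = 1, the
    factor tends to 0 pointwise and is bounded.\<close>
  have c1: "l2null (\<lambda>k x. (\<theta> (r k *\<^sub>R x) - 1) * g x)" if "g \<in> L2" for g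
  proof -
    obtain B where B: "B \<ge> 0" "\<And>x. norm (\<theta> x) \<le> B" by (rule test_function_norm_le[OF \<theta>(1)], rule that)
    show ?thesis
    proof (rule l2null_mult[OF that, where B = "B + 1"])
      show "(\<lambda>x. \<theta> (r k *\<^sub>R x) - 1) \<in> borel_measurable borel" for k
        by (rule smooth_measurable[OF smooth_diff[OF smooth_dilate[OF s(1)] smooth_const]])
      show "norm (\<theta> (r k *\<^sub>R x) - 1) \<le> B + 1" for k x
        using B(2)[of "r k *\<^sub>R x"] norm_triangle_ineq4[of "\<theta> (r k *\<^sub>R x)" 1] by simp
      show "(\<lambda>k. \<theta> (r k *\<^sub>R x) - 1) \<longlonglongrightarrow> 0" for x
      proof -
        have "(\<lambda>k. r k *\<^sub>R x) \<longlonglongrightarrow> 0 *\<^sub>R x" by (intro tendsto_intros r0)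
        moreover have "isCont \<theta> (0 *\<^sub>R x)"
          using smooth_continuous[OF s(1)] by (simp add: continuous_on_eq_continuous_at)
        ultimately have "(\<lambda>k. \<theta> (r k *\<^sub>R x)) \<longlonglongrightarrow> \<theta> (0 *\<^sub>R x)" by (rule isCont_tendsto_compose[rotated])
        then show ?thesis using \<theta>(2) by (simp add: LIM_zero_iff)
      qed
    qed
  qed
  \<comment> \<open>The terms in which a derivative falls on the cutoff; \<rho> is r after one
    derivative and r^2 after two.\<close>
  have c2: "l2null (\<lambda>k x. (of_real (\<rho> k) * dil (r k) \<eta> x) * g x)"
    if g: "g \<in> L2" and \<eta>: "test_function \<eta>" and \<rho>: "\<And>k. 0 \<le> \<rho> k" "\<And>k. \<rho> k \<le> 1" "\<rho> \<longlonglongrightarrow> 0" for g \<eta> \<rho>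
  proof -
    obtain B where B: "B \<ge> 0" "\<And>x. norm (\<eta> x) \<le> B" by (rule test_function_norm_le[OF \<eta>], rule that)
    have le: "norm (of_real (\<rho> k) * dil (r k) \<eta> x) \<le> \<rho> k * B" for k x
      using \<rho>(1)[of k] B by (simp add: norm_mult mult_left_mono)
    show ?thesis
    proof (rule l2null_mult[OF g, where B = B])
      show "(\<lambda>x. of_real (\<rho> k) * dil (r k) \<eta> x) \<in> borel_measurable borel" for k
        by (rule smooth_measurable[OF smooth_mult[OF smooth_const smooth_dilate[OF test_function_smooth[OF \<eta>]]]])
      show "norm (of_real (\<rho> k) * dil (r k) \<eta> x) \<le> B" for k x
        using le[of k x] \<rho>(2)[of k] B mult_right_mono[of "\<rho> k" 1 B] by linarith
      show "(\<lambda>k. of_real (\<rho> k) * dil (r k) \<eta> x) \<longlonglongrightarrow> 0" for x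
      proof (rule Lim_null_comparison)
        show "(\<lambda>k. \<rho> k * B) \<longlonglongrightarrow> 0" by (rule tendsto_mult_left_zero[OF \<rho>(3)])
      qed (use le in auto)
    qed
  qed
  have r_le: "0 \<le> r k" "0 \<le> (r k)\<^sup>2" "(r k)\<^sup>2 \<le> 1" for k
    using r[of k] by (auto simp: power_le_one)
  have r20: "(\<lambda>k. (r k)\<^sup>2) \<longlonglongrightarrow> 0" using tendsto_power[OF r0, of 2] by simp
  note cr = c2[of _ _ r, OF _ _ r_le(1) r(2) r0] and cr2 = c2[of _ _ "\<lambda>k. (r k)\<^sup>2", OF _ _ r_le(2,3) r20]
  define \<psi> where "\<psi> = (\<lambda>k x. \<theta> (r k *\<^sub>R x) * f x)"
  have sd: "smooth (dil (r k) \<theta>)" for k by (rule smooth_dilate[OF s(1)])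
  show thesis
  proof (rule that[of \<psi>])
    show "test_function (\<psi> k)" for k
      unfolding \<psi>_def by (rule test_function_mult[OF test_function_dilate[OF \<theta>(1) r(1)] s(2)])
    have "(\<lambda>k x. \<psi> k x - f x) = (\<lambda>k x. (\<theta> (r k *\<^sub>R x) - 1) * f x)"
      by (auto simp: \<psi>_def algebra_simps)
    then show "l2null (\<lambda>k x. \<psi> k x - f x)" using c1[OF smooth_H2_L2[OF f]] by simp
    show "l2null (\<lambda>k x. partial b (\<psi> k) x - partial b f x)" if b: "b \<in> Basis" for b
    proof -
      have "(\<lambda>k x. partial b (\<psi> k) x - partial b f x)
        = (\<lambda>k x. (of_real (r k) * partial b \<theta> (r k *\<^sub>R x)) * f x + (\<theta> (r k *\<^sub>R x) - 1) * partial b f x)"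
        unfolding \<psi>_def partial_mult[OF sd s(2) b] partial_dilate[OF s(1) b] by (auto simp: algebra_simps)
      then show ?thesis
        using l2null_add[OF cr[OF smooth_H2_L2[OF f] test_function_partial[OF \<theta>(1) b]] c1[OF smooth_H2_partial[OF f b]]]
        by simp
    qed
    have eq: "(\<lambda>k x. laplacian (\<psi> k) x - laplacian f x)
      = (\<lambda>k x. ((of_real ((r k)\<^sup>2) * laplacian \<theta> (r k *\<^sub>R x)) * f x
        + 2 * (\<Sum>b\<in>Basis. (of_real (r k) * partial b \<theta> (r k *\<^sub>R x)) * partial b f x))
        + (\<theta> (r k *\<^sub>R x) - 1) * laplacian f x)"
      unfolding \<psi>_def laplacian_mult[OF sd s(2)] laplacian_dilate[OF s(1)]
      by (auto simp: partial_dilate[OF s(1)] algebra_simps)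
    show "l2null (\<lambda>k x. laplacian (\<psi> k) x - laplacian f x)"
      unfolding eq
      by (intro l2null_add l2null_cmult l2null_sum c1 cr cr2 smooth_H2_L2 smooth_H2_partial smooth_H2_laplacian
          test_function_partial test_function_laplacian \<theta> f finite_Basis)
  qed
qed

lemma test_integral_laplacian:
  assumes "test_function \<phi>" "smooth f"
  shows "(LINT x|lborel. f x * laplacian \<phi> x) = - (\<Sum>b\<in>Basis. LINT x|lborel. partial b f x * partial b \<phi> x)"
    and "(LINT x|lborel. f x * laplacian \<phi> x) = (LINT x|lborel. laplacian f x * \<phi> x)"
proof -
  have sb: "smooth (partial b f)" if "b \<in> Basis" for b using assms(2) that by (rule smooth_partial)
  have I: "integrable lborel (\<lambda>x. g x * \<psi> x)" if "smooth g" "test_function \<psi>" for g \<psi> :: "'a \<Rightarrow> complex"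
    using integrable_test_mult[OF that(2) smooth_continuous[OF that(1)]] .
  have t: "test_function (partial b \<phi>)" "test_function (partial b (partial b \<phi>))" if "b \<in> Basis" for b
    using assms(1) that by (auto intro: test_function_partial)
  have 1: "(LINT x|lborel. f x * partial b (partial b \<phi>) x) = - (LINT x|lborel. partial b f x * partial b \<phi> x)"
    if "b \<in> Basis" for b
    by (rule integration_by_parts[OF assms(2) test_function_smooth[OF t(1)[OF that]] that
      I[OF assms(2) t(1)[OF that]] I[OF sb[OF that] t(1)[OF that]] I[OF assms(2) t(2)[OF that]]])
  have 2: "(LINT x|lborel. partial b f x * partial b \<phi> x) = - (LINT x|lborel. partial b (partial b f) x * \<phi> x)"
    if "b \<in> Basis" for b
    by (rule integration_by_parts[OF sb[OF that] test_function_smooth[OF assms(1)] that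
      I[OF sb[OF that] assms(1)] I[OF smooth_partial[OF sb[OF that] that] assms(1)] I[OF sb[OF that] t(1)[OF that]]])
  have L: "(LINT x|lborel. f x * laplacian \<phi> x) = (\<Sum>b\<in>Basis. LINT x|lborel. f x * partial b (partial b \<phi>) x)"
    unfolding laplacian_def sum_distrib_left
    by (rule Bochner_Integration.integral_sum) (intro I assms t)
  show "(LINT x|lborel. f x * laplacian \<phi> x) = - (\<Sum>b\<in>Basis. LINT x|lborel. partial b f x * partial b \<phi> x)"
    unfolding L sum_negf[symmetric] using 1 by (intro sum.cong) auto
  have "(LINT x|lborel. laplacian f x * \<phi> x) = (\<Sum>b\<in>Basis. LINT x|lborel. partial b (partial b f) x * \<phi> x)"
    unfolding laplacian_def sum_distrib_right
    by (rule Bochner_Integration.integral_sum) (intro I assms smooth_partial)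
  also have "\<dots> = (\<Sum>b\<in>Basis. LINT x|lborel. f x * partial b (partial b \<phi>) x)"
    using 1 2 by (intro sum.cong) auto
  finally show "(LINT x|lborel. f x * laplacian \<phi> x) = (LINT x|lborel. laplacian f x * \<phi> x)" using L by simp
qed

section \<open>The equation tested with functions in \<open>H\<^sup>2\<close>\<close>

locale nls =
  fixes u :: "real \<Rightarrow> 'a::euclidean_space \<Rightarrow> complex" and \<mu> \<epsilon> p C \<gamma> :: real
  assumes sol: "biharmonic_NLS_solution \<mu> \<epsilon> p u"
    and smooth_u: "\<And>t. smooth (u t)"
    and decay: "\<And>t x. norm (u t x) \<le> C * exp (- \<gamma> * norm x)"
    and p_pos: "p > 0" and C_pos: "C > 0" and \<gamma>_pos: "\<gamma> > 0"
begin

lemma u_le: "norm (u t x) \<le> C"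
proof -
  have "exp (- \<gamma> * norm x) \<le> 1" using \<gamma>_pos by simp
  then have "C * exp (- \<gamma> * norm x) \<le> C * 1" using C_pos by (intro mult_left_mono) auto
  then show ?thesis using decay[of t x] by linarith
qed

lemma u_H2: "smooth_H2 (u t)"
  using sol smooth_u by (auto simp: biharmonic_NLS_solution_def intro: smooth_H2_I)

lemma u_L2: "u t \<in> L2"
  and lap_L2: "laplacian (u t) \<in> L2"
  and partial_L2: "b \<in> Basis \<Longrightarrow> partial b (u t) \<in> L2"
  by (simp_all add: smooth_H2_L2 smooth_H2_laplacian smooth_H2_partial u_H2)

lemma l2cont_partials:
  assumes "\<alpha> \<in> multi_indices" "length \<alpha> \<le> 2"
  shows "l2cont (\<lambda>t. partials \<alpha> (u t))"
  unfolding l2cont_def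
proof (intro conjI allI)
  show "partials \<alpha> (u t) \<in> L2" for t using smooth_H2_partials[OF u_H2 assms] .
  fix t
  have "((\<lambda>s. (H2_norm (\<lambda>x. u s x - u t x))\<^sup>2) \<longlongrightarrow> 0\<^sup>2) (at t)"
    using sol unfolding biharmonic_NLS_solution_def by (intro tendsto_power) blast
  then have *: "((\<lambda>s. (H2_norm (\<lambda>x. u s x - u t x))\<^sup>2) \<longlongrightarrow> 0) (at t)" by simp
  have "sqn (\<lambda>x. partials \<alpha> (u s) x - partials \<alpha> (u t) x) \<le> (H2_norm (\<lambda>x. u s x - u t x))\<^sup>2" for s
    using sqn_partials_le_H2_norm[OF smooth_H2_diff[OF u_H2 u_H2] assms, of s t]
    unfolding partials_diff[OF assms(1) smooth_u smooth_u] .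
  then show "((\<lambda>s. sqn (\<lambda>x. partials \<alpha> (u s) x - partials \<alpha> (u t) x)) \<longlongrightarrow> 0) (at t)"
    by (intro tendsto_sandwich[OF _ _ tendsto_const *]) simp_all
qed

lemma l2cont_u: "l2cont u"
  using l2cont_partials[of "[]"] by simp

lemma l2cont_partial: "b \<in> Basis \<Longrightarrow> l2cont (\<lambda>t. partial b (u t))"
  using l2cont_partials[of "[b]"] by simp

lemma l2cont_laplacian: "l2cont (\<lambda>t. laplacian (u t))"
proof -
  have "l2cont (\<lambda>t. partial b (partial b (u t)))" if "b \<in> Basis" for b
    using l2cont_partials[of "[b, b]"] that by simp
  then show ?thesis
    using l2cont_sum[of Basis "\<lambda>b t. partial b (partial b (u t))"] unfolding laplacian_def[abs_def] by simp
qed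

text \<open>The uniform bound \<open>C\<close> on the values of \<open>u\<close> makes the
  nonlinearity Lipschitz along the solution, so it inherits continuity in L^2.\<close>

lemma l2cont_nl: "l2cont (\<lambda>t x. nl p (u t x))"
proof (rule l2cont_comparison[OF l2cont_u])
  have [measurable]: "u t \<in> borel_measurable borel" for t by (rule smooth_measurable[OF smooth_u])
  show L: "(\<lambda>x. nl p (u t x)) \<in> L2" for t
    unfolding nl_def
  proof (rule L2_bdd_mult[OF u_L2])
    show "norm (complex_of_real (norm (u t x) powr p)) \<le> C powr p" for x
      using u_le[of t x] p_pos by (auto intro!: powr_mono2)
  qed measurable
  show "sqn (\<lambda>x. nl p (u s x) - nl p (u t x)) \<le> ((1 + p) * C powr p)\<^sup>2 * sqn (\<lambda>x. u s x - u t x)" for s t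
  proof -
    have "sqn (\<lambda>x. nl p (u s x) - nl p (u t x)) \<le> (LINT x|lborel. ((1 + p) * C powr p)\<^sup>2 * (norm (u s x - u t x))\<^sup>2)"
      unfolding sqn_def
    proof (rule integral_mono)
      show "integrable lborel (\<lambda>x. (norm (nl p (u s x) - nl p (u t x)))\<^sup>2)"
        by (intro L2_integrable L2_diff L)
      show "integrable lborel (\<lambda>x. ((1 + p) * C powr p)\<^sup>2 * (norm (u s x - u t x))\<^sup>2)"
        by (intro integrable_mult_right L2_integrable L2_diff smooth_H2_L2 u_H2)
      show "(norm (nl p (u s x) - nl p (u t x)))\<^sup>2 \<le> ((1 + p) * C powr p)\<^sup>2 * (norm (u s x - u t x))\<^sup>2" for x
        unfolding power_mult_distrib[symmetric]
        by (intro power_mono nl_Lipschitz u_le p_pos norm_ge_zero)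
    qed
    then show ?thesis by (simp add: sqn_def)
  qed
qed

lemma nl_L2: "(\<lambda>x. nl p (u t x)) \<in> L2"
  by (rule l2cont_L2[OF l2cont_nl])

text \<open>The pairing of Delta^2 u - \<mu> Delta u + \<epsilon> |u|^p u with \<psi>, with the
  derivatives shared between both sides so that it makes sense for \<psi> in H^2. The equation
  reads: i times the time derivative of \<open>ip (u s) \<psi>\<close> equals
  \<open>F s \<psi>\<close>.\<close>

definition F :: "real \<Rightarrow> ('a \<Rightarrow> complex) \<Rightarrow> complex" where
  "F s \<psi> = ip (laplacian (u s)) (laplacian \<psi>) + of_real \<mu> * (\<Sum>b\<in>Basis. ip (partial b (u s)) (partial b \<psi>))
     + of_real \<epsilon> * ip (\<lambda>x. nl p (u s x)) \<psi>"

lemma F_continuous: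
  assumes "smooth_H2 \<psi>" shows "continuous_on S (\<lambda>s. F s \<psi>)"
  unfolding F_def
  by (intro continuous_intros
      ip_continuous2[OF l2cont_laplacian l2cont_const[OF smooth_H2_laplacian[OF assms]] continuous_on_id continuous_on_const]
      ip_continuous2[OF l2cont_partial l2cont_const[OF smooth_H2_partial[OF assms]] continuous_on_id continuous_on_const]
      ip_continuous2[OF l2cont_nl l2cont_const[OF smooth_H2_L2[OF assms]] continuous_on_id continuous_on_const])

text \<open>The definition of a solution uses bilinear pairings, whereas \<open>ip\<close>
  conjugates its second argument; so the equation is tested with the conjugate of \<psi>.\<close>

lemma weak_equation_test:
  assumes \<psi>: "test_function \<psi>"
  shows "((\<lambda>s. ip (u s) \<psi>) has_vector_derivative (- \<i> * F t \<psi>)) (at t)"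
proof -
  let ?\<phi> = "\<lambda>x. cnj (\<psi> x)"
  have s: "smooth \<psi>" using \<psi> by (rule test_function_smooth)
  have \<phi>: "test_function ?\<phi>"
    using \<psi> by (intro test_functionI smooth_cnj s) (simp add: test_function_bounded)
  have t1: "test_function (laplacian ?\<phi>)" "test_function (laplacian (laplacian ?\<phi>))"
    using \<phi> by (auto intro: test_function_laplacian)
  obtain d where d: "((\<lambda>s. LINT x|lborel. u s x * ?\<phi> x) has_vector_derivative d) (at t)"
    "\<i> * d + (LINT x|lborel. u t x * (of_real \<mu> * laplacian ?\<phi> x - laplacian (laplacian ?\<phi>) x))
               = of_real \<epsilon> * (LINT x|lborel. of_real (norm (u t x) powr p) * u t x * ?\<phi> x)"
    using sol \<phi> unfolding biharmonic_NLS_solution_def by blast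
  have I: "integrable lborel (\<lambda>x. u t x * \<eta> x)" if "test_function \<eta>" for \<eta>
    by (rule integrable_test_mult[OF that smooth_continuous[OF smooth_u]])
  have "(LINT x|lborel. u t x * (of_real \<mu> * laplacian ?\<phi> x - laplacian (laplacian ?\<phi>) x))
    = (LINT x|lborel. of_real \<mu> * (u t x * laplacian ?\<phi> x) - u t x * laplacian (laplacian ?\<phi>) x)"
    by (simp add: algebra_simps)
  also have "\<dots> = of_real \<mu> * (LINT x|lborel. u t x * laplacian ?\<phi> x) - (LINT x|lborel. u t x * laplacian (laplacian ?\<phi>) x)"
    by (subst Bochner_Integration.integral_diff) (auto intro!: I t1)
  also have "(LINT x|lborel. u t x * laplacian ?\<phi> x) = - (\<Sum>b\<in>Basis. ip (partial b (u t)) (partial b \<psi>))"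
    unfolding test_integral_laplacian(1)[OF \<phi> smooth_u] ip_def using partial_cnj[OF s] by simp
  also have "(LINT x|lborel. u t x * laplacian (laplacian ?\<phi>) x) = ip (laplacian (u t)) (laplacian \<psi>)"
    using test_integral_laplacian(2)[OF t1(1) smooth_u, of t] unfolding ip_def by (simp add: laplacian_cnj[OF s])
  finally have eq: "(LINT x|lborel. u t x * (of_real \<mu> * laplacian ?\<phi> x - laplacian (laplacian ?\<phi>) x))
    = of_real \<mu> * - (\<Sum>b\<in>Basis. ip (partial b (u t)) (partial b \<psi>)) - ip (laplacian (u t)) (laplacian \<psi>)" .
  have "\<i> * d = F t \<psi>"
    using d(2)[unfolded eq] unfolding F_def nl_def ip_def[of "\<lambda>x. _ x * _ x"] by (simp add: algebra_simps)
  then have "d = - \<i> * F t \<psi>"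
    by (metis minus_mult_left mult.assoc i_squared mult_minus1 minus_minus mult.left_neutral)
  then show ?thesis using d(1) by (simp add: ip_def)
qed

text \<open>The integrated equation is stable under approximation of \<psi>: \<open>F s\<close>
  depends continuously on \<psi> in the H^2 sense, uniformly for s in a compact interval. A limit
  inside the derivative would not be justified by convergence of the pairings alone.\<close>

lemma weak_equation:
  assumes \<psi>: "smooth_H2 \<psi>" and ab: "a \<le> b"
  shows "ip (u b) \<psi> - ip (u a) \<psi> = - \<i> * integral {a..b} (\<lambda>s. F s \<psi>)"
proof -
  obtain \<phi> where \<phi>: "\<And>k::nat. test_function (\<phi> k)" and n: "l2null (\<lambda>k x. \<phi> k x - \<psi> x)"
    "\<And>b. b \<in> Basis \<Longrightarrow> l2null (\<lambda>k x. partial b (\<phi> k) x - partial b \<psi> x)"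
    "l2null (\<lambda>k x. laplacian (\<phi> k) x - laplacian \<psi> x)"
    by (rule smooth_H2_approx[OF \<psi>], rule that)
  have test_smooth_H2: "smooth_H2 f" if "test_function f" for f :: "'a \<Rightarrow> complex"
    unfolding smooth_H2_def
    by (intro conjI ballI impI test_function_smooth[OF that] test_function_L2 test_function_partials[OF that])
  note \<phi>H = test_smooth_H2[OF \<phi>]
  have id: "ip (u b) (\<phi> k) - ip (u a) (\<phi> k) = - \<i> * integral {a..b} (\<lambda>s. F s (\<phi> k))" for k
  proof -
    have "((\<lambda>s. - \<i> * F s (\<phi> k)) has_integral ip (u b) (\<phi> k) - ip (u a) (\<phi> k)) {a..b}"
      by (rule fundamental_theorem_of_calculus[OF ab])
        (use weak_equation_test[OF \<phi>] has_vector_derivative_at_within in blast)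
    from integral_unique[OF this] show ?thesis
      unfolding Henstock_Kurzweil_Integration.integral_mult_right by (rule sym)
  qed
  \<comment> \<open>Collects the norms of the solution that occur in \<open>F s\<close>; its maximum
    over the compact interval gives the uniformity in s.\<close>
  define A where "A = (\<lambda>s. sqrt (sqn (laplacian (u s))) + (\<Sum>b\<in>Basis. sqrt (sqn (partial b (u s)))) + sqrt (sqn (\<lambda>x. nl p (u s x))))"
  have "continuous_on {a..b} A"
    unfolding A_def
    by (intro continuous_intros sqn_continuous[OF l2cont_laplacian] sqn_continuous[OF l2cont_partial] sqn_continuous[OF l2cont_nl])
  then have "bounded (A ` {a..b})" by (intro compact_imp_bounded compact_continuous_image) auto
  then obtain M where M: "\<And>s. s \<in> {a..b} \<Longrightarrow> A s \<le> M"
    unfolding bounded_iff by (metis abs_le_D1 imageI real_norm_def)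
  define e where "e = (\<lambda>k. sqrt (sqn (\<lambda>x. laplacian (\<phi> k) x - laplacian \<psi> x))
     + \<bar>\<mu>\<bar> * (\<Sum>b\<in>Basis. sqrt (sqn (\<lambda>x. partial b (\<phi> k) x - partial b \<psi> x))) + \<bar>\<epsilon>\<bar> * sqrt (sqn (\<lambda>x. \<phi> k x - \<psi> x)))"
  have "e \<longlonglongrightarrow> sqrt 0 + \<bar>\<mu>\<bar> * (\<Sum>b\<in>(Basis::'a set). sqrt 0) + \<bar>\<epsilon>\<bar> * sqrt 0"
    unfolding e_def by (intro tendsto_intros) (use n in \<open>auto simp: l2null_def\<close>)
  then have e0: "e \<longlonglongrightarrow> 0" by simp
  have le: "norm (F s (\<phi> k) - F s \<psi>) \<le> M * e k" if s: "s \<in> {a..b}" for s k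
  proof -
    have nn: "0 \<le> (\<Sum>b\<in>Basis. sqrt (sqn (partial b (u s))))" by (intro sum_nonneg) simp
    have sq: "sqrt (sqn f) \<ge> 0" for f :: "'a \<Rightarrow> complex" by simp
    have A1: "sqrt (sqn (laplacian (u s))) \<le> M" "sqrt (sqn (\<lambda>x. nl p (u s x))) \<le> M"
      using M[OF s] nn sq[of "laplacian (u s)"] sq[of "\<lambda>x. nl p (u s x)"] unfolding A_def by linarith+
    have A2: "sqrt (sqn (partial b (u s))) \<le> M" if "b \<in> Basis" for b
    proof -
      have "sqrt (sqn (partial b (u s))) \<le> (\<Sum>b\<in>Basis. sqrt (sqn (partial b (u s))))"
        using that by (intro member_le_sum) auto
      then show ?thesis using M[OF s] sq[of "laplacian (u s)"] sq[of "\<lambda>x. nl p (u s x)"] unfolding A_def by linarith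
    qed
    have M0: "M \<ge> 0" using A1(1) sq[of "laplacian (u s)"] by linarith
    have 1: "norm (ip (laplacian (u s)) (laplacian (\<phi> k)) - ip (laplacian (u s)) (laplacian \<psi>))
      \<le> M * sqrt (sqn (\<lambda>x. laplacian (\<phi> k) x - laplacian \<psi> x))"
      by (rule order_trans[OF CS_ip_diff[OF lap_L2 smooth_H2_laplacian[OF \<phi>H] smooth_H2_laplacian[OF \<psi>]]]) (intro mult_right_mono A1 sq)
    have 2: "norm (ip (\<lambda>x. nl p (u s x)) (\<phi> k) - ip (\<lambda>x. nl p (u s x)) \<psi>) \<le> M * sqrt (sqn (\<lambda>x. \<phi> k x - \<psi> x))"
      by (rule order_trans[OF CS_ip_diff[OF nl_L2 smooth_H2_L2[OF \<phi>H] smooth_H2_L2[OF \<psi>]]]) (intro mult_right_mono A1 sq)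
    have 3: "norm (ip (partial b (u s)) (partial b (\<phi> k)) - ip (partial b (u s)) (partial b \<psi>))
      \<le> M * sqrt (sqn (\<lambda>x. partial b (\<phi> k) x - partial b \<psi> x))" if b: "b \<in> Basis" for b
      by (rule order_trans[OF CS_ip_diff[OF partial_L2[OF b] smooth_H2_partial[OF \<phi>H b] smooth_H2_partial[OF \<psi> b]]]) (intro mult_right_mono A2 sq b)
    let ?d1 = "ip (laplacian (u s)) (laplacian (\<phi> k)) - ip (laplacian (u s)) (laplacian \<psi>)"
    let ?d2 = "\<Sum>b\<in>Basis. ip (partial b (u s)) (partial b (\<phi> k)) - ip (partial b (u s)) (partial b \<psi>)"
    let ?d3 = "ip (\<lambda>x. nl p (u s x)) (\<phi> k) - ip (\<lambda>x. nl p (u s x)) \<psi>"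
    have eq: "F s (\<phi> k) - F s \<psi> = ?d1 + of_real \<mu> * ?d2 + of_real \<epsilon> * ?d3"
      unfolding F_def sum_subtractf by (simp add: algebra_simps)
    have "norm (F s (\<phi> k) - F s \<psi>) \<le> norm ?d1 + norm (of_real \<mu> * ?d2) + norm (of_real \<epsilon> * ?d3)"
      unfolding eq by (intro norm_triangle_mono order_refl)
    moreover have "norm (of_real \<mu> * ?d2) \<le> \<bar>\<mu>\<bar> * (\<Sum>b\<in>Basis. M * sqrt (sqn (\<lambda>x. partial b (\<phi> k) x - partial b \<psi> x)))"
      unfolding norm_mult norm_of_real by (intro mult_left_mono sum_norm_le 3) auto
    moreover have "norm (of_real \<epsilon> * ?d3) \<le> \<bar>\<epsilon>\<bar> * (M * sqrt (sqn (\<lambda>x. \<phi> k x - \<psi> x)))"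
      unfolding norm_mult norm_of_real by (intro mult_left_mono 2) auto
    ultimately show ?thesis
      using 1 unfolding e_def by (simp add: algebra_simps sum_distrib_left)
  qed
  have lim1: "(\<lambda>k. integral {a..b} (\<lambda>s. F s (\<phi> k))) \<longlonglongrightarrow> integral {a..b} (\<lambda>s. F s \<psi>)"
  proof -
    have "norm (integral {a..b} (\<lambda>s. F s (\<phi> k)) - integral {a..b} (\<lambda>s. F s \<psi>)) \<le> M * e k * (b - a)" for k
    proof -
      have "integral {a..b} (\<lambda>s. F s (\<phi> k)) - integral {a..b} (\<lambda>s. F s \<psi>) = integral {a..b} (\<lambda>s. F s (\<phi> k) - F s \<psi>)"
        by (rule Henstock_Kurzweil_Integration.integral_diff[symmetric])
          (intro integrable_continuous_interval F_continuous \<phi>H \<psi>)+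
      also have "norm \<dots> \<le> M * e k * (b - a)"
        by (rule integral_bound[OF ab]) (use le in \<open>auto intro!: continuous_intros F_continuous \<phi>H \<psi>\<close>)
      finally show ?thesis .
    qed
    moreover have "(\<lambda>k. M * e k * (b - a)) \<longlonglongrightarrow> M * 0 * (b - a)" by (intro tendsto_intros e0)
    ultimately show ?thesis
      by (subst LIM_zero_iff[symmetric]) (rule Lim_null_comparison[of _ "\<lambda>k. M * e k * (b - a)"], auto)
  qed
  have lim2: "(\<lambda>k. ip (u s) (\<phi> k)) \<longlonglongrightarrow> ip (u s) \<psi>" for s
  proof -
    have le: "norm (ip (u s) (\<phi> k) - ip (u s) \<psi>) \<le> sqrt (sqn (u s)) * sqrt (sqn (\<lambda>x. \<phi> k x - \<psi> x))" for k
      by (rule CS_ip_diff[OF u_L2 smooth_H2_L2[OF \<phi>H] smooth_H2_L2[OF \<psi>]])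
    have "(\<lambda>k. sqrt (sqn (u s)) * sqrt (sqn (\<lambda>x. \<phi> k x - \<psi> x))) \<longlonglongrightarrow> sqrt (sqn (u s)) * sqrt 0"
      using n(1) unfolding l2null_def by (intro tendsto_intros) blast
    then show ?thesis
      by (subst LIM_zero_iff[symmetric])
        (rule Lim_null_comparison[of _ "\<lambda>k. sqrt (sqn (u s)) * sqrt (sqn (\<lambda>x. \<phi> k x - \<psi> x))"], use le in auto)
  qed
  have "(\<lambda>k. ip (u b) (\<phi> k) - ip (u a) (\<phi> k)) \<longlonglongrightarrow> ip (u b) \<psi> - ip (u a) \<psi>"
    by (intro tendsto_intros lim2)
  moreover have "(\<lambda>k. - \<i> * integral {a..b} (\<lambda>s. F s (\<phi> k))) \<longlonglongrightarrow> - \<i> * integral {a..b} (\<lambda>s. F s \<psi>)"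
    by (intro tendsto_intros lim1)
  ultimately show ?thesis unfolding id by (rule LIMSEQ_unique)
qed

text \<open>The integrand in \<open>weak_equation\<close> is continuous in time, so the differential
  form returns by the fundamental theorem. The interval is chosen to have t in its interior.\<close>

lemma weak_derivative:
  assumes \<psi>: "smooth_H2 \<psi>"
  shows "((\<lambda>s. ip (u s) \<psi>) has_vector_derivative (- \<i> * F t \<psi>)) (at t)"
proof -
  have "((\<lambda>s. integral {t - 1..s} (\<lambda>s. F s \<psi>)) has_vector_derivative F t \<psi>) (at t within {t - 1..t + 1})"
    by (intro integral_has_vector_derivative F_continuous \<psi>) auto
  then have "((\<lambda>s. ip (u (t - 1)) \<psi> + (- \<i>) * integral {t - 1..s} (\<lambda>s. F s \<psi>)) has_vector_derivative (- \<i>) * F t \<psi>) (at t within {t - 1..t + 1})"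
    by (auto intro!: derivative_eq_intros)
  then have "((\<lambda>s. ip (u s) \<psi>) has_vector_derivative (- \<i>) * F t \<psi>) (at t within {t - 1..t + 1})"
  proof (rule has_vector_derivative_transform[rotated 2])
    show "ip (u s) \<psi> = ip (u (t - 1)) \<psi> + (- \<i>) * integral {t - 1..s} (\<lambda>s. F s \<psi>)" if "s \<in> {t - 1..t + 1}" for s
      using weak_equation[OF \<psi>, of "t - 1" s] that by (simp add: algebra_simps)
  qed auto
  moreover have "at t within {t - 1..t + 1} = at t"
    by (rule at_within_interior) simp
  ultimately show ?thesis by simp
qed

end

section \<open>Conservation of mass and energy\<close>

text \<open>Partial derivatives, one of which is jointly continuous, give total differentiability,
  and the chain rule then applies along the line of pairs (t + r, t).\<close>

lemma has_vector_derivative_diagonal: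
  fixes H H1 H2 :: "real \<Rightarrow> real \<Rightarrow> complex"
  assumes H1: "\<And>s t. ((\<lambda>s. H s t) has_vector_derivative H1 s t) (at s)"
    and H2: "\<And>s t. ((\<lambda>t. H s t) has_vector_derivative H2 s t) (at t)"
    and cont: "continuous_on UNIV (\<lambda>q. H2 (fst q) (snd q))"
  shows "((\<lambda>t. H (t + r) t) has_vector_derivative (H1 (t + r) t + H2 (t + r) t)) (at t)"
proof -
  have "((\<lambda>(x, y). H x y) has_derivative (\<lambda>(tx, ty). tx *\<^sub>R H1 (t + r) t + blinfun_scaleR_left (H2 (t + r) t) ty))
      (at (t + r, t) within UNIV \<times> UNIV)"
  proof (rule has_derivative_partialsI)
    show "((\<lambda>x. H x t) has_derivative (\<lambda>tx. tx *\<^sub>R H1 (t + r) t)) (at (t + r) within UNIV)"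
      using H1[of t "t + r"] by (simp add: has_vector_derivative_def)
    show "((\<lambda>y. H x y) has_derivative blinfun_apply (blinfun_scaleR_left (H2 x y))) (at y within UNIV)" for x y
      using H2[of x y] by (simp add: has_vector_derivative_def)
    have "isCont (\<lambda>q. blinfun_scaleR_left (H2 (fst q) (snd q))) (t + r, t)"
      using cont by (intro bounded_linear.isCont[OF bounded_linear_blinfun_scaleR_left])
        (simp add: continuous_on_eq_continuous_at)
    then show "continuous (at (t + r, t) within UNIV \<times> UNIV) (\<lambda>(x, y). blinfun_scaleR_left (H2 x y))"
      by (simp add: case_prod_unfold)
  qed auto
  then have "((\<lambda>(x, y). H x y) has_derivative (\<lambda>(tx, ty). tx *\<^sub>R H1 (t + r) t + ty *\<^sub>R H2 (t + r) t)) (at ((\<lambda>t. (t + r, t)) t))"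
    by simp
  moreover have "((\<lambda>t. (t + r, t)) has_derivative (\<lambda>h. (h, h))) (at t)"
    by (auto intro!: derivative_eq_intros)
  ultimately have "(((\<lambda>(x, y). H x y) \<circ> (\<lambda>t. (t + r, t))) has_derivative ((\<lambda>(tx, ty). tx *\<^sub>R H1 (t + r) t + ty *\<^sub>R H2 (t + r) t) \<circ> (\<lambda>h. (h, h)))) (at t)"
    by (rule diff_chain_at[rotated])
  then show ?thesis
    by (simp add: has_vector_derivative_def o_def scaleR_add_right)
qed

text \<open>Uniform continuity on a compact strip around the diagonal makes smallness in r uniform
  in t.\<close>

lemma diagonal_uniform:
  fixes D :: "real \<times> real \<Rightarrow> real"
  assumes "continuous_on UNIV D" "\<And>t. D (0, t) = 0" "e > 0"
  obtains d where "d > 0" "\<And>r t. \<bar>r\<bar> < d \<Longrightarrow> t \<in> {a..b} \<Longrightarrow> \<bar>D (r, t)\<bar> < e"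
proof -
  have "uniformly_continuous_on ({-1..1} \<times> {a..b}) D"
    by (intro compact_uniformly_continuous compact_Times continuous_on_subset[OF assms(1)]) auto
  then obtain d where d: "d > 0" "\<And>q q'. q \<in> {-1..1} \<times> {a..b} \<Longrightarrow> q' \<in> {-1..1} \<times> {a..b} \<Longrightarrow> dist q' q < d \<Longrightarrow> dist (D q') (D q) < e"
    using assms(3) unfolding uniformly_continuous_on_def by metis
  show thesis
  proof (rule that[of "min d 1"])
    show "min d 1 > 0" using d(1) by simp
    fix r t :: real assume "\<bar>r\<bar> < min d 1" "t \<in> {a..b}"
    then have "r \<in> {-1..1}" "\<bar>r\<bar> < d" "t \<in> {a..b}" by auto
    then show "\<bar>D (r, t)\<bar> < e"
      using d(2)[of "(0, t)" "(r, t)"] assms(2)[of t] by (simp add: dist_Pair_Pair dist_real_def)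
  qed
qed

context nls
begin

text \<open>Pairings of two different times: they are scalar, differentiable in each time, and with jointly
  continuous derivatives, although \<open>u\<close> itself need not be differentiable in time.\<close>

definition S :: "real \<Rightarrow> real \<Rightarrow> complex" where "S s t = ip (u s) (u t)"

text \<open>The polarised quadratic part of the energy: a Hermitian form taken at two times.\<close>

definition K :: "real \<Rightarrow> real \<Rightarrow> complex" where
  "K s t = ip (laplacian (u s)) (laplacian (u t)) + of_real \<mu> * (\<Sum>b\<in>Basis. ip (partial b (u s)) (partial b (u t)))"

definition n2 :: "real \<Rightarrow> real \<Rightarrow> complex" where "n2 s t = ip (\<lambda>x. nl p (u s x)) (u t)"

definition N :: "real \<Rightarrow> real" where "N t = (LINT x|lborel. norm (u t x) powr (p + 2))"

lemma F_u: "F s (u t) = K s t + of_real \<epsilon> * n2 s t"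
  by (simp add: F_def K_def n2_def)

lemma K_cnj: "cnj (K s t) = K t s"
  by (simp add: K_def ip_cnj_commute)

lemma nl_mult_cnj: "nl p z * cnj z = of_real (norm z powr (p + 2))"
proof -
  have "nl p z * cnj z = of_real (norm z powr p) * of_real ((norm z)\<^sup>2)"
    by (simp only: nl_def mult.assoc complex_norm_square)
  then show ?thesis by (cases "z = 0") (simp_all add: powr_add nl_def)
qed

lemma n2_diag: "n2 t t = of_real (N t)"
  unfolding n2_def ip_def nl_mult_cnj N_def integral_complex_of_real ..

lemma K_continuous: "continuous_on T a \<Longrightarrow> continuous_on T b \<Longrightarrow> continuous_on T (\<lambda>q. K (a q) (b q))"
  unfolding K_def
  by (intro continuous_intros ip_continuous2[OF l2cont_laplacian l2cont_laplacian]
      ip_continuous2[OF l2cont_partial l2cont_partial])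

lemma n2_continuous: "continuous_on T a \<Longrightarrow> continuous_on T b \<Longrightarrow> continuous_on T (\<lambda>q. n2 (a q) (b q))"
  unfolding n2_def by (intro ip_continuous2[OF l2cont_nl l2cont_u])

lemma N_continuous: "continuous_on T a \<Longrightarrow> continuous_on T (\<lambda>q. N (a q))"
  using continuous_on_Re[OF n2_continuous[of T a a]] by (simp add: n2_diag)

lemma F_u_continuous: "continuous_on T a \<Longrightarrow> continuous_on T b \<Longrightarrow> continuous_on T (\<lambda>q. F (a q) (u (b q)))"
  unfolding F_u by (intro continuous_intros K_continuous n2_continuous)

lemma Im_F_diag: "Im (F t (u t)) = 0"
proof -
  have "cnj (K t t) = K t t" by (rule K_cnj)
  then have "Im (K t t) = 0" by (simp add: complex_eq_iff)
  then show ?thesis by (simp add: F_u n2_diag)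
qed

lemma S_deriv1: "((\<lambda>s. S s t) has_vector_derivative - \<i> * F s (u t)) (at s)"
  unfolding S_def by (rule weak_derivative[OF u_H2])

lemma S_deriv2: "((\<lambda>t. S s t) has_vector_derivative \<i> * cnj (F t (u s))) (at t)"
proof -
  have "((\<lambda>t. cnj (S t s)) has_vector_derivative cnj (- \<i> * F t (u s))) (at t)"
    by (rule has_vector_derivative_cnj[OF S_deriv1])
  then show ?thesis by (simp add: S_def ip_cnj_commute)
qed

lemma S_diagonal_deriv:
  "((\<lambda>t. S (t + r) t) has_vector_derivative \<i> * (cnj (F t (u (t + r))) - F (t + r) (u t))) (at t)"
  using has_vector_derivative_diagonal[OF S_deriv1 S_deriv2, where r = r and t = t]
  by (simp add: continuous_intros F_u_continuous algebra_simps)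

text \<open>The derivative along the diagonal at r = 0 involves only the imaginary part of
  \<open>F t (u t)\<close>, which vanishes.\<close>

lemma mass_const: "sqn (u t) = sqn (u s)"
proof -
  have "((\<lambda>t. S t t) has_vector_derivative 0) (at t)" for t
  proof -
    have "cnj (F t (u t)) = F t (u t)" using Im_F_diag[of t] by (simp add: complex_eq_iff)
    then show ?thesis using S_diagonal_deriv[of 0 t] by simp
  qed
  then obtain c where "\<And>t. S t t = c"
    using has_vector_derivative_zero_constant[of UNIV "\<lambda>t. S t t"] by auto
  then have "S t t = S s s" by simp
  then show ?thesis by (simp add: S_def ip_self)
qed

text \<open>Continuity in H^2 alone gives no rate. By conservation of mass the squared increment
  equals 2 \<open>sqn (u t)\<close> - 2 Re S(t + r, t), whose derivative in r is -2 Im F(t + r,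
  u(t)); this vanishes at r = 0, uniformly for t in [a, b], so the increment is o(r).\<close>

lemma sqn_increment_le:
  assumes "e > 0"
  obtains d where "d > 0"
    "\<And>r t. 0 < r \<Longrightarrow> r < d \<Longrightarrow> t \<in> {a..b} \<Longrightarrow> sqn (\<lambda>x. u (t + r) x - u t x) \<le> e * r"
proof -
  define D where "D = (\<lambda>q. 2 * Im (F (snd q + fst q) (u (snd q))))"
  have "continuous_on UNIV D"
    unfolding D_def by (intro continuous_intros F_u_continuous)
  moreover have "D (0, t) = 0" for t by (simp add: D_def Im_F_diag)
  ultimately obtain d where d: "d > 0" "\<And>r t. \<bar>r\<bar> < d \<Longrightarrow> t \<in> {a..b} \<Longrightarrow> \<bar>D (r, t)\<bar> < e"
    using diagonal_uniform[of D e a b] assms by blast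
  show thesis
  proof (rule that[OF d(1)])
    fix r t :: real assume r: "0 < r" "r < d" and t: "t \<in> {a..b}"
    define q where "q = (\<lambda>r. 2 * sqn (u t) - 2 * Re (S (t + r) t))"
    have q: "q r = sqn (\<lambda>x. u (t + r) x - u t x)" for r
      unfolding q_def S_def using sqn_diff[OF u_L2 u_L2, of "t + r" t] mass_const[of "t + r" t]
      by simp
    have dq: "(q has_real_derivative - D (r, t)) (at r)" for r
    proof -
      have "((\<lambda>r. Re (S (t + r) t)) has_vector_derivative Re (- \<i> * F (t + r) (u t))) (at r)"
      proof (rule bounded_linear.has_vector_derivative[OF bounded_linear_Re])
        have "((\<lambda>s. S s t) \<circ> (\<lambda>r. t + r) has_vector_derivative 1 *\<^sub>R (- \<i> * F (t + r) (u t))) (at r)"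
        proof (rule vector_diff_chain_at)
          show "((+) t has_vector_derivative 1) (at r)"
            by (auto intro!: derivative_eq_intros simp: has_vector_derivative_def)
        qed (rule S_deriv1)
        then show "((\<lambda>r. S (t + r) t) has_vector_derivative - \<i> * F (t + r) (u t)) (at r)" by (simp add: o_def)
      qed
      then have "((\<lambda>r. Re (S (t + r) t)) has_real_derivative Im (F (t + r) (u t))) (at r)"
        by (simp add: has_real_derivative_iff_has_vector_derivative)
      from DERIV_diff[OF DERIV_const[of "2 * sqn (u t)"] DERIV_cmult[OF this, of 2]] show ?thesis
        unfolding q_def D_def by simp
    qed
    obtain z where z: "0 < z" "z < r" "q r - q 0 = (r - 0) * - D (z, t)"
      using MVT2[of 0 r q "\<lambda>r. - D (r, t)"] r dq by blast
    have "q 0 = 0" unfolding q by (simp add: sqn_def)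
    moreover have "- D (z, t) \<le> e" using d(2)[of z t] z r t by simp
    ultimately have "q r \<le> r * e" using z(3) r mult_left_mono[of "- D (z, t)" e r] by simp
    then show "sqn (\<lambda>x. u (t + r) x - u t x) \<le> e * r" by (simp add: q mult.commute)
  qed
qed

lemma N_integrable: "integrable lborel (\<lambda>x. norm (u t x) powr (p + 2))"
proof -
  have "integrable lborel (\<lambda>x. nl p (u t x) * cnj (u t x))"
    by (rule ip_integrable[OF nl_L2 u_L2])
  then have "integrable lborel (\<lambda>x. complex_of_real (norm (u t x) powr (p + 2)))" by (simp only: nl_mult_cnj)
  then show ?thesis by (simp only: complex_of_real_integrable_eq)
qed

lemma N_expand:
  "\<bar>N s - N t - (p + 2) * Re (n2 t s - n2 t t)\<bar> \<le> (p + 2) * (1 + p) * C powr p * sqn (\<lambda>x. u s x - u t x)"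
proof -
  let ?f = "\<lambda>x. norm (u s x) powr (p + 2) - norm (u t x) powr (p + 2) - (p + 2) * Re (nl p (u t x) * cnj (u s x - u t x))"
  have Ld: "(\<lambda>x. u s x - u t x) \<in> L2" by (intro L2_diff u_L2)
  have I: "integrable lborel (\<lambda>x. nl p (u t x) * cnj (u s x - u t x))"
    by (rule ip_integrable[OF nl_L2 Ld])
  have If: "integrable lborel ?f"
    by (intro Bochner_Integration.integrable_diff integrable_mult_right N_integrable integrable_Re I)
  have "integral\<^sup>L lborel ?f = N s - N t - (p + 2) * Re (ip (\<lambda>x. nl p (u t x)) (\<lambda>x. u s x - u t x))"
    unfolding N_def ip_def using N_integrable I
    by (simp add: Bochner_Integration.integral_diff integrable_Re del: complex_cnj_diff times_complex.sel)
  also have "ip (\<lambda>x. nl p (u t x)) (\<lambda>x. u s x - u t x) = n2 t s - n2 t t"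
    unfolding n2_def by (rule ip_diff_right[OF nl_L2 u_L2 u_L2])
  finally have eq: "integral\<^sup>L lborel ?f = N s - N t - (p + 2) * Re (n2 t s - n2 t t)" .
  have "\<bar>integral\<^sup>L lborel ?f\<bar> \<le> (LINT x|lborel. \<bar>?f x\<bar>)"
    using integral_norm_bound[of lborel ?f] by simp
  also have "\<dots> \<le> (LINT x|lborel. (p + 2) * (1 + p) * C powr p * (norm (u s x - u t x))\<^sup>2)"
    by (rule integral_mono[OF integrable_abs[OF If]])
      (use p_pos in \<open>intro integrable_mult_right L2_integrable Ld powr_expand u_le; simp\<close>)+
  finally show ?thesis unfolding eq by (simp add: sqn_def)
qed

lemma energy_eq: "energy \<mu> \<epsilon> p (u t) = Re (K t t) + \<epsilon> * (2 / (p + 2)) * N t"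
proof -
  have g: "(gradient_norm f x)\<^sup>2 = (\<Sum>b\<in>Basis. (norm (partial b f x))\<^sup>2)" for f and x :: 'a
    unfolding gradient_norm_def by (intro real_sqrt_pow2 sum_nonneg) simp
  have I1: "integrable lborel (\<lambda>x. (norm (laplacian (u t) x))\<^sup>2)"
    by (rule L2_integrable[OF lap_L2])
  have I2: "integrable lborel (\<lambda>x. (norm (partial b (u t) x))\<^sup>2)" if "b \<in> Basis" for b
    by (rule L2_integrable[OF partial_L2[OF that]])
  have "energy \<mu> \<epsilon> p (u t) = sqn (laplacian (u t)) + \<mu> * (\<Sum>b\<in>Basis. sqn (partial b (u t))) + \<epsilon> * (2 / (p + 2)) * N t"
    unfolding energy_def g sqn_def N_def
    using I1 I2 N_integrable by (simp add: Bochner_Integration.integral_sum)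
  then show ?thesis by (simp add: K_def ip_self)
qed

text \<open>As \<open>K\<close> is Hermitian, it cancels in the derivative of \<open>\<sigma>(t + r, t) = Im S(t + r, t)\<close> with respect to \<open>t\<close>,
  which therefore involves only the nonlinearity, while \<open>\<sigma>(t + r, t) / r\<close> recovers \<open>-(K + \<epsilon> N)\<close> at time \<open>t\<close> as \<open>r\<close> tends to \<open>0\<close>.\<close>

lemma energy_conserved_aux:
  assumes "a \<le> b"
  shows "energy \<mu> \<epsilon> p (u a) = energy \<mu> \<epsilon> p (u b)"
proof -
  define \<sigma> where "\<sigma> = (\<lambda>s t. Im (S s t))"
  define m where "m = (\<lambda>r t. Re (n2 t (t + r)) - Re (n2 (t + r) t))"
  define L where "L = (1 + p) * C powr p"
  \<comment> \<open>Expanding N from time t and from time t + r gives m(r, t) = 2 (N(t + r) - N(t))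
    / (p + 2) - (N(t + r) - N(t)) up to quadratic errors; this is the resulting factor.\<close>
  define \<kappa> where "\<kappa> = 2 / (p + 2) - 1"
  define dN where "dN = (\<lambda>r. integral {a..b} (\<lambda>t. N (t + r) - N t))"
  define err where "err = (\<lambda>r. integral {a..b} (m r) - \<kappa> * dN r)"
  have L: "L > 0" using p_pos C_pos by (simp add: L_def)
  have diag: "\<sigma> (b + r) b - \<sigma> (a + r) a = \<epsilon> * integral {a..b} (m r)" for r
  proof -
    have "((\<lambda>t. \<sigma> (t + r) t) has_vector_derivative Im (\<i> * (cnj (F t (u (t + r))) - F (t + r) (u t)))) (at t within {a..b})" for t
      unfolding \<sigma>_def by (rule bounded_linear.has_vector_derivative[OF bounded_linear_Im has_vector_derivative_at_within[OF S_diagonal_deriv]])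
    moreover have "Im (\<i> * (cnj (F t (u (t + r))) - F (t + r) (u t))) = \<epsilon> * m r t" for t
    proof -
      have "Re (K t (t + r)) = Re (K (t + r) t)" unfolding K_cnj[of t "t + r", symmetric] by simp
      then show ?thesis by (simp add: F_u m_def algebra_simps)
    qed
    ultimately have "((\<lambda>t. \<epsilon> * m r t) has_integral \<sigma> (b + r) b - \<sigma> (a + r) a) {a..b}"
      using fundamental_theorem_of_calculus[OF assms, of "\<lambda>t. \<sigma> (t + r) t" "\<lambda>t. \<epsilon> * m r t"] by simp
    from integral_unique[OF this] show ?thesis
      unfolding Henstock_Kurzweil_Integration.integral_mult_right by (rule sym)
  qed
  have lim_\<sigma>: "((\<lambda>r. \<sigma> (t + r) t / r) \<longlongrightarrow> - (Re (K t t) + \<epsilon> * N t)) (at_right 0)" for t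
  proof -
    have "((\<lambda>s. \<sigma> s t) has_vector_derivative Im (- \<i> * F t (u t))) (at t)"
      unfolding \<sigma>_def by (rule bounded_linear.has_vector_derivative[OF bounded_linear_Im S_deriv1])
    then have "((\<lambda>s. \<sigma> s t) has_real_derivative - (Re (K t t) + \<epsilon> * N t)) (at t)"
      by (simp add: has_real_derivative_iff_has_vector_derivative F_u n2_diag)
    then have "((\<lambda>r. (\<sigma> (t + r) t - \<sigma> t t) / r) \<longlongrightarrow> - (Re (K t t) + \<epsilon> * N t)) (at 0)"
      by (simp add: DERIV_def)
    moreover have "\<sigma> t t = 0" by (simp add: \<sigma>_def S_def ip_self)
    ultimately show ?thesis by (simp add: filterlim_at_split)
  qed
  have int_N: "N integrable_on {c..d}" for c d
    by (intro integrable_continuous_interval N_continuous continuous_on_id)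
  \<comment> \<open>\<open>N\<close> is only known to be continuous. The integral of N(t + r) - N(t)
    telescopes to integrals over intervals of length r at both ends, whose averages converge to the
    end values.\<close>
  have lim_N: "((\<lambda>r. dN r / r) \<longlongrightarrow> N b - N a) (at_right 0)"
  proof -
    have at_right: "((\<lambda>r. integral {c..c + r} N / r) \<longlongrightarrow> N c) (at_right 0)" for c
    proof -
      have "((\<lambda>x. integral {c..x} N) has_real_derivative N c) (at c within {c..c + 1})"
        by (rule integral_has_real_derivative) (auto intro!: N_continuous continuous_on_id)
      then have "((\<lambda>x. integral {c..x} N) has_real_derivative N c) (at_right c)"
        by (simp add: at_within_Icc_at_right)
      then have "((\<lambda>y. (integral {c..y} N - integral {c..c} N) / (y - c)) \<longlongrightarrow> N c) (at_right c)"
        by (simp add: has_field_derivative_iff)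
      then have "((\<lambda>y. integral {c..y} N / (y - c)) \<longlongrightarrow> N c) (at_right (c + 0))" by simp
      then show ?thesis
        unfolding at_right_to_0[of "c + 0"] filterlim_filtermap by (simp add: add.commute)
    qed
    have eq: "dN r = integral {b..b + r} N - integral {a..a + r} N" if "r > 0" for r
    proof -
      have "dN r = integral {a..b} (\<lambda>t. N (t + r)) - integral {a..b} N"
        unfolding dN_def by (intro Henstock_Kurzweil_Integration.integral_diff int_N integrable_continuous_interval N_continuous continuous_intros)
      also have "integral {a..b} (\<lambda>t. N (t + r)) = integral {a + r..b + r} N"
        using integral_shift_Icc_real[of a b N r] by (simp add: o_def add.commute)
      also have "integral {a + r..b + r} N = integral {a..b + r} N - integral {a..a + r} N"
        using Henstock_Kurzweil_Integration.integral_combine[of a "a + r" "b + r" N] int_N that assms by simp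
      also have "integral {a..b + r} N = integral {a..b} N + integral {b..b + r} N"
        using Henstock_Kurzweil_Integration.integral_combine[of a b "b + r" N] int_N that assms by simp
      finally show ?thesis by simp
    qed
    have "((\<lambda>r. integral {b..b + r} N / r - integral {a..a + r} N / r) \<longlongrightarrow> N b - N a) (at_right 0)"
      by (intro tendsto_intros at_right)
    then show ?thesis
      by (rule Lim_transform_eventually)
        (auto simp: eventually_at_right_field eq diff_divide_distrib intro!: exI[of _ 1])
  qed
  have lim_err: "((\<lambda>r. err r / r) \<longlongrightarrow> 0) (at_right 0)"
  proof (rule tendstoI)
    fix e :: real assume e: "e > 0"
    define w where "w = b - a + 1"
    have w: "w > 0" "b - a \<le> w" using assms by (auto simp: w_def)
    \<comment> \<open>Chosen so that the final bound is e / 2; the extra 1 in \<open>w\<close> keeps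
      the denominator positive if a = b.\<close>
    define e' where "e' = e / (2 * (2 * L) * w)"
    have e': "e' > 0" using e L w by (simp add: e'_def)
    obtain d where d: "d > 0" "\<And>r t. 0 < r \<Longrightarrow> r < d \<Longrightarrow> t \<in> {a..b} \<Longrightarrow> sqn (\<lambda>x. u (t + r) x - u t x) \<le> e' * r"
      by (rule sqn_increment_le[OF e', of a b], rule that)
    have bd: "\<bar>err r / r\<bar> < e" if r: "0 < r" "r < d" for r
    proof -
      have le: "\<bar>m r t - \<kappa> * (N (t + r) - N t)\<bar> \<le> 2 * L * (e' * r)" if t: "t \<in> {a..b}" for t
      proof -
        let ?s = "sqn (\<lambda>x. u (t + r) x - u t x)"
        have comm: "sqn (\<lambda>x. u t x - u (t + r) x) = ?s" by (simp add: sqn_def norm_minus_commute)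
        have div: "\<bar>x / (p + 2) - y\<bar> \<le> L * ?s" if "\<bar>x - (p + 2) * y\<bar> \<le> (p + 2) * (1 + p) * C powr p * ?s" for x y
        proof -
          have "x - (p + 2) * y = (p + 2) * (x / (p + 2) - y)"
            using p_pos by (simp add: right_diff_distrib)
          then have "\<bar>x - (p + 2) * y\<bar> = (p + 2) * \<bar>x / (p + 2) - y\<bar>"
            using p_pos by (simp add: abs_mult)
          with that have "(p + 2) * \<bar>x / (p + 2) - y\<bar> \<le> (p + 2) * (L * ?s)" by (simp add: L_def mult_ac)
          then show ?thesis using p_pos by simp
        qed
        have 1: "\<bar>(N (t + r) - N t) / (p + 2) - Re (n2 t (t + r) - n2 t t)\<bar> \<le> L * ?s"
          by (rule div[OF N_expand])
        have 2: "\<bar>(N t - N (t + r)) / (p + 2) - Re (n2 (t + r) t - n2 (t + r) (t + r))\<bar> \<le> L * ?s"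
          by (rule div[OF N_expand[of t "t + r", unfolded comm]])
        have k: "\<kappa> * (N (t + r) - N t) = (N (t + r) - N t) / (p + 2) - (N t - N (t + r)) / (p + 2) - (N (t + r) - N t)"
          unfolding \<kappa>_def by (simp add: algebra_simps diff_divide_distrib)
        have "\<bar>m r t - \<kappa> * (N (t + r) - N t)\<bar> \<le> L * ?s + L * ?s"
          using 1 2 unfolding k m_def by (simp add: n2_diag)
        also have "\<dots> \<le> 2 * L * (e' * r)"
          using d(2)[OF r t] L by simp
        finally show ?thesis .
      qed
      have c1: "continuous_on {a..b} (m r)" "continuous_on {a..b} (\<lambda>t. N (t + r) - N t)"
        unfolding m_def by (intro continuous_intros n2_continuous N_continuous)+
      have "err r = integral {a..b} (\<lambda>t. m r t - \<kappa> * (N (t + r) - N t))"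
        unfolding err_def dN_def integral_mult_right[symmetric]
        by (rule Henstock_Kurzweil_Integration.integral_diff[symmetric])
          (intro integrable_continuous_interval c1 continuous_intros)+
      also have "norm \<dots> \<le> 2 * L * (e' * r) * (b - a)"
        by (rule integral_bound[OF assms]) (use le c1 in \<open>auto intro!: continuous_intros\<close>)
      finally have "\<bar>err r / r\<bar> \<le> 2 * L * e' * (b - a)"
        using r by (simp add: field_simps)
      also have "\<dots> \<le> 2 * L * e' * w"
        using L e' w by (intro mult_left_mono) auto
      also have "\<dots> = e / 2" unfolding e'_def using L w by (simp add: field_simps)
      also have "\<dots> < e" using e by simp
      finally show ?thesis .
    qed
    show "\<forall>\<^sub>F r in at_right 0. dist (err r / r) 0 < e"
      unfolding eventually_at_right_field using d(1) bd by (intro exI[of _ d]) auto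
  qed
  have "((\<lambda>r. \<epsilon> * (err r / r)
      + \<epsilon> * \<kappa> * (dN r / r)) \<longlongrightarrow> \<epsilon> * 0 + \<epsilon> * \<kappa> * (N b - N a)) (at_right 0)"
    by (intro tendsto_intros lim_err lim_N)
  moreover have "\<epsilon> * (err r / r)
      + \<epsilon> * \<kappa> * (dN r / r) = \<sigma> (b + r) b / r - \<sigma> (a + r) a / r" for r
    unfolding diff_divide_distrib[symmetric] diag err_def by (simp add: algebra_simps diff_divide_distrib)
  ultimately have "((\<lambda>r. \<sigma> (b + r) b / r - \<sigma> (a + r) a / r) \<longlongrightarrow> \<epsilon> * \<kappa> * (N b - N a)) (at_right 0)"
    by simp
  moreover have "((\<lambda>r. \<sigma> (b + r) b / r - \<sigma> (a + r) a / r) \<longlongrightarrow>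
      - (Re (K b b) + \<epsilon> * N b) - - (Re (K a a) + \<epsilon> * N a)) (at_right 0)"
    by (intro tendsto_intros lim_\<sigma>)
  ultimately have "\<epsilon> * \<kappa> * (N b - N a) = - (Re (K b b) + \<epsilon> * N b) - - (Re (K a a) + \<epsilon> * N a)"
    by (rule tendsto_unique[rotated]) simp
  \<comment> \<open>Since 1 + \<kappa> = 2 / (p + 2), equality of the two limits says precisely that
    the energies at a and b agree.\<close>
  then show ?thesis unfolding energy_eq \<kappa>_def by (simp add: algebra_simps diff_divide_distrib)
qed

lemma energy_conserved: "energy \<mu> \<epsilon> p (u s) = energy \<mu> \<epsilon> p (u t)"
  using energy_conserved_aux[of s t] energy_conserved_aux[of t s] by linarith

end

section \<open>Dilations\<close>

text \<open>Continuity of the partial derivatives gives total differentiability; the increment is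
  built up one coordinate direction at a time, by induction over subsets of the basis.\<close>

lemma smooth_has_derivative:
  fixes f :: "'a::euclidean_space \<Rightarrow> complex"
  assumes f: "smooth f"
  shows "(f has_derivative (\<lambda>v. \<Sum>b\<in>Basis. (v \<bullet> b) *\<^sub>R partial b f x)) (at x)"
proof -
  have "((\<lambda>v. f (x + (\<Sum>b\<in>B. (v \<bullet> b) *\<^sub>R b))) has_derivative (\<lambda>v. \<Sum>b\<in>B. (v \<bullet> b) *\<^sub>R partial b f x)) (at 0)"
    if "finite B" "B \<subseteq> Basis" for B
    using that
  proof (induction B rule: finite_induct)
    case (insert b B)
    have b: "b \<in> Basis" using insert by auto
    let ?H = "\<lambda>v s. f (x + (\<Sum>b\<in>B. (v \<bullet> b) *\<^sub>R b) + s *\<^sub>R b)"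
    let ?D = "\<lambda>v s. partial b f (x + (\<Sum>b\<in>B. (v \<bullet> b) *\<^sub>R b) + s *\<^sub>R b)"
    have "((\<lambda>(v, s). ?H v s) has_derivative (\<lambda>(tv, ts). (\<Sum>b\<in>B. (tv \<bullet> b) *\<^sub>R partial b f x) + blinfun_scaleR_left (?D 0 0) ts))
        (at (0, 0) within UNIV \<times> UNIV)"
    proof (rule has_derivative_partialsI)
      show "((\<lambda>v. ?H v 0) has_derivative (\<lambda>v. \<Sum>b\<in>B. (v \<bullet> b) *\<^sub>R partial b f x)) (at 0 within UNIV)"
        using insert by simp
      show "((\<lambda>s. ?H v s) has_derivative blinfun_apply (blinfun_scaleR_left (?D v s))) (at s within UNIV)" for v s
        using has_partial_line[OF smooth_has_partial[OF f b], of "x + (\<Sum>b\<in>B. (v \<bullet> b) *\<^sub>R b)" s]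
        by (simp add: has_vector_derivative_def)
      have "continuous_on UNIV (\<lambda>q. ?D (fst q) (snd q))"
        by (rule continuous_on_compose2[OF smooth_continuous[OF smooth_partial[OF f b]]])
          (auto intro!: continuous_intros)
      then have "isCont (\<lambda>q. blinfun_scaleR_left (?D (fst q) (snd q))) (0, 0)"
        by (intro bounded_linear.isCont[OF bounded_linear_blinfun_scaleR_left])
          (simp add: continuous_on_eq_continuous_at)
      then show "continuous (at (0, 0) within UNIV \<times> UNIV) (\<lambda>(v, s). blinfun_scaleR_left (?D v s))"
        by (simp add: case_prod_unfold)
    qed auto
    then have 1: "((\<lambda>(v, s). ?H v s) has_derivative (\<lambda>(tv, ts). (\<Sum>b\<in>B. (tv \<bullet> b) *\<^sub>R partial b f x) + ts *\<^sub>R partial b f x))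
        (at ((\<lambda>v. (v, v \<bullet> b)) 0))" by simp
    have 2: "((\<lambda>v. (v, v \<bullet> b)) has_derivative (\<lambda>v. (v, v \<bullet> b))) (at 0)"
      by (auto intro!: derivative_eq_intros)
    from diff_chain_at[OF 2 1] show ?case
      using insert by (simp add: o_def algebra_simps)
  qed (simp add: has_derivative_const)
  from this[of Basis] have "((\<lambda>v. f (x + v)) has_derivative (\<lambda>v. \<Sum>b\<in>Basis. (v \<bullet> b) *\<^sub>R partial b f x)) (at (x - x))"
    by (simp add: euclidean_representation)
  moreover have "((\<lambda>y. y - x) has_derivative (\<lambda>v. v)) (at x)"
    by (auto intro!: derivative_eq_intros)
  ultimately have "((\<lambda>v. f (x + v)) \<circ> (\<lambda>y. y - x) has_derivative (\<lambda>v. \<Sum>b\<in>Basis. (v \<bullet> b) *\<^sub>R partial b f x) \<circ> (\<lambda>v. v)) (at x)"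
    by (rule diff_chain_at[rotated])
  then show ?thesis by (simp add: o_def)
qed

lemma smooth_ray_derivative:
  fixes f :: "'a::euclidean_space \<Rightarrow> complex"
  assumes "smooth f"
  shows "((\<lambda>s. f (s *\<^sub>R x)) has_vector_derivative (\<Sum>b\<in>Basis. (x \<bullet> b) *\<^sub>R partial b f (s *\<^sub>R x))) (at s)"
proof -
  have 2: "((\<lambda>s. s *\<^sub>R x) has_derivative (\<lambda>h. h *\<^sub>R x)) (at s)"
    by (auto intro!: derivative_eq_intros)
  from diff_chain_at[OF 2 smooth_has_derivative[OF assms]] show ?thesis
    by (simp add: has_vector_derivative_def o_def scaleR_sum_right)
qed

section \<open>The L^2 increment under a dilation\<close>

definition grad_sq :: "('a::euclidean_space \<Rightarrow> complex) \<Rightarrow> 'a \<Rightarrow> real" where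
  "grad_sq f x = (\<Sum>b\<in>Basis. (norm (partial b f x))\<^sup>2)"

lemma grad_sq_nonneg: "0 \<le> grad_sq f x"
  unfolding grad_sq_def by (intro sum_nonneg) simp

lemma grad_sq_continuous: "smooth f \<Longrightarrow> continuous_on UNIV (grad_sq f)"
  unfolding grad_sq_def[abs_def] by (intro continuous_intros smooth_continuous smooth_partial)

lemma grad_sq_integral:
  assumes "smooth_H2 f"
  shows "integrable lborel (grad_sq f)" "integral\<^sup>L lborel (grad_sq f) = (\<Sum>b\<in>Basis. sqn (partial b f))"
  unfolding grad_sq_def[abs_def] sqn_def
  using L2_integrable[OF smooth_H2_partial[OF assms]] by (auto simp: Bochner_Integration.integral_sum)

text \<open>The increment is the integral of x . grad f(s x) over 1 \<le> s \<le> c. Cauchy-Schwarz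
  in s gives the length c - 1, Cauchy-Schwarz over the coordinates gives R^2 times the dimension.
  The bound is stated in \<open>ennreal\<close> to be ready for interchanging the integrals over s
  and x.\<close>

lemma ray_increment_le:
  fixes f :: "'a::euclidean_space \<Rightarrow> complex"
  assumes f: "smooth f" and c: "1 \<le> c" and R: "norm x \<le> R"
  shows "ennreal ((norm (f (c *\<^sub>R x) - f x))\<^sup>2)
    \<le> ennreal ((c - 1) * R\<^sup>2 * DIM('a)) * (\<integral>\<^sup>+s. indicator {1..c} s * ennreal (grad_sq f (s *\<^sub>R x)) \<partial>lborel)"
proof -
  define h where "h = (\<lambda>s. \<Sum>b\<in>Basis. (x \<bullet> b) *\<^sub>R partial b f (s *\<^sub>R x))"
  have cont_h: "continuous_on {1..c} h"
    unfolding h_def by (intro continuous_intros continuous_on_compose2[OF smooth_continuous[OF smooth_partial[OF f]]]) auto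
  have cont_g: "continuous_on {1..c} (\<lambda>s. grad_sq f (s *\<^sub>R x))"
    by (intro continuous_on_compose2[OF grad_sq_continuous[OF f]] continuous_intros) auto
  define g where "g = (\<lambda>s::real. indicator {1..c} s * grad_sq f (s *\<^sub>R x))"
  have gi: "integrable lborel g"
    using borel_integrable_compact[OF compact_Icc cont_g] by (simp add: g_def)
  have g0: "g s \<ge> 0" for s by (simp add: g_def grad_sq_nonneg)
  define i where "i = (\<lambda>s. complex_of_real (indicator {1..c} s))"
  have iL: "i \<in> L2" and isq: "sqn i = c - 1"
  proof -
    have eq: "(\<lambda>s. (norm (i s))\<^sup>2) = indicat_real {1..c}" by (auto simp: i_def indicator_def)
    show "i \<in> L2"
      using c by (intro L2_I) (simp_all add: eq integrable_indicator_iff, simp add: i_def)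
    show "sqn i = c - 1" using c by (simp add: sqn_def eq)
  qed
  define k where "k = (\<lambda>s. i s * h s)"
  have hle: "(norm (h s))\<^sup>2 \<le> R\<^sup>2 * DIM('a) * grad_sq f (s *\<^sub>R x)" for s
  proof -
    have "norm (h s) \<le> (\<Sum>b\<in>Basis. R * norm (partial b f (s *\<^sub>R x)))"
      unfolding h_def
    proof (rule sum_norm_le)
      fix b :: 'a assume "b \<in> Basis"
      then have "\<bar>x \<bullet> b\<bar> \<le> R" using Basis_le_norm[of b x] R by linarith
      then show "norm ((x \<bullet> b) *\<^sub>R partial b f (s *\<^sub>R x)) \<le> R * norm (partial b f (s *\<^sub>R x))"
        by (simp add: mult_right_mono)
    qed
    then have "(norm (h s))\<^sup>2 \<le> (R * (\<Sum>b\<in>Basis. norm (partial b f (s *\<^sub>R x))))\<^sup>2"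
      unfolding sum_distrib_left by (intro power_mono) auto
    also have "\<dots> \<le> R\<^sup>2 * (grad_sq f (s *\<^sub>R x) * DIM('a))"
      unfolding power_mult_distrib grad_sq_def by (intro mult_left_mono sum_squared_le_sum_of_squares) auto
    finally show ?thesis by (simp add: mult_ac)
  qed
  have km: "k \<in> borel_measurable borel"
    using borel_measurable_integrable[OF borel_integrable_compact[OF compact_Icc cont_h]]
    by (simp add: k_def i_def scaleR_conv_of_real)
  have ksq: "(norm (k s))\<^sup>2 \<le> R\<^sup>2 * DIM('a) * g s" for s
    using hle[of s] by (auto simp: k_def i_def g_def indicator_def)
  have kL: "k \<in> L2"
    by (rule L2_bound[OF km _ ksq]) (intro integrable_mult_right gi)
  have "sqn k \<le> R\<^sup>2 * DIM('a) * integral\<^sup>L lborel g"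
    unfolding sqn_def integral_mult_right_zero[symmetric]
    by (intro integral_mono ksq L2_integrable kL integrable_mult_right gi)
  moreover have "f (c *\<^sub>R x) - f x = (LINT s|lborel. i s * k s)"
  proof -
    have "(LINT s|lborel. indicator {1..c} s *\<^sub>R h s) = f (c *\<^sub>R x) - f (1 *\<^sub>R x)"
      by (rule integral_FTC_atLeastAtMost[OF c _ cont_h])
        (unfold h_def, rule has_vector_derivative_at_within[OF smooth_ray_derivative[OF f]])
    moreover have "(\<lambda>s. i s * k s) = (\<lambda>s. indicator {1..c} s *\<^sub>R h s)"
      by (auto simp: i_def k_def indicator_def)
    ultimately show ?thesis by simp
  qed
  then have "norm (f (c *\<^sub>R x) - f x) \<le> sqrt (sqn i) * sqrt (sqn k)"
    using CS_bilinear[OF iL kL] by simp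
  then have "(norm (f (c *\<^sub>R x) - f x))\<^sup>2 \<le> (sqrt (sqn i) * sqrt (sqn k))\<^sup>2"
    by (intro power_mono) auto
  then have "(norm (f (c *\<^sub>R x) - f x))\<^sup>2 \<le> (c - 1) * sqn k"
    using c by (simp add: power_mult_distrib isq)
  ultimately have "(norm (f (c *\<^sub>R x) - f x))\<^sup>2 \<le> (c - 1) * (R\<^sup>2 * DIM('a) * integral\<^sup>L lborel g)"
    using c by (meson mult_left_mono order_trans diff_ge_0_iff_ge)
  also have "\<dots> = ((c - 1) * R\<^sup>2 * DIM('a)) * integral\<^sup>L lborel g" by simp
  finally have "ennreal ((norm (f (c *\<^sub>R x) - f x))\<^sup>2) \<le> ennreal (((c - 1) * R\<^sup>2 * DIM('a)) * integral\<^sup>L lborel g)"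
    by (rule ennreal_leI)
  also have "\<dots> = ennreal ((c - 1) * R\<^sup>2 * DIM('a)) * ennreal (integral\<^sup>L lborel g)"
    using c by (intro ennreal_mult) (auto intro!: Bochner_Integration.integral_nonneg g0)
  also have "ennreal (integral\<^sup>L lborel g) = (\<integral>\<^sup>+s. ennreal (g s) \<partial>lborel)"
    by (rule nn_integral_eq_integral[symmetric]) (auto simp: gi g0)
  also have "(\<lambda>s. ennreal (g s)) = (\<lambda>s. indicator {1..c} s * ennreal (grad_sq f (s *\<^sub>R x)))"
    by (auto simp: g_def indicator_def)
  finally show ?thesis .
qed

text \<open>After interchanging the integrals, the inner one is the gradient integral at scale s
  \<ge> 1, which the Jacobian makes at most the one at scale 1. The second factor c - 1 is the
  length of the range of s.\<close>

lemma dilation_increment_ball: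
  fixes f :: "'a::euclidean_space \<Rightarrow> complex"
  assumes f: "smooth_H2 f" and c: "1 \<le> c" and R: "0 \<le> R"
  shows "(\<integral>\<^sup>+x. ennreal (indicator (cball 0 R) x * (norm (f (c *\<^sub>R x) - f x))\<^sup>2) \<partial>lborel)
    \<le> ennreal ((c - 1)\<^sup>2 * R\<^sup>2 * DIM('a) * (\<Sum>b\<in>Basis. sqn (partial b f)))"
proof -
  have s: "smooth f" using f by (rule smooth_H2_smooth)
  have [measurable]: "grad_sq f \<in> borel_measurable borel"
    by (rule borel_measurable_continuous_onI[OF grad_sq_continuous[OF s]])
  define A where "A = (c - 1) * R\<^sup>2 * DIM('a)"
  define B where "B = (\<Sum>b\<in>Basis. sqn (partial b f))"
  have A: "A \<ge> 0" and B: "B \<ge> 0" using c by (auto simp: A_def B_def intro!: sum_nonneg)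
  have inner: "(\<integral>\<^sup>+x. ennreal (grad_sq f (s *\<^sub>R x)) \<partial>lborel) \<le> ennreal B" if "s \<ge> 1" for s
  proof -
    have I: "integrable lborel (\<lambda>x. grad_sq f (s *\<^sub>R x))"
      using LINT_dilate(2)[of "grad_sq f" s] grad_sq_integral(1)[OF f] that by simp
    have "B = s ^ DIM('a) * (LINT x|lborel. grad_sq f (s *\<^sub>R x))"
      using LINT_dilate(1)[of "grad_sq f" s] grad_sq_integral(2)[OF f] that by (simp add: B_def)
    moreover have "1 * (LINT x|lborel. grad_sq f (s *\<^sub>R x)) \<le> s ^ DIM('a) * (LINT x|lborel. grad_sq f (s *\<^sub>R x))"
      using that by (intro mult_right_mono Bochner_Integration.integral_nonneg grad_sq_nonneg) simp
    ultimately have "(LINT x|lborel. grad_sq f (s *\<^sub>R x)) \<le> B" by simp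
    then show ?thesis
      by (subst nn_integral_eq_integral[OF I]) (auto simp: grad_sq_nonneg ennreal_leI)
  qed
  have "(\<integral>\<^sup>+x. ennreal (indicator (cball 0 R) x * (norm (f (c *\<^sub>R x) - f x))\<^sup>2) \<partial>lborel)
    \<le> (\<integral>\<^sup>+x. ennreal A * (\<integral>\<^sup>+s. indicator {1..c} s * ennreal (grad_sq f (s *\<^sub>R x)) \<partial>lborel) \<partial>lborel)"
  proof (intro nn_integral_mono)
    fix x
    show "ennreal (indicator (cball 0 R) x * (norm (f (c *\<^sub>R x) - f x))\<^sup>2)
      \<le> ennreal A * (\<integral>\<^sup>+s. indicator {1..c} s * ennreal (grad_sq f (s *\<^sub>R x)) \<partial>lborel)"
      using ray_increment_le[OF s c, of x R] by (cases "x \<in> cball 0 R") (auto simp: A_def)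
  qed
  also have "\<dots> = ennreal A * (\<integral>\<^sup>+x. (\<integral>\<^sup>+s. indicator {1..c} s * ennreal (grad_sq f (s *\<^sub>R x)) \<partial>lborel) \<partial>lborel)"
    by (rule nn_integral_cmult) measurable
  also have "(\<integral>\<^sup>+x. (\<integral>\<^sup>+s. indicator {1..c} s * ennreal (grad_sq f (s *\<^sub>R x)) \<partial>lborel) \<partial>lborel)
    = (\<integral>\<^sup>+s. (\<integral>\<^sup>+x. indicator {1..c} s * ennreal (grad_sq f (s *\<^sub>R x)) \<partial>lborel) \<partial>lborel)"
    by (rule lborel_pair.Fubini') measurable
  also have "\<dots> = (\<integral>\<^sup>+s. indicator {1..c} s * (\<integral>\<^sup>+x. ennreal (grad_sq f (s *\<^sub>R x)) \<partial>lborel) \<partial>lborel)"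
    by (intro nn_integral_cong nn_integral_cmult) measurable
  also have "\<dots> \<le> (\<integral>\<^sup>+s. ennreal B * indicator {1..c} s \<partial>lborel)"
    by (intro nn_integral_mono) (auto simp: indicator_def inner)
  also have "\<dots> = ennreal B * ennreal (c - 1)"
    using c by (simp add: nn_integral_cmult_indicator)
  finally have "(\<integral>\<^sup>+x. ennreal (indicator (cball 0 R) x * (norm (f (c *\<^sub>R x) - f x))\<^sup>2) \<partial>lborel)
    \<le> ennreal A * (ennreal B * ennreal (c - 1))" by (simp add: mult_left_mono)
  also have "\<dots> = ennreal (A * (B * (c - 1)))"
    using A B c by (simp add: ennreal_mult)
  also have "A * (B * (c - 1)) = (c - 1)\<^sup>2 * R\<^sup>2 * DIM('a) * B"
    by (simp add: A_def power2_eq_square mult_ac)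
  finally show ?thesis by (simp add: B_def)
qed

section \<open>Exponential weights\<close>

lemma integrable_exp_abs:
  assumes "a > 0" shows "(\<integral>\<^sup>+x. ennreal (exp (- a * \<bar>x::real\<bar>)) \<partial>lborel) < \<infinity>"
proof -
  have half: "(\<integral>\<^sup>+x. ennreal (indicator {0..} x * exp (- a * x)) \<partial>lborel) = ennreal (1 / a)"
    using nn_integral_has_integral_lebesgue[OF _ has_integral_exp_minus_to_infinity[OF assms, of 0]] by simp
  have "(\<integral>\<^sup>+x. ennreal (exp (- a * \<bar>x\<bar>)) \<partial>lborel)
    \<le> (\<integral>\<^sup>+x. ennreal (indicator {0..} x * exp (- a * x)) + ennreal (indicator {0..} (0 + (-1) * x) * exp (- a * (0 + (-1) * x))) \<partial>lborel)"
    by (intro nn_integral_mono) (auto simp: indicator_def)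
  also have "\<dots> = (\<integral>\<^sup>+x. ennreal (indicator {0..} x * exp (- a * x)) \<partial>lborel)
      + (\<integral>\<^sup>+x. ennreal (indicator {0..} (0 + (-1) * x) * exp (- a * (0 + (-1) * x))) \<partial>lborel)"
    by (intro nn_integral_add) measurable
  also have "(\<integral>\<^sup>+x. ennreal (indicator {0..} (0 + (-1) * x) * exp (- a * (0 + (-1) * x))) \<partial>lborel) = ennreal (1 / a)"
    using nn_integral_real_affine[of "\<lambda>x. ennreal (indicator {0..} x * exp (- a * x))" "-1" 0] half by simp
  finally show ?thesis unfolding half by (auto intro: le_less_trans)
qed

text \<open>Each coordinate is at most the norm, so the weight is dominated by a product of
  one-dimensional exponentials, the rate being divided by the dimension.\<close>

lemma integrable_exp_norm:
  assumes "a > 0" shows "integrable lborel (\<lambda>x::'a::euclidean_space. exp (- a * norm x))"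
proof (rule integrableI_bounded)
  let ?d = "real DIM('a)"
  have "(\<integral>\<^sup>+x. ennreal (norm (exp (- a * norm (x::'a)))) \<partial>lborel)
    \<le> (\<integral>\<^sup>+x. (\<Prod>b\<in>(Basis::'a set). ennreal (exp (- (a / ?d) * \<bar>x \<bullet> b\<bar>))) \<partial>lborel)"
  proof (intro nn_integral_mono)
    fix x :: 'a
    have "(\<Sum>b\<in>Basis. (a / ?d) * \<bar>x \<bullet> b\<bar>) \<le> (\<Sum>b\<in>(Basis::'a set). (a / ?d) * norm x)"
      using assms by (intro sum_mono mult_left_mono Basis_le_norm) auto
    also have "\<dots> = a * norm x" by simp
    finally have "exp (- a * norm x) \<le> exp (\<Sum>b\<in>Basis. - (a / ?d) * \<bar>x \<bullet> b\<bar>)"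
      by (simp add: sum_negf)
    also have "\<dots> = (\<Prod>b\<in>Basis. exp (- (a / ?d) * \<bar>x \<bullet> b\<bar>))" by (simp add: exp_sum)
    finally show "ennreal (norm (exp (- a * norm x))) \<le> (\<Prod>b\<in>Basis. ennreal (exp (- (a / ?d) * \<bar>x \<bullet> b\<bar>)))"
      by (subst prod_ennreal) (auto intro: ennreal_leI)
  qed
  also have "\<dots> = (\<Prod>b\<in>(Basis::'a set). (\<integral>\<^sup>+x. ennreal (exp (- (a / ?d) * \<bar>x\<bar>)) \<partial>lborel))"
    by (rule nn_integral_lborel_prod) auto
  also have "\<dots> < \<infinity>"
  proof -
    have "(\<integral>\<^sup>+x. ennreal (exp (- (a / ?d) * \<bar>x\<bar>)) \<partial>lborel) < \<infinity>"
      using integrable_exp_abs[of "a / ?d"] assms by simp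
    then show ?thesis by (simp add: power_less_top_ennreal)
  qed
  finally show "(\<integral>\<^sup>+x. ennreal (norm (exp (- a * norm (x::'a)))) \<partial>lborel) < \<infinity>" .
qed measurable

text \<open>The sixth power of y \<le> exp y at y = g R / 6. The exponent 6 exceeds 4, so with R^-4
  = c - 1 the tail is (c - 1)^(3/2), negligible against c - 1.\<close>

lemma exp_le_inverse_power6:
  fixes g R :: real
  assumes "g > 0" "R > 0" shows "exp (- g * R) \<le> (6 / g) ^ 6 / R ^ 6"
proof -
  have "g * R / 6 \<le> exp (g * R / 6)"
    using exp_ge_add_one_self[of "g * R / 6"] by linarith
  then have "(g * R / 6) ^ 6 \<le> exp (g * R / 6) ^ 6"
    using assms by (intro power_mono) auto
  also have "\<dots> = exp (g * R)" by (simp flip: exp_of_nat_mult)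
  finally have "exp (- g * R) \<le> 1 / (g * R / 6) ^ 6"
    using assms by (simp add: exp_minus field_simps)
  also have "\<dots> = (6 / g) ^ 6 / R ^ 6" by (simp add: power_divide power_mult_distrib)
  finally show ?thesis .
qed

text \<open>Up to the Jacobian, dilation by 1 / c is the adjoint of dilation by c. A dilation can
  thus be moved off the factor that is to be differentiated in time.\<close>

lemma ip_dilate:
  fixes f g :: "'a::euclidean_space \<Rightarrow> complex"
  assumes "f \<in> L2" "g \<in> L2" "c > 0"
  shows "ip f (dil (1 / c) g) = of_real (c ^ DIM('a)) * ip (dil c f) g"
proof -
  have [measurable]: "f \<in> borel_measurable borel" "g \<in> borel_measurable borel"
    using assms by (auto simp: L2_measurable)
  have [measurable]: "cnj \<in> borel_measurable borel"
    by (intro borel_measurable_continuous_onI continuous_intros)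
  have "(\<lambda>x. f x * cnj (g ((1 / c) *\<^sub>R x))) \<in> borel_measurable borel" by measurable
  from LINT_dilate(1)[OF this assms(3)] show ?thesis
    using assms(3) by (simp add: ip_def scaleR_conv_of_real)
qed

text \<open>Dilation by c \<ge> 1 does not increase the L^2 norm. This bound is uniform in c and
  serves as the majorant when c tends to 1.\<close>

lemma Re_ip_dilate_le:
  fixes f :: "'a::euclidean_space \<Rightarrow> complex"
  assumes f: "f \<in> L2" and c: "c \<ge> 1"
  shows "\<bar>Re (ip (dil c f) f)\<bar> \<le> sqn f"
proof -
  have "sqn (dil c f) \<le> sqn f"
    using sqn_dilate[OF f, of c] c by (simp add: divide_le_eq mult_left_le)
       (metis mult.right_neutral mult_left_mono one_le_power sqn_nonneg)
  then have "sqrt (sqn (dil c f)) * sqrt (sqn f) \<le> sqrt (sqn f) * sqrt (sqn f)"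
    by (intro mult_right_mono real_sqrt_le_mono) auto
  then have "norm (ip (dil c f) f) \<le> sqn f"
    using CS_ip[OF L2_dilate[OF f, of c] f] c by simp
  then show ?thesis using abs_Re_le_cmod order_trans by blast
qed

text \<open>Fatou's lemma for \<open>|f(c x) + f(x)|\<^sup>2\<close>, whose pointwise limit is \<open>4 |f(x)|\<^sup>2\<close>.\<close>

lemma Re_ip_dilate_tendsto:
  fixes f :: "'a::euclidean_space \<Rightarrow> complex"
  assumes f: "f \<in> L2" and cont: "continuous_on UNIV f"
    and c: "\<And>k. c k \<ge> 1" "c \<longlonglongrightarrow> 1"
  shows "(\<lambda>k. Re (ip (dil (c k) f) f)) \<longlonglongrightarrow> sqn f"
proof -
  have [measurable]: "f \<in> borel_measurable borel" using f by (rule L2_measurable)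
  have cp: "c k > 0" for k using c(1)[of k] by simp
  define I where "I = (\<lambda>k. sqn (\<lambda>x. f (c k *\<^sub>R x) + f x))"
  have L: "(dil (c k) f) \<in> L2" for k using L2_dilate[OF f cp] .
  have I_le: "I k \<le> 2 * sqn f + 2 * Re (ip (dil (c k) f) f)" for k
  proof -
    have "I k = sqn (\<lambda>x. f (c k *\<^sub>R x) - (- 1) * f x)" by (simp add: I_def)
    also have "\<dots> = sqn (dil (c k) f) + sqn f + 2 * Re (ip (dil (c k) f) f)"
      by (subst sqn_diff[OF L L2_cmult[OF f]]) (simp only: sqn_cmult ip_cmult_right; simp)
    also have "sqn (dil (c k) f) \<le> sqn f"
      using sqn_dilate[OF f cp[of k]] c(1)[of k] by (simp add: divide_le_eq)
        (metis mult.right_neutral mult_left_mono one_le_power sqn_nonneg)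
    finally show ?thesis by simp
  qed
  have nn: "(\<integral>\<^sup>+x. ennreal ((norm (f (c k *\<^sub>R x) + f x))\<^sup>2) \<partial>lborel) = ennreal (I k)" for k
    unfolding I_def sqn_def by (intro nn_integral_eq_integral L2_integrable L2_add L f) simp
  have "ennreal (4 * sqn f) = (\<integral>\<^sup>+x. ennreal (4 * (norm (f x))\<^sup>2) \<partial>lborel)"
    unfolding sqn_def integral_mult_right_zero[symmetric]
    by (intro nn_integral_eq_integral[symmetric] integrable_mult_right L2_integrable f) simp
  also have "\<dots> = (\<integral>\<^sup>+x. liminf (\<lambda>k. ennreal ((norm (f (c k *\<^sub>R x) + f x))\<^sup>2)) \<partial>lborel)"
  proof (intro nn_integral_cong)
    fix x
    have "isCont f (1 *\<^sub>R x)" using cont by (simp add: continuous_on_eq_continuous_at)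
    moreover have "(\<lambda>k. c k *\<^sub>R x) \<longlonglongrightarrow> 1 *\<^sub>R x" by (intro tendsto_intros c)
    ultimately have "(\<lambda>k. f (c k *\<^sub>R x)) \<longlonglongrightarrow> f (1 *\<^sub>R x)" by (rule isCont_tendsto_compose)
    then have "(\<lambda>k. ennreal ((norm (f (c k *\<^sub>R x) + f x))\<^sup>2)) \<longlonglongrightarrow> ennreal ((norm (f (1 *\<^sub>R x) + f x))\<^sup>2)"
      by (intro tendsto_intros)
    then have "liminf (\<lambda>k. ennreal ((norm (f (c k *\<^sub>R x) + f x))\<^sup>2)) = ennreal ((norm (f (1 *\<^sub>R x) + f x))\<^sup>2)"
      by (intro lim_imp_Liminf) auto
    moreover have "(norm (f (1 *\<^sub>R x) + f x))\<^sup>2 = 4 * (norm (f x))\<^sup>2"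
    proof -
      have "f (1 *\<^sub>R x) + f x = 2 * f x" by simp
      then show ?thesis by (simp add: norm_mult power_mult_distrib)
    qed
    ultimately show "ennreal (4 * (norm (f x))\<^sup>2) = liminf (\<lambda>k. ennreal ((norm (f (c k *\<^sub>R x) + f x))\<^sup>2))" by simp
  qed
  also have "\<dots> \<le> liminf (\<lambda>k. \<integral>\<^sup>+x. ennreal ((norm (f (c k *\<^sub>R x) + f x))\<^sup>2) \<partial>lborel)"
    by (rule nn_integral_liminf) measurable
  finally have li: "ennreal (4 * sqn f) \<le> liminf (\<lambda>k. ennreal (I k))" by (simp add: nn)
  show ?thesis
  proof (rule order_tendstoI)
    fix a assume a: "a < sqn f"
    show "\<forall>\<^sub>F k in sequentially. a < Re (ip (dil (c k) f) f)"
    \<comment> \<open>The comparison in \<open>ennreal\<close> needs a nonnegative left side; if it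
      is negative, then a < -\<open>sqn f\<close>, and the uniform bound suffices.\<close>
    proof (cases "2 * sqn f + 2 * a < 0")
      case True
      then have "a < Re (ip (dil (c k) f) f)" for k
        using Re_ip_dilate_le[OF f c(1)[of k]] by linarith
      then show ?thesis by simp
    next
      case False
      then have "ennreal (2 * sqn f + 2 * a) < ennreal (4 * sqn f)"
        using a by (intro ennreal_lessI) auto
      then have "\<forall>\<^sub>F k in sequentially. ennreal (2 * sqn f + 2 * a) < ennreal (I k)"
        using li unfolding le_Liminf_iff by blast
      then show ?thesis
      proof eventually_elim
        case (elim k)
        then have "2 * sqn f + 2 * a < I k"
          using False by (simp add: ennreal_less_iff)
        with I_le[of k] show ?case by linarith
      qed
    qed
  next
    fix a assume "a > sqn f"
    then have "Re (ip (dil (c k) f) f) < a" for k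
      using Re_ip_dilate_le[OF f c(1)[of k]] by linarith
    then show "\<forall>\<^sub>F k in sequentially. Re (ip (dil (c k) f) f) < a" by simp
  qed
qed

section \<open>The virial identity\<close>

text \<open>The set where \<open>f\<close> differs from 0 is open, and a nonempty open set is not a
  null set.\<close>

lemma continuous_AE_zero:
  fixes f :: "'a::euclidean_space \<Rightarrow> complex"
  assumes "continuous_on UNIV f" "AE x in lborel. f x = 0"
  shows "f x = 0"
proof (rule ccontr)
  assume "f x \<noteq> 0"
  moreover have "open {x. f x \<noteq> 0}"
    using assms(1) by (intro open_Collect_neq continuous_intros)
  ultimately have "\<not> negligible {x. f x \<noteq> 0}"
    using open_not_negligible[of "{x. f x \<noteq> 0}"] by blast
  moreover have "negligible {x. f x \<noteq> 0}"
  proof -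
    have "AE x in lebesgue. f x = 0" using assms(2) by (rule AE_completion)
    then have "{x. f x \<noteq> 0} \<in> null_sets lebesgue"
      by (simp add: AE_iff_null_sets[symmetric] eventually_ae_filter) (metis (mono_tags, lifting) Collect_cong null_sets_completion_subset)
    then show ?thesis by (simp add: negligible_iff_null_sets)
  qed
  ultimately show False by blast
qed

lemma sqn_eq_0:
  fixes f :: "'a::euclidean_space \<Rightarrow> complex"
  assumes "f \<in> L2" "continuous_on UNIV f" "sqn f = 0"
  shows "f x = 0"
proof (rule continuous_AE_zero[OF assms(2)])
  have "AE x in lborel. (norm (f x))\<^sup>2 = 0"
    using assms(3) integral_nonneg_eq_0_iff_AE[OF L2_integrable[OF assms(1)]] by (simp add: sqn_def)
  then show "AE x in lborel. f x = 0" by simp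
qed

text \<open>Integration by parts between L^2 functions. It is needed to conclude from a vanishing
  Laplacian that the gradient vanishes.\<close>

lemma smooth_H2_Green:
  assumes f: "smooth_H2 f"
  shows "ip (laplacian f) f = - of_real (\<Sum>b\<in>Basis. sqn (partial b f))"
proof -
  have s: "smooth f" using f by (rule smooth_H2_smooth)
  have c: "smooth (\<lambda>x. cnj (f x))" by (rule smooth_cnj[OF s])
  have fc: "(\<lambda>x. cnj (f x)) \<in> L2" by (rule L2_cnj[OF smooth_H2_L2[OF f]])
  have 1: "(LINT x|lborel. cnj (f x) * partial b (partial b f) x) = - of_real (sqn (partial b f))" if b: "b \<in> Basis" for b
  proof -
    have pc: "partial b (\<lambda>x. cnj (f x)) = (\<lambda>x. cnj (partial b f x))" by (rule partial_cnj[OF s b])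
    have "(LINT x|lborel. cnj (f x) * partial b (partial b f) x) = - (LINT x|lborel. cnj (partial b f x) * partial b f x)"
      using integration_by_parts[OF c smooth_partial[OF s b] b
        L2_mult_integrable[OF fc smooth_H2_partial[OF f b]]
        L2_mult_integrable[OF _ smooth_H2_partial[OF f b]]
        L2_mult_integrable[OF fc smooth_H2_partial2[OF f b b]]] L2_cnj[OF smooth_H2_partial[OF f b]]
      by (simp add: pc)
    also have "(LINT x|lborel. cnj (partial b f x) * partial b f x) = of_real (sqn (partial b f))"
      using ip_self[of "partial b f"] by (simp add: ip_def mult.commute)
    finally show ?thesis .
  qed
  have "ip (laplacian f) f = (LINT x|lborel. (\<Sum>b\<in>Basis. cnj (f x) * partial b (partial b f) x))"
    unfolding ip_def laplacian_def sum_distrib_left[symmetric] by (simp add: mult.commute)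
  also have "\<dots> = (\<Sum>b\<in>Basis. LINT x|lborel. cnj (f x) * partial b (partial b f) x)"
    by (rule Bochner_Integration.integral_sum) (intro L2_mult_integrable fc smooth_H2_partial2[OF f])
  also have "\<dots> = - of_real (\<Sum>b\<in>Basis. sqn (partial b f))"
    using 1 by (simp add: sum_negf)
  finally show ?thesis .
qed

context nls
begin

section \<open>The dilated pairing and its time derivative\<close>

definition A :: "real \<Rightarrow> real" where "A t = sqn (laplacian (u t))"
definition B :: "real \<Rightarrow> real" where "B t = (\<Sum>b\<in>Basis. sqn (partial b (u t)))"

lemma A_nonneg: "A t \<ge> 0" and B_nonneg: "B t \<ge> 0" and N_nonneg: "N t \<ge> 0"
  unfolding A_def B_def N_def by (auto intro!: sum_nonneg Bochner_Integration.integral_nonneg)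

lemma A_continuous: "continuous_on T A" and B_continuous: "continuous_on T B"
  unfolding A_def[abs_def] B_def[abs_def]
  by (intro continuous_intros sqn_continuous[OF l2cont_laplacian continuous_on_id] sqn_continuous[OF l2cont_partial continuous_on_id])+

lemma energy_ABN: "energy \<mu> \<epsilon> p (u t) = A t + \<mu> * B t + \<epsilon> * (2 / (p + 2)) * N t"
  unfolding energy_eq K_def A_def B_def by (simp add: ip_self)

lemma F_dilate:
  assumes "c > 0"
  shows "F s (dil c (u t)) = of_real (c\<^sup>2) * ip (laplacian (u s)) (dil c (laplacian (u t)))
    + of_real (\<mu> * c) * (\<Sum>b\<in>Basis. ip (partial b (u s)) (dil c (partial b (u t))))
    + of_real \<epsilon> * ip (\<lambda>x. nl p (u s x)) (\<lambda>x. u t (c *\<^sub>R x))"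
proof -
  have "(\<Sum>b\<in>Basis. ip (partial b (u s)) (partial b (dil c (u t))))
    = of_real c * (\<Sum>b\<in>Basis. ip (partial b (u s)) (dil c (partial b (u t))))"
    unfolding sum_distrib_left by (intro sum.cong refl) (simp only: partial_dilate[OF smooth_u] ip_cmult_right complex_cnj_complex_of_real)
  then show ?thesis
    unfolding F_def laplacian_dilate[OF smooth_u] ip_cmult_right by simp
qed

lemma F_dilate_continuous:
  assumes "c > 0" "continuous_on T a" "continuous_on T b"
  shows "continuous_on T (\<lambda>q. F (a q) (dil c (u (b q))))"
  unfolding F_dilate[OF assms(1)]
  by (intro continuous_intros ip_continuous2[OF l2cont_laplacian l2cont_dilate[OF l2cont_laplacian assms(1)] assms(2,3)]
      ip_continuous2[OF l2cont_partial l2cont_dilate[OF l2cont_partial assms(1)] assms(2,3)]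
      ip_continuous2[OF l2cont_nl l2cont_dilate[OF l2cont_u assms(1)] assms(2,3)])

text \<open>At c = 1 and equal times the pairing is real, so Im (J c t t) / (c - 1) is a difference
  quotient in c for the Morawetz functional, the imaginary part of the integral of (x . grad u) cnj
  u.\<close>

definition J :: "real \<Rightarrow> real \<Rightarrow> real \<Rightarrow> complex" where
  "J c s t = ip (dil c (u s)) (u t)"

definition W :: "real \<Rightarrow> real \<Rightarrow> real" where
  "W c t = Re (F t (dil c (u t))) - Re (F t (dil (1 / c) (u t))) / c ^ DIM('a)"

text \<open>The second time is differentiated with the dilate by c as test function. For the first
  time the dilation is moved to the other factor, which explains the dilate by 1 / c and the
  division by the Jacobian in \<open>W\<close>.\<close>

lemma J_diagonal_deriv:
  assumes c: "c > 0"
  shows "((\<lambda>t. Im (J c t t)) has_vector_derivative W c t) (at t)"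
proof -
  define r where "r = 1 / c ^ DIM('a)"
  define k where "k = complex_of_real r"
  have J1: "((\<lambda>s. J c s t) has_vector_derivative k * (- \<i> * F s (dil (1 / c) (u t)))) (at s)" for s t
  proof -
    have "J c s t = k * ip (u s) (dil (1 / c) (u t))" for s
      using ip_dilate[OF u_L2 u_L2 c, of s t] c by (simp add: J_def k_def r_def)
    moreover have "((\<lambda>s. k * ip (u s) (dil (1 / c) (u t))) has_vector_derivative k * (- \<i> * F s (dil (1 / c) (u t)))) (at s)"
      by (intro has_vector_derivative_mult_right weak_derivative smooth_H2_dilate u_H2) (use c in simp)
    ultimately show ?thesis by simp
  qed
  have J2: "((\<lambda>t. J c s t) has_vector_derivative \<i> * cnj (F t (dil c (u s)))) (at t)" for s t
  proof -
    have "((\<lambda>t. cnj (ip (u t) (dil c (u s)))) has_vector_derivative cnj (- \<i> * F t (dil c (u s)))) (at t)"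
      by (intro has_vector_derivative_cnj weak_derivative smooth_H2_dilate u_H2 c)
    then show ?thesis by (simp add: J_def ip_cnj_commute)
  qed
  have "continuous_on UNIV (\<lambda>q. \<i> * cnj (F (snd q) (dil c (u (fst q)))))"
    by (intro continuous_intros F_dilate_continuous c)
  from has_vector_derivative_diagonal[OF J1 J2 this, of 0 t]
  have "((\<lambda>t. J c t t) has_vector_derivative
      k * (- \<i> * F t (dil (1 / c) (u t))) + \<i> * cnj (F t (dil c (u t)))) (at t)"
    by simp
  from bounded_linear.has_vector_derivative[OF bounded_linear_Im this] show ?thesis
    by (simp add: W_def k_def) (simp add: r_def)
qed

lemma W_continuous: "c > 0 \<Longrightarrow> continuous_on T (W c)"
  unfolding W_def[abs_def] by (intro continuous_intros F_dilate_continuous) simp_all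

lemma W_integral:
  assumes c: "c > 0" and \<tau>: "\<tau> > 0" and per: "\<And>t x. u (t + \<tau>) x = u t x"
  shows "integral {0..\<tau>} (W c) = 0"
proof -
  have "(W c has_integral Im (J c \<tau> \<tau>) - Im (J c 0 0)) {0..\<tau>}"
    by (rule fundamental_theorem_of_calculus)
      (use \<tau> in \<open>auto intro: has_vector_derivative_at_within J_diagonal_deriv[OF c]\<close>)
  moreover have "u \<tau> = u 0" using per[of 0] by auto
  ultimately show ?thesis by (simp add: integral_unique J_def)
qed

text \<open>The nonlinear part of \<open>W\<close>, with both pairings expressed through the
  dilation by c.\<close>

definition Y :: "real \<Rightarrow> real \<Rightarrow> real" where
  "Y c t = Re (ip (dil c (u t)) (\<lambda>x. nl p (u t x))) - Re (ip (\<lambda>x. nl p (u t (c *\<^sub>R x))) (u t))"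

text \<open>Moving the dilation by 1 / c back across the pairing cancels the Jacobian, so both
  halves of \<open>W\<close> contain the same pairings. The powers c^2 and c from the derivatives
  then meet their inverses.\<close>

lemma W_eq:
  fixes t
  defines "a c \<equiv> Re (ip (dil c (laplacian (u t))) (laplacian (u t)))"
    and "b c \<equiv> \<Sum>b\<in>Basis. Re (ip (dil c (partial b (u t))) (partial b (u t)))"
  assumes c: "c > 0"
  shows "W c t = (c\<^sup>2 - 1 / c\<^sup>2) * a c + \<mu> * (c - 1 / c) * b c + \<epsilon> * Y c t"
proof -
  have Re_swap: "Re (ip f g) = Re (ip g f)" for f g :: "'a \<Rightarrow> complex"
    by (subst ip_cnj_commute[symmetric]) simp
  have dil: "Re (ip f (dil (1 / c) g)) = c ^ DIM('a) * Re (ip (dil c f) g)"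
    if "f \<in> L2" "g \<in> L2" for f g :: "'a \<Rightarrow> complex"
    using ip_dilate[OF that c] by simp
  have c': "1 / c > 0" using c by simp
  have 1: "Re (F t (dil c (u t))) = c\<^sup>2 * a c + \<mu> * c * b c + \<epsilon> * Re (ip (dil c (u t)) (\<lambda>x. nl p (u t x)))"
    unfolding F_dilate[OF c] a_def b_def
    by (simp add: Re_swap[of "laplacian (u t)"] Re_swap[of "partial _ (u t)"] Re_swap[of "\<lambda>x. nl p (u t x)"])
  have "Re (F t (dil (1 / c) (u t))) = (1 / c)\<^sup>2 * Re (ip (laplacian (u t)) (dil (1 / c) (laplacian (u t))))
    + \<mu> * (1 / c) * (\<Sum>b\<in>Basis. Re (ip (partial b (u t)) (dil (1 / c) (partial b (u t)))))
    + \<epsilon> * Re (ip (\<lambda>x. nl p (u t x)) (dil (1 / c) (u t)))"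
    unfolding F_dilate[OF c'] by simp
  also have "(\<Sum>b\<in>Basis. Re (ip (partial b (u t)) (dil (1 / c) (partial b (u t))))) = c ^ DIM('a) * b c"
    unfolding b_def sum_distrib_left by (intro sum.cong refl dil partial_L2)
  also have "Re (ip (laplacian (u t)) (dil (1 / c) (laplacian (u t)))) = c ^ DIM('a) * a c"
    unfolding a_def by (rule dil[OF lap_L2 lap_L2])
  also have "Re (ip (\<lambda>x. nl p (u t x)) (dil (1 / c) (u t))) = c ^ DIM('a) * Re (ip (dil c (\<lambda>x. nl p (u t x))) (u t))"
    by (rule dil[OF nl_L2 u_L2])
  finally have 2: "Re (F t (dil (1 / c) (u t))) / c ^ DIM('a)
    = (1 / c\<^sup>2) * a c + \<mu> * (1 / c) * b c + \<epsilon> * Re (ip (dil c (\<lambda>x. nl p (u t x))) (u t))"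
    using c by (simp add: add_divide_distrib power_divide)
  show ?thesis unfolding W_def 1 2 Y_def by (simp add: algebra_simps)
qed

text \<open>Integrate \<open>virial_ineq\<close> with z = u(c x) and w = u(x); the main term arises
  because the integral of |u(c x)|^(p+2) is c^-n times \<open>N t\<close>.\<close>

lemma Y_estimate:
  assumes c: "c > 0"
  shows "\<bar>Y c t - p / (p + 2) * (1 - 1 / c ^ DIM('a)) * N t\<bar> \<le> (2 + p) * C powr p * sqn (\<lambda>x. u t (c *\<^sub>R x) - u t x)"
proof -
  let ?v = "\<lambda>x. u t (c *\<^sub>R x)"
  let ?a = "\<lambda>x. Re (?v x * cnj (u t x)) * (norm (u t x) powr p - norm (?v x) powr p)"
  let ?b = "\<lambda>x. norm (u t x) powr (p + 2) - norm (?v x) powr (p + 2)"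
  have vL: "?v \<in> L2" by (rule L2_dilate[OF u_L2 c])
  have nvL: "(\<lambda>x. nl p (?v x)) \<in> L2" by (rule L2_dilate[OF nl_L2 c])
  have Ld: "(\<lambda>x. ?v x - u t x) \<in> L2" by (rule L2_diff[OF vL u_L2])
  have I1: "integrable lborel (\<lambda>x. ?v x * cnj (nl p (u t x)))" by (rule ip_integrable[OF vL nl_L2])
  have I2: "integrable lborel (\<lambda>x. nl p (?v x) * cnj (u t x))" by (rule ip_integrable[OF nvL u_L2])
  have a_eq: "?a = (\<lambda>x. Re (?v x * cnj (nl p (u t x))) - Re (nl p (?v x) * cnj (u t x)))"
    by (auto simp: nl_def algebra_simps)
  have Ia: "integrable lborel ?a"
    unfolding a_eq by (intro Bochner_Integration.integrable_diff integrable_Re I1 I2)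
  have Ya: "integral\<^sup>L lborel ?a = Y c t"
    unfolding a_eq Y_def ip_def using I1 I2 by (simp add: integrable_Re del: times_complex.sel)
  have [measurable]: "(\<lambda>x. norm (u t x) powr (p + 2)) \<in> borel_measurable borel"
    using borel_measurable_integrable[OF N_integrable[of t]] by simp
  have Iv: "integrable lborel (\<lambda>x. norm (?v x) powr (p + 2))"
    using LINT_dilate(2)[of "\<lambda>x. norm (u t x) powr (p + 2)" c] N_integrable c by simp
  have Nv: "(LINT x|lborel. norm (?v x) powr (p + 2)) = N t / c ^ DIM('a)"
    using LINT_dilate(1)[of "\<lambda>x. norm (u t x) powr (p + 2)" c] c by (simp add: N_def)
  have Ib: "integrable lborel ?b" by (intro Bochner_Integration.integrable_diff N_integrable Iv)
  have Yb: "integral\<^sup>L lborel ?b = (1 - 1 / c ^ DIM('a)) * N t"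
    using N_integrable Iv Nv by (simp add: N_def algebra_simps)
  have "Y c t - p / (p + 2) * (1 - 1 / c ^ DIM('a)) * N t = (LINT x|lborel. ?a x - p / (p + 2) * ?b x)"
    unfolding Bochner_Integration.integral_diff[OF Ia integrable_mult_right[OF Ib]] integral_mult_right_zero Ya Yb
    by (simp only: mult.assoc)
  then have "\<bar>Y c t - p / (p + 2) * (1 - 1 / c ^ DIM('a)) * N t\<bar> \<le> (LINT x|lborel. \<bar>?a x - p / (p + 2) * ?b x\<bar>)"
    using integral_norm_bound[of lborel "\<lambda>x. ?a x - p / (p + 2) * ?b x"] by simp
  also have "\<dots> \<le> (LINT x|lborel. (2 + p) * C powr p * (norm (?v x - u t x))\<^sup>2)"
    by (intro integral_mono integrable_abs Bochner_Integration.integrable_diff integrable_mult_right Ia Ib L2_integrable Ld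
        virial_ineq u_le p_pos)
  finally show ?thesis by (simp add: sqn_def)
qed

text \<open>The tail constant: the squared increment is at most 4 C^2 exp(-2 \<gamma> |x|); one
  exponential is traded for (6 / \<gamma>)^6 R^-6, the other is kept for integrability.\<close>

definition M0 :: real where "M0 = 4 * C\<^sup>2 * (6 / \<gamma>) ^ 6 * (LINT x|lborel. exp (- \<gamma> * norm (x::'a)))"

lemma M0_nonneg: "M0 \<ge> 0"
  unfolding M0_def by (intro mult_nonneg_nonneg Bochner_Integration.integral_nonneg) (use \<gamma>_pos in auto)

text \<open>Inside the ball of radius R the gradient controls the increment; outside, both u(c x)
  and u(x) are small by decay, since c \<ge> 1 moves points outwards.\<close>

lemma dilation_increment_le:
  assumes c: "1 \<le> c" and R: "R > 0"
  shows "sqn (\<lambda>x. u t (c *\<^sub>R x) - u t x) \<le> (c - 1)\<^sup>2 * R\<^sup>2 * DIM('a) * B t + M0 / R ^ 6"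
proof -
  let ?d = "\<lambda>x. (norm (u t (c *\<^sub>R x) - u t x))\<^sup>2"
  define e where "e = 4 * C\<^sup>2 * ((6 / \<gamma>) ^ 6 / R ^ 6)"
  have e0: "e \<ge> 0" using \<gamma>_pos R by (simp add: e_def)
  have [measurable]: "u t \<in> borel_measurable borel" by (rule smooth_measurable[OF smooth_u])
  have [measurable]: "cball (0::'a) R \<in> sets borel" by simp
  have Ld: "(\<lambda>x. u t (c *\<^sub>R x) - u t x) \<in> L2"
    by (rule L2_diff[OF L2_dilate[OF u_L2] u_L2]) (use c in simp)
  have Ie: "integrable lborel (\<lambda>x::'a. exp (- \<gamma> * norm x))" by (rule integrable_exp_norm[OF \<gamma>_pos])
  have pt: "?d x \<le> indicator (cball 0 R) x * ?d x + e * exp (- \<gamma> * norm x)" for x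
  proof (cases "x \<in> cball 0 R")
    case False
    then have xR: "R \<le> norm x" by simp
    have "norm x \<le> norm (c *\<^sub>R x)" using c by (simp add: mult_le_cancel_right1)
    then have "exp (- \<gamma> * norm (c *\<^sub>R x)) \<le> exp (- \<gamma> * norm x)" using \<gamma>_pos by simp
    then have "C * exp (- \<gamma> * norm (c *\<^sub>R x)) \<le> C * exp (- \<gamma> * norm x)" using C_pos by simp
    then have "norm (u t (c *\<^sub>R x) - u t x) \<le> 2 * C * exp (- \<gamma> * norm x)"
      using norm_triangle_ineq4[of "u t (c *\<^sub>R x)" "u t x"] decay[of t "c *\<^sub>R x"] decay[of t x] by linarith
    then have "?d x \<le> (2 * C * exp (- \<gamma> * norm x))\<^sup>2" by (intro power_mono) auto
    also have "\<dots> = 4 * C\<^sup>2 * (exp (- \<gamma> * norm x) * exp (- \<gamma> * norm x))" by (simp add: power2_eq_square)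
    also have "\<dots> \<le> 4 * C\<^sup>2 * ((6 / \<gamma>) ^ 6 / R ^ 6 * exp (- \<gamma> * norm x))"
    proof (intro mult_left_mono mult_right_mono)
      have "exp (- \<gamma> * norm x) \<le> exp (- \<gamma> * R)" using xR \<gamma>_pos by simp
      also have "\<dots> \<le> (6 / \<gamma>) ^ 6 / R ^ 6" by (rule exp_le_inverse_power6[OF \<gamma>_pos R])
      finally show "exp (- \<gamma> * norm x) \<le> (6 / \<gamma>) ^ 6 / R ^ 6" .
    qed auto
    finally show ?thesis using False by (simp add: e_def mult_ac)
  qed (use e0 in simp)
  have "ennreal (sqn (\<lambda>x. u t (c *\<^sub>R x) - u t x)) = (\<integral>\<^sup>+x. ennreal (?d x) \<partial>lborel)"
    unfolding sqn_def by (rule nn_integral_eq_integral[symmetric]) (auto intro: L2_integrable[OF Ld])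
  also have "\<dots> \<le> (\<integral>\<^sup>+x. ennreal (indicator (cball 0 R) x * ?d x) + ennreal (e * exp (- \<gamma> * norm x)) \<partial>lborel)"
    using pt e0 by (intro nn_integral_mono) (simp add: ennreal_plus[symmetric] ennreal_leI del: ennreal_plus)
  also have "\<dots> = (\<integral>\<^sup>+x. ennreal (indicator (cball 0 R) x * ?d x) \<partial>lborel) + (\<integral>\<^sup>+x. ennreal (e * exp (- \<gamma> * norm (x::'a))) \<partial>lborel)"
    by (rule nn_integral_add) measurable
  also have "(\<integral>\<^sup>+x. ennreal (e * exp (- \<gamma> * norm (x::'a))) \<partial>lborel) = ennreal (M0 / R ^ 6)"
  proof -
    have "(\<integral>\<^sup>+x. ennreal (e * exp (- \<gamma> * norm (x::'a))) \<partial>lborel) = ennreal (LINT x|lborel. e * exp (- \<gamma> * norm (x::'a)))"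
      by (rule nn_integral_eq_integral) (use Ie e0 in auto)
    then show ?thesis by (simp add: M0_def e_def mult_ac)
  qed
  also have "(\<integral>\<^sup>+x. ennreal (indicator (cball 0 R) x * ?d x) \<partial>lborel) + ennreal (M0 / R ^ 6)
    \<le> ennreal ((c - 1)\<^sup>2 * R\<^sup>2 * DIM('a) * B t) + ennreal (M0 / R ^ 6)"
    unfolding B_def using R by (intro add_right_mono dilation_increment_ball[OF u_H2 c]) simp
  also have "\<dots> = ennreal ((c - 1)\<^sup>2 * R\<^sup>2 * DIM('a) * B t + M0 / R ^ 6)"
    using M0_nonneg R B_nonneg by (intro ennreal_plus[symmetric]) auto
  finally show ?thesis
    using M0_nonneg R B_nonneg[of t] by (subst (asm) ennreal_le_iff) auto
qed

definition V :: "real \<Rightarrow> real" where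
  "V t = 4 * A t + 2 * \<mu> * B t + \<epsilon> * (DIM('a) * p / (p + 2)) * N t"

lemma V_continuous: "continuous_on T V"
  unfolding V_def[abs_def]
  by (intro continuous_intros A_continuous B_continuous N_continuous continuous_on_id)

text \<open>\<open>W\<close> has integral 0 over a period for every c, by periodicity of
  \<open>J\<close>. Dividing by c - 1 and letting c tend to 1 gives \<open>V\<close> pointwise, and
  dominated convergence carries the vanishing over.\<close>

lemma virial_identity:
  assumes \<tau>: "\<tau> > 0" and per: "\<And>t x. u (t + \<tau>) x = u t x"
  shows "integral {0..\<tau>} V = 0"
proof -
  let ?n = "DIM('a)"
  define \<delta> where "\<delta> = (\<lambda>k::nat. 1 / real (Suc k) ^ 4)"
  define c where "c = (\<lambda>k. 1 + \<delta> k)"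
  have \<delta>: "\<delta> k > 0" for k by (simp add: \<delta>_def)
  have \<delta>0: "\<delta> \<longlonglongrightarrow> 0" unfolding \<delta>_def by real_asymp
  have c: "c k > 0" "c k \<ge> 1" "c k - 1 = \<delta> k" "c k \<noteq> 0" for k using \<delta>[of k] by (auto simp: c_def)
  have c1: "c \<longlonglongrightarrow> 1" unfolding c_def using tendsto_add[OF tendsto_const[of 1] \<delta>0] by simp
  \<comment> \<open>The three difference quotients at c = 1; cancelling the factor c - 1 gives their
    limits 4, 2 and n.\<close>
  define \<alpha> where "\<alpha> = (\<lambda>k. ((c k)\<^sup>2 - 1 / (c k)\<^sup>2) / \<delta> k)"
  define \<beta> where "\<beta> = (\<lambda>k. (c k - 1 / c k) / \<delta> k)"
  define \<eta> where "\<eta> = (\<lambda>k. (1 - 1 / c k ^ ?n) / \<delta> k)"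
  have \<alpha>: "\<alpha> \<longlonglongrightarrow> 4"
  proof -
    have "\<alpha> = (\<lambda>k. (c k + 1) * ((c k)\<^sup>2 + 1) / (c k)\<^sup>2)"
    proof
      fix k
      have "(c k)\<^sup>2 - 1 / (c k)\<^sup>2 = \<delta> k * ((c k + 1) * ((c k)\<^sup>2 + 1) / (c k)\<^sup>2)"
        unfolding c(3)[symmetric] using c(4)[of k] by (simp add: field_simps power2_eq_square)
      then show "\<alpha> k = (c k + 1) * ((c k)\<^sup>2 + 1) / (c k)\<^sup>2" using \<delta>[of k] by (simp add: \<alpha>_def)
    qed
    moreover have "(\<lambda>k. (c k + 1) * ((c k)\<^sup>2 + 1) / (c k)\<^sup>2) \<longlonglongrightarrow> (1 + 1) * (1\<^sup>2 + 1) / 1\<^sup>2"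
      by (intro tendsto_intros c1) auto
    ultimately show ?thesis by simp
  qed
  have \<beta>: "\<beta> \<longlonglongrightarrow> 2"
  proof -
    have "\<beta> = (\<lambda>k. (c k + 1) / c k)"
    proof
      fix k
      have "c k - 1 / c k = \<delta> k * ((c k + 1) / c k)"
        unfolding c(3)[symmetric] using c(4)[of k] by (simp add: field_simps)
      then show "\<beta> k = (c k + 1) / c k" using \<delta>[of k] by (simp add: \<beta>_def)
    qed
    moreover have "(\<lambda>k. (c k + 1) / c k) \<longlonglongrightarrow> (1 + 1) / 1"
      by (intro tendsto_intros c1) auto
    ultimately show ?thesis by simp
  qed
  have \<eta>: "\<eta> \<longlonglongrightarrow> real ?n"
  proof -
    have "\<eta> = (\<lambda>k. (\<Sum>i<?n. c k ^ i) / c k ^ ?n)"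
    proof
      fix k
      have "1 - 1 / c k ^ ?n = \<delta> k * ((\<Sum>i<?n. c k ^ i) / c k ^ ?n)"
      proof -
        have "1 - 1 / c k ^ ?n = (c k ^ ?n - 1) / c k ^ ?n" using c(4)[of k] by (simp add: diff_divide_distrib)
        then show ?thesis using power_diff_1_eq[of "c k" ?n] unfolding c(3) by simp
      qed
      then show "\<eta> k = (\<Sum>i<?n. c k ^ i) / c k ^ ?n" using \<delta>[of k] by (simp add: \<eta>_def)
    qed
    moreover have "(\<lambda>k. (\<Sum>i<?n. c k ^ i) / c k ^ ?n) \<longlonglongrightarrow> (\<Sum>i<?n. 1 ^ i) / 1 ^ ?n"
      by (intro tendsto_intros c1) auto
    ultimately show ?thesis by simp
  qed
  have bounded: "\<exists>L\<ge>0. \<forall>k. \<bar>x k\<bar> \<le> L" if "x \<longlonglongrightarrow> l" for x :: "nat \<Rightarrow> real" and l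
    using convergent_imp_Bseq[OF convergentI[OF that]] unfolding Bseq_def real_norm_def by (meson less_imp_le)
  obtain La where La: "La \<ge> 0" "\<And>k. \<bar>\<alpha> k\<bar> \<le> La" using bounded[OF \<alpha>] by blast
  obtain Lb where Lb: "Lb \<ge> 0" "\<And>k. \<bar>\<beta> k\<bar> \<le> Lb" using bounded[OF \<beta>] by blast
  obtain Ln where Ln: "Ln \<ge> 0" "\<And>k. \<bar>\<eta> k\<bar> \<le> Ln" using bounded[OF \<eta>] by blast
  define a where "a = (\<lambda>k t. Re (ip (dil (c k) (laplacian (u t))) (laplacian (u t))))"
  define b where "b = (\<lambda>k t. \<Sum>b\<in>Basis. Re (ip (dil (c k) (partial b (u t))) (partial b (u t))))"
  define err where "err = (\<lambda>k t. Y (c k) t - p / (p + 2) * (1 - 1 / c k ^ ?n) * N t)"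
  define f where "f = (\<lambda>k t. W (c k) t / \<delta> k)"
  have f_eq: "f k t = \<alpha> k * a k t + \<mu> * \<beta> k * b k t + \<epsilon> * (p / (p + 2) * \<eta> k * N t + err k t / \<delta> k)" for k t
  proof -
    have "W (c k) t = ((c k)\<^sup>2 - 1 / (c k)\<^sup>2) * a k t + \<mu> * (c k - 1 / c k) * b k t
        + \<epsilon> * (p / (p + 2) * (1 - 1 / c k ^ ?n) * N t + err k t)"
      unfolding W_eq[OF c(1)] a_def b_def err_def by simp
    then show ?thesis
      unfolding f_def \<alpha>_def \<beta>_def \<eta>_def using \<delta>[of k] by (simp add: add_divide_distrib distrib_left)
  qed
  define m where "m = (\<lambda>t. (2 + p) * C powr p * (?n * B t + M0))"
  have m0: "m t \<ge> 0" for t unfolding m_def using p_pos M0_nonneg B_nonneg[of t] by simp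
  text \<open>The increment is split at the radius \<open>R = k + 1\<close>: with \<open>\<delta>\<close> equal to \<open>1 / R\<^sup>4\<close>, both the inner part, of order \<open>\<delta>\<^sup>2 R\<^sup>2\<close>,
    and the tail, of order \<open>1 / R\<^sup>6\<close>, are negligible against \<open>\<delta>\<close>.\<close>
  have err_le: "\<bar>err k t / \<delta> k\<bar> \<le> m t / real (Suc k) ^ 2" for k t
  proof -
    let ?r = "real (Suc k)"
    have r: "?r > 0" by simp
    have "(\<delta> k)\<^sup>2 * ?r\<^sup>2 * ?n * B t + M0 / ?r ^ 6 = (?n * B t + M0) / ?r ^ 6"
    proof -
      have "(\<delta> k)\<^sup>2 * ?r\<^sup>2 = 1 / ?r ^ 6"
        unfolding \<delta>_def using r by (simp add: power_divide power_mult[symmetric] divide_simps power_add[symmetric] del: of_nat_Suc)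
      then show ?thesis by (simp add: add_divide_distrib del: of_nat_Suc)
    qed
    then have "sqn (\<lambda>x. u t (c k *\<^sub>R x) - u t x) \<le> (?n * B t + M0) / ?r ^ 6"
      using dilation_increment_le[OF c(2)[of k] r, of t] unfolding c(3) by simp
    then have "(2 + p) * C powr p * sqn (\<lambda>x. u t (c k *\<^sub>R x) - u t x) \<le> (2 + p) * C powr p * ((?n * B t + M0) / ?r ^ 6)"
      using p_pos by (intro mult_left_mono) auto
    then have "\<bar>err k t\<bar> \<le> m t / ?r ^ 6"
      using Y_estimate[OF c(1)[of k], of t] unfolding err_def m_def by (simp add: mult.assoc)
    then have "\<bar>err k t\<bar> / \<delta> k \<le> m t / ?r ^ 6 / \<delta> k"
      using \<delta>[of k] by (intro divide_right_mono) auto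
    also have "m t / ?r ^ 6 / \<delta> k = m t / ?r ^ 2"
      unfolding \<delta>_def using r by (simp add: divide_simps power_add[symmetric] del: of_nat_Suc)
    finally show ?thesis using \<delta>[of k] by (simp add: abs_divide)
  qed
  have a_le: "\<bar>a k t\<bar> \<le> A t" for k t
    unfolding a_def A_def by (rule Re_ip_dilate_le[OF lap_L2 c(2)])
  have b_le: "\<bar>b k t\<bar> \<le> B t" for k t
    unfolding b_def B_def
    by (rule order_trans[OF sum_abs sum_mono[OF Re_ip_dilate_le[OF partial_L2 c(2)]]])
  \<comment> \<open>A majorant independent of k: bounds on the convergent quotients, times integrals
    that the dilated pairings do not exceed. It is continuous in t, hence integrable over the
    period.\<close>
  define h where "h = (\<lambda>t. La * A t + \<bar>\<mu>\<bar> * Lb * B t + \<bar>\<epsilon>\<bar> * (p / (p + 2) * Ln * N t + m t))"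
  have "(\<lambda>k. integral {0..\<tau>} (f k)) \<longlonglongrightarrow> integral {0..\<tau>} V"
  proof (rule dominated_convergence(2))
    show "f k integrable_on {0..\<tau>}" for k
      unfolding f_def by (intro integrable_continuous_interval continuous_intros W_continuous c) (use \<delta>[of k] in simp)
    show "h integrable_on {0..\<tau>}"
      unfolding h_def m_def
      by (intro integrable_continuous_interval continuous_intros A_continuous B_continuous N_continuous continuous_on_id)
    show "norm (f k t) \<le> h t" for k t
    proof -
      have 1: "\<bar>\<alpha> k * a k t\<bar> \<le> La * A t"
        unfolding abs_mult using La a_le by (intro mult_mono) auto
      have 2: "\<bar>\<mu> * \<beta> k * b k t\<bar> \<le> \<bar>\<mu>\<bar> * Lb * B t"
        unfolding abs_mult using Lb b_le by (intro mult_mono) auto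
      have 3: "\<bar>p / (p + 2) * \<eta> k * N t\<bar> \<le> p / (p + 2) * Ln * N t"
        unfolding abs_mult using Ln N_nonneg p_pos by (intro mult_mono) auto
      have 4: "\<bar>err k t / \<delta> k\<bar> \<le> m t"
      proof -
        have "m t / real (Suc k) ^ 2 \<le> m t / 1"
          using m0 by (intro divide_left_mono) auto
        then show ?thesis using err_le[of k t] by simp
      qed
      have "\<bar>p / (p + 2) * \<eta> k * N t + err k t / \<delta> k\<bar> \<le> p / (p + 2) * Ln * N t + m t"
        using 3 4 by linarith
      then have "\<bar>\<epsilon> * (p / (p + 2) * \<eta> k * N t + err k t / \<delta> k)\<bar> \<le> \<bar>\<epsilon>\<bar> * (p / (p + 2) * Ln * N t + m t)"
        unfolding abs_mult[of \<epsilon>] by (intro mult_left_mono) auto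
      with 1 2 show ?thesis unfolding f_eq h_def real_norm_def by linarith
    qed
    show "(\<lambda>k. f k t) \<longlonglongrightarrow> V t" for t
    proof -
      have a: "(\<lambda>k. a k t) \<longlonglongrightarrow> A t"
        unfolding a_def A_def
        by (rule Re_ip_dilate_tendsto[OF lap_L2 smooth_continuous[OF smooth_laplacian[OF smooth_u]] c(2) c1])
      have b: "(\<lambda>k. b k t) \<longlonglongrightarrow> B t"
        unfolding b_def B_def
        by (rule tendsto_sum, rule Re_ip_dilate_tendsto[OF partial_L2 smooth_continuous[OF smooth_partial[OF smooth_u]] c(2) c1])
      have e: "(\<lambda>k. err k t / \<delta> k) \<longlonglongrightarrow> 0"
      proof (rule Lim_null_comparison)
        show "\<forall>\<^sub>F k in sequentially. norm (err k t / \<delta> k) \<le> m t / real (Suc k) ^ 2"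
          using err_le by simp
        show "(\<lambda>k. m t / real (Suc k) ^ 2) \<longlonglongrightarrow> 0" by real_asymp
      qed
      have "(\<lambda>k. f k t) \<longlonglongrightarrow> 4 * A t + \<mu> * 2 * B t + \<epsilon> * (p / (p + 2) * real ?n * N t + 0)"
        unfolding f_eq by (intro tendsto_intros \<alpha> \<beta> \<eta> a b e)
      then show ?thesis by (simp add: V_def mult_ac)
    qed
  qed
  moreover have "integral {0..\<tau>} (f k) = 0" for k
    unfolding f_def using W_integral[OF c(1) \<tau> per] by simp
  ultimately show ?thesis by (simp add: LIMSEQ_const_iff)
qed

section \<open>Integrals whose vanishing forces the solution to vanish\<close>

lemma vanish_all:
  assumes "\<And>x. u s x = 0" shows "u t x = 0"
proof (rule sqn_eq_0[OF u_L2 smooth_continuous[OF smooth_u]])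
  show "sqn (u t) = 0" using mass_const[of t s] assms by (simp add: sqn_def)
qed

lemma N_zero_imp: "N t = 0 \<Longrightarrow> u t x = 0"
proof (rule continuous_AE_zero[OF smooth_continuous[OF smooth_u]])
  assume "N t = 0"
  then have "AE x in lborel. norm (u t x) powr (p + 2) = 0"
    using integral_nonneg_eq_0_iff_AE[OF N_integrable[of t]] by (simp add: N_def)
  then show "AE x in lborel. u t x = 0" by simp
qed

text \<open>A single basis direction suffices: the function is constant along each line in this
  direction and decays there, so the constant is 0.\<close>

lemma B_zero_imp: 
  assumes "B t = 0" shows "u t x = 0"
proof -
  obtain b :: 'a where b: "b \<in> Basis" using nonempty_Basis by blast
  have "sqn (partial b (u t)) = 0"
    using assms b unfolding B_def by (subst (asm) sum_nonneg_eq_0_iff) auto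
  then have z: "partial b (u t) y = 0" for y
    by (rule sqn_eq_0[OF partial_L2[OF b] smooth_continuous[OF smooth_partial[OF smooth_u b]]])
  have "((\<lambda>s. u t (x + s *\<^sub>R b)) has_vector_derivative 0) (at s)" for s
    using has_partial_line[OF smooth_has_partial[OF smooth_u b], of t x s] by (simp add: z)
  then obtain k where k: "\<And>s. u t (x + s *\<^sub>R b) = k"
    using has_vector_derivative_zero_constant[of UNIV "\<lambda>s. u t (x + s *\<^sub>R b)"] by auto
  have "norm k \<le> C * exp (- \<gamma> * (s - norm x))" if "s > 0" for s
  proof -
    have "s = norm (s *\<^sub>R b)" using b that by simp
    also have "\<dots> \<le> norm (x + s *\<^sub>R b) + norm x"
      using norm_triangle_ineq4[of "x + s *\<^sub>R b" x] by simp
    finally have "exp (- \<gamma> * norm (x + s *\<^sub>R b)) \<le> exp (- \<gamma> * (s - norm x))"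
      using \<gamma>_pos by simp
    then have "C * exp (- \<gamma> * norm (x + s *\<^sub>R b)) \<le> C * exp (- \<gamma> * (s - norm x))"
      using C_pos by simp
    then show ?thesis using decay[of t "x + s *\<^sub>R b"] k[of s] by simp
  qed
  then have "\<forall>\<^sub>F s in at_top. norm k \<le> C * exp (- \<gamma> * (s - norm x))"
    by (intro eventually_mono[OF eventually_gt_at_top[of 0]])
  moreover have "((\<lambda>s. C * exp (- \<gamma> * (s - norm x))) \<longlongrightarrow> 0) at_top"
    using \<gamma>_pos by real_asymp
  ultimately have "norm k \<le> 0"
    by (intro tendsto_lowerbound[of _ 0 at_top "norm k"]) auto
  then show ?thesis using k[of 0] by simp
qed

text \<open>A vanishing Laplacian reduces to a vanishing gradient by pairing it with the function
  itself.\<close>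

lemma A_zero_imp:
  assumes "A t = 0" shows "u t x = 0"
proof (rule B_zero_imp)
  have "laplacian (u t) y = 0" for y
    using assms unfolding A_def
    by (rule sqn_eq_0[OF lap_L2 smooth_continuous[OF smooth_laplacian[OF smooth_u]]])
  then have "complex_of_real (B t) = 0"
    using smooth_H2_Green[OF u_H2, of t] by (simp add: B_def ip_def)
  then show "B t = 0" by simp
qed

text \<open>The first form uses the energy to eliminate \<open>N\<close>, the second to eliminate
  \<open>B\<close>; which one shows the sign of \<open>V\<close> depends on the regime.\<close>

lemma V_energy:
  "V t = (DIM('a) * p / 2) * energy \<mu> \<epsilon> p (u t) + (4 - DIM('a) * p / 2) * A t + \<mu> * (2 - DIM('a) * p / 2) * B t"
  "V t = 2 * energy \<mu> \<epsilon> p (u t) + 2 * A t + \<epsilon> * ((DIM('a) * p - 4) / (p + 2)) * N t"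
proof -
  show "V t = (DIM('a) * p / 2) * energy \<mu> \<epsilon> p (u t) + (4 - DIM('a) * p / 2) * A t + \<mu> * (2 - DIM('a) * p / 2) * B t"
    unfolding V_def energy_ABN divide_inverse[of _ "p + 2"] by (simp add: algebra_simps)
  show "V t = 2 * energy \<mu> \<epsilon> p (u t) + 2 * A t + \<epsilon> * ((DIM('a) * p - 4) / (p + 2)) * N t"
    unfolding V_def energy_ABN divide_inverse[of _ "p + 2"] by (simp add: algebra_simps)
qed

text \<open>A continuous function of constant sign with integral 0 over [0, \<tau>] vanishes there,
  in particular at the end point 0.\<close>

lemma V_sign_imp_zero:
  assumes "\<tau> > 0" "\<And>t x. u (t + \<tau>) x = u t x" and sign: "(\<forall>t. V t \<ge> 0) \<or> (\<forall>t. V t \<le> 0)"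
  shows "V 0 = 0"
proof -
  have I: "integral {0..\<tau>} V = 0" by (rule virial_identity[OF assms(1,2)])
  from sign show ?thesis
  proof
    assume "\<forall>t. V t \<ge> 0"
    then have "\<forall>t\<in>{0..\<tau>}. V t = 0"
      using integral_eq_0_iff[of 0 \<tau> V] V_continuous assms(1) I by auto
    then show ?thesis using assms(1) by auto
  next
    assume "\<forall>t. V t \<le> 0"
    moreover have "integral {0..\<tau>} (\<lambda>t. - V t) = 0" using I by simp
    ultimately have "\<forall>t\<in>{0..\<tau>}. - V t = 0"
      using integral_eq_0_iff[of 0 \<tau> "\<lambda>t. - V t"] continuous_on_minus[OF V_continuous] assms(1) by auto
    then show ?thesis using assms(1) by auto
  qed
qed

lemma periodic_vanishes:
  fixes t\<^sub>0 :: real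
  defines "n \<equiv> real DIM('a)" and "E \<equiv> energy \<mu> \<epsilon> p (u t\<^sub>0)"
  assumes per: "\<tau> > 0" "\<And>t x. u (t + \<tau>) x = u t x"
    and regime: "(\<epsilon> = 1 \<and> \<mu> \<ge> 0)
       \<or> (\<epsilon> = - 1 \<and> ((p < 8 / n \<and> \<mu> \<le> 0 \<and> E \<ge> 0) \<or> (8 / n < p \<and> \<mu> \<ge> 0 \<and> E \<le> 0)))
       \<or> (p = 8 / n \<and> (E, \<mu>) \<noteq> (0, 0) \<and> \<mu> * E \<le> 0)"
  shows "u t x = 0"
proof -
  have n: "n > 0" by (simp add: n_def)
  have E: "energy \<mu> \<epsilon> p (u t) = E" for t unfolding E_def by (rule energy_conserved)
  have V1: "V t = n * p / 2 * E + (4 - n * p / 2) * A t + \<mu> * (2 - n * p / 2) * B t" for t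
    using V_energy(1)[of t] by (simp add: E n_def)
  have V2: "V t = 2 * E + 2 * A t + \<epsilon> * ((n * p - 4) / (p + 2)) * N t" for t
    using V_energy(2)[of t] by (simp add: E n_def)
  note nonneg = A_nonneg B_nonneg N_nonneg
  note V0 = V_sign_imp_zero[OF per]
  have np: "n * p > 0" using n p_pos by simp
  have d: "p < 8 / n \<longleftrightarrow> n * p < 8" "8 / n < p \<longleftrightarrow> 8 < n * p" "p = 8 / n \<longleftrightarrow> n * p = 8"
    using n by (auto simp: field_simps)
  have "u 0 x = 0" for x
  proof -
    \<comment> \<open>For \<epsilon> = -1 and n p < 8 the term \<mu> (2 - n p / 2) B is nonnegative,
      given \<mu> \<le> 0, only from n p = 4 on. Up to n p = 4 the form without \<open>B\<close> is
      used, where (n p - 4) \<epsilon> is nonnegative.\<close>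
    from regime consider
        "\<epsilon> = 1" "\<mu> \<ge> 0"
      | "\<epsilon> = - 1" "n * p \<le> 4" "E \<ge> 0"
      | "n * p > 4" "n * p < 8" "\<mu> \<le> 0" "E \<ge> 0"
      | "n * p > 8" "\<mu> \<ge> 0" "E \<le> 0"
      | "n * p = 8" "(E, \<mu>) \<noteq> (0, 0)" "\<mu> * E \<le> 0"
      unfolding d by (cases "n * p \<le> 4") (auto simp: not_le)
    then show ?thesis
    proof cases
      case 1
      have le: "n * p / (p + 2) * N t \<le> V t" for t
        unfolding V_def using 1 nonneg[of t] by (simp add: n_def mult_nonneg_nonneg)
      have nn: "0 \<le> n * p / (p + 2) * N t" for t
        using np p_pos nonneg[of t] by simp
      have "V 0 = 0" using V0 order_trans[OF nn le] by blast
      then have "n * p / (p + 2) * N 0 = 0" using le[of 0] nn[of 0] by simp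
      then have "N 0 = 0" using n p_pos by simp
      then show ?thesis by (rule N_zero_imp)
    next
      case 2
      have "0 \<le> (4 - n * p) / (p + 2) * N t" for t
        using 2 p_pos nonneg[of t] by simp
      moreover have "\<epsilon> * ((n * p - 4) / (p + 2)) = (4 - n * p) / (p + 2)"
        using 2 by (simp add: minus_divide_left)
      ultimately have le: "2 * A t \<le> V t" for t unfolding V2 using 2 by simp
      have "0 \<le> V t" for t using le[of t] nonneg[of t] by linarith
      then have "V 0 = 0" using V0 by blast
      then have "A 0 = 0" using le[of 0] nonneg[of 0] by linarith
      then show ?thesis by (rule A_zero_imp)
    next
      case 3
      have "0 \<le> n * p / 2 * E" using 3 np by simp
      moreover have "0 \<le> \<mu> * (2 - n * p / 2) * B t" for t
        using 3 nonneg[of t] by (intro mult_nonneg_nonneg mult_nonpos_nonpos) auto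
      ultimately have le: "(4 - n * p / 2) * A t \<le> V t" for t unfolding V1 by (simp add: add_increasing add_increasing2)
      have nn: "0 \<le> (4 - n * p / 2) * A t" for t using 3 nonneg[of t] by (intro mult_nonneg_nonneg) auto
      have "V 0 = 0" using V0 order_trans[OF nn le] by blast
      then have "(4 - n * p / 2) * A 0 = 0" using le[of 0] nn[of 0] by simp
      then have "A 0 = 0" using 3 by simp
      then show ?thesis by (rule A_zero_imp)
    next
      case 4
      have "n * p / 2 * E \<le> 0" using 4 np by (intro mult_nonneg_nonpos) auto
      moreover have "\<mu> * (2 - n * p / 2) * B t \<le> 0" for t
        using 4 nonneg[of t] by (intro mult_nonpos_nonneg mult_nonneg_nonpos) auto
      ultimately have le: "V t \<le> (4 - n * p / 2) * A t" for t unfolding V1 by (smt (verit))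
      have np': "(4 - n * p / 2) * A t \<le> 0" for t using 4 nonneg[of t] by (intro mult_nonpos_nonneg) auto
      have "V 0 = 0" using V0 order_trans[OF le np'] by blast
      then have "(4 - n * p / 2) * A 0 = 0" using le[of 0] np'[of 0] by simp
      then have "A 0 = 0" using 4 by simp
      then show ?thesis by (rule A_zero_imp)
    next
      case 5
      \<comment> \<open>At n p = 8 the coefficient of \<open>A\<close> vanishes, so the sign is
        decided by \<open>E\<close> and \<mu> alone and the conclusion must come from
        \<open>B\<close>.\<close>
      have V: "V t = 4 * E - 2 * \<mu> * B t" for t unfolding V1 using 5(1) by simp
      consider "\<mu> = 0" "E \<noteq> 0" | "\<mu> > 0" "E \<le> 0" | "\<mu> < 0" "E \<ge> 0"
        using 5(2,3) by (cases \<mu> "0 :: real" rule: linorder_cases) (auto simp: mult_le_0_iff)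
      then show ?thesis
      proof cases
        case 1
        \<comment> \<open>Here \<open>V\<close> is the constant 4 E, which is nonzero; its vanishing
          at 0 is the contradiction.\<close>
        then have "V 0 = 0" using V0 V by (cases "E \<ge> 0") auto
        with V[of 0] have "4 * E - 2 * \<mu> * B 0 = 0" by simp
        with 1 show ?thesis by simp
      next
        case 2
        have nn: "0 \<le> 2 * \<mu> * B t" for t using 2 nonneg[of t] by simp
        have "V t \<le> 0" for t unfolding V using nn[of t] 2 by linarith
        then have "V 0 = 0" using V0 by blast
        then have "2 * \<mu> * B 0 = 0" unfolding V using nn[of 0] 2 by linarith
        then have "B 0 = 0" using 2 by simp
        then show ?thesis by (rule B_zero_imp)
      next
        case 3
        have nn: "2 * \<mu> * B t \<le> 0" for t using 3 nonneg[of t] by (simp add: mult_le_0_iff)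
        have "V t \<ge> 0" for t unfolding V using nn[of t] 3 by linarith
        then have "V 0 = 0" using V0 by blast
        then have "2 * \<mu> * B 0 = 0" unfolding V using nn[of 0] 3 by linarith
        then have "B 0 = 0" using 3 by simp
        then show ?thesis by (rule B_zero_imp)
      qed
    qed
  qed
  then show ?thesis by (rule vanish_all)
qed

end

theorem theorem4p4:
  fixes u :: "real \<Rightarrow> real ^ 'n \<Rightarrow> complex"
    and \<mu> \<epsilon> p t\<^sub>0 :: real
  defines "n \<equiv> CARD('n)"
    and "E \<equiv> energy \<mu> \<epsilon> p (u t\<^sub>0)"
  assumes "\<epsilon> \<in> {1, - 1}"
    and "0 < p" and "ereal p < p_crit n"
    and "(\<epsilon> = 1 \<and> \<mu> \<ge> 0)
       \<or> (\<epsilon> = - 1 \<and>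
           ((p < 8 / real n \<and> ereal (8 / real n) < p_crit n \<and> \<mu> \<le> 0 \<and> E \<ge> 0)
          \<or> (8 / real n < p \<and> ereal p < p_crit n \<and> \<mu> \<ge> 0 \<and> E \<le> 0)))
       \<or> (\<epsilon> \<in> {1, - 1} \<and> p = 8 / real n \<and> (E, \<mu>) \<noteq> (0, 0) \<and> \<mu> * E \<le> 0)"
  shows "\<not> breather \<mu> \<epsilon> p u"
proof
  assume "breather \<mu> \<epsilon> p u"
  then obtain s y and \<tau> C \<gamma> :: real and k where b: "biharmonic_NLS_solution \<mu> \<epsilon> p u" "u s y \<noteq> 0"
    "\<tau> > 0" "C > 0" "\<gamma> > 0" "\<forall>t x. u (t + \<tau>) x = u t x" "\<forall>t. smooth (u t) \<and> u t \<in> H2"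
    "\<forall>x. \<forall>\<alpha>\<in>multi_indices. length \<alpha> \<le> k \<longrightarrow> (\<forall>t. norm (partials \<alpha> (u t) x) \<le> C * exp (- \<gamma> * norm x))"
    unfolding breather_def by blast
  \<comment> \<open>The empty multi-index is admissible for every k and bounds \<open>u\<close>
    itself.\<close>
  have decay: "norm (u t x) \<le> C * exp (- \<gamma> * norm x)" for t x
    using b(8)[rule_format, of "[]" t x] by simp
  interpret nls u \<mu> \<epsilon> p C \<gamma>
    by unfold_locales (use b decay assms(4) in auto)
  have "u s y = 0"
    by (rule periodic_vanishes[where \<tau> = \<tau> and t\<^sub>0 = t\<^sub>0]) (use b assms in auto)
  with b(2) show False by contradiction
qed

end
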